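(* Let $\mathcal{K}$ and $\mathcal{H}$ be two collections of posets, each $\mathcal{C}$ in $\mathcal{K}$ equipped with a subcanonical Grothendieck topology $J_{\mathcal{C}}$ and each $\mathcal{D}$ in $\mathcal{H}$ with a subcanonical Grothendieck topology $K_{\mathcal{D}}$. Let $f:\mathcal{K}\to\mathcal{H}$ and $g:\mathcal{H}\to\mathcal{K}$ be functions inverse to each other up to isomorphism, and suppose that for each $\mathcal{C}$ in $\mathcal{K}$ there is a categorical equivalence $\mathbf{Sh}(\mathcal{C},J_{\mathcal{C}})\simeq\mathbf{Sh}(f(\mathcal{C}),K_{f(\mathcal{C})})$. Let $U$ and $V$ be invariant properties of families of elements of frames such that: (a) for any $\mathcal{C}$ in $\mathcal{K}$ (resp. $\mathcal{D}$ in $\mathcal{H}$) and any family $\mathcal{F}$ of principal $J_{\mathcal{C}}$-ideals on $\mathcal{C}$ (resp. principal $K_{\mathcal{D}}$-ideals on $\mathcal{D}$), $\mathcal{F}$ has a refinement satisfying $U$ (resp. $V$) if and only if it has such a refinement made of principal $J_{\mathcal{C}}$-ideals (resp. principal $K_{\mathcal{D}}$-ideals); (b) all the topologies $J_{\mathcal{C}}$ are $U$-induced and all the topologies $K_{\mathcal{D}}$ are $V$-induced. Let $\mathrm{Ext}(\mathcal{K})$ be the category whose objects are the posets isomorphic to a poset in $\mathcal{K}$ (with the correspondingly transported topology) and whose arrows $\mathcal{C}\to\mathcal{C}'$ are the monotone maps $h$ which are morphisms of sites $(\mathcal{C},J_{\mathcal{C}})\to(\mathcal{C}',J_{\mathcal{C}'})$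 and such that the frame homomorphism $A(h):\mathrm{Id}_{J_{\mathcal{C}}}(\mathcal{C})\to\mathrm{Id}_{J_{\mathcal{C}'}}(\mathcal{C}')$ sends $V$-compact elements to $V$-compact elements and its restriction $V\text{-comp}(\mathrm{Id}_{J_{\mathcal{C}}}(\mathcal{C}))\to V\text{-comp}(\mathrm{Id}_{J_{\mathcal{C}'}}(\mathcal{C}'))$ is a morphism of sites for the topologies induced on these posets by the canonical topologies of the two frames. Let $\mathrm{Ext}(\mathcal{H})$ be defined symmetrically ($\mathcal{H}$ in place of $\mathcal{K}$, the topologies $K_{\mathcal{D}}$ in place of the $J_{\mathcal{C}}$, and $U$ in place of $V$). Let $D:\mathrm{Ext}(\mathcal{K})\to\mathrm{Ext}(\mathcal{H})$ be the functor sending $\mathcal{C}$ to the poset $V\text{-comp}(\mathrm{Id}_{J_{\mathcal{C}}}(\mathcal{C}))$ and $h:\mathcal{C}\to\mathcal{C}'$ to the restriction of $A(h)$ to the subsets of $V$-compact elements, and let $E:\mathrm{Ext}(\mathcal{H})\to\mathrm{Ext}(\mathcal{K})$ be defined symmetrically. Then $D$ and $E$ are categorical inverses to each other and hence define a categorical equivalence between $\mathrm{Ext}(\mathcal{K})$ and $\mathrm{Ext}(\mathcal{H})$.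
   Context: Posets are regarded as categories. A $J$-ideal on $\mathcal{C}$ is a lower set $I$ such that whenever all elements of a $J$-covering sieve on $c$ lie in $I$, also $c\in I$; $\mathrm{Id}_J(\mathcal{C})$ is the frame of $J$-ideals ordered by inclusion. The principal $J$-ideal of $c$ is the smallest $J$-ideal containing $c$ (equal to $\{d\mid d\le c\}$ if $J$ is subcanonical). $J$ is subcanonical if each $c$ is the supremum of every $J$-covering sieve on it. A morphism of sites $h:(\mathcal{C},J)\to(\mathcal{C}',J')$ between posets is a monotone map such that: for every $d\in\mathcal{C}'$ there is $c$ with $d\le h(c)$; whenever $d\le h(c),h(c')$ there is $c''\le c,c'$ with $d\le h(c'')$; and the image of each $J$-covering sieve generates a $J'$-covering sieve. For such $h$, $A(h)$ sends a $J$-ideal $I$ to the smallest $J'$-ideal containing $h(I)$. The canonical topology on a frame $L$ has as covering sieves on $l$ the sieves with join $l$; the topology it induces on a subset $B\subseteq L$ has as covering sieves on $b\in B$ the sieves in $B$ which generate a covering sieve in $L$. A family $\{b_j\}$ in a frame refines $\{a_i\}$ if each $b_j\le a_i$ for some $i$ and $\bigvee_jb_j=\bigvee_ia_i$. An invariant property of families of elements of frames is one stable under frame isomorphism (equivalently, a topos-theoretic invariant property of families of subterminal objects). For an invariant $C$, an element $l$ of a frame $L$ is $C$-compact if every family with join $l$ has a refinement satisfying $C$; $C\text{-comp}(L)$ is the poset of $C$-compact elements. $C$-induced: let $\mathcal{K}$ be a collection of posets with topologies and let $P$ be an invariant property of embeddings $B_L\hookrightarrow L$ of a basis $B_L$ of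 a frame $L$ (a subset of which every element of $L$ is a join) which holds for all canonical embeddings $\mathcal{C}\hookrightarrow\mathrm{Id}_{J_{\mathcal{C}}}(\mathcal{C})$, $c\mapsto\{d\mid d\le c\}$, $\mathcal{C}$ in $\mathcal{K}$. $J_{\mathcal{C}}$ is $C$-induced relative to $P$ if for every frame $L$ and every monotone embedding $i:\mathcal{C}\hookrightarrow L$ whose image is a basis of $L$, satisfying $P$ and sending $J_{\mathcal{C}}$-covering sieves to covering families in $L$, the following holds for every family $\mathcal{A}$ of elements of $\mathcal{C}$: there exists $c\in\mathcal{C}$ with $a\le c$ for all $a\in\mathcal{A}$ such that the sieve on $c$ generated by $\mathcal{A}$ is $J_{\mathcal{C}}$-covering if and only if $i(\mathcal{A})$ has a refinement in $L$ satisfying $C$ made of elements $i(c')$, $c'\in\mathcal{C}$. $J_{\mathcal{C}}$ is $C$-induced if it is so relative to some such $P$. *)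

theory Defs
  imports "HOL-Algebra.Complete_Lattice"
begin

section \<open>Categories, functors and equivalences\<close>

text \<open>Arrows need not determine their source and target (they will be functions), so composition,
  identities and the arrow part of a functor are indexed by objects.
  \<open>comp \<C> x y z b a\<close> is the composite of \<open>a : x \<rightarrow> y\<close> followed by \<open>b : y \<rightarrow> z\<close>.\<close>

record ('o, 'a) cat =
  obj :: "'o set"
  homs :: "'o \<Rightarrow> 'o \<Rightarrow> 'a set"
  ide :: "'o \<Rightarrow> 'a"
  comp :: "'o \<Rightarrow> 'o \<Rightarrow> 'o \<Rightarrow> 'a \<Rightarrow> 'a \<Rightarrow> 'a"

locale category =
  fixes \<C> :: "('o, 'a) cat"
  assumes ide_in: "x \<in> obj \<C> \<Longrightarrow> ide \<C> x \<in> homs \<C> x x"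
    and comp_in: "\<lbrakk>x \<in> obj \<C>; y \<in> obj \<C>; z \<in> obj \<C>; a \<in> homs \<C> x y; b \<in> homs \<C> y z\<rbrakk>
      \<Longrightarrow> comp \<C> x y z b a \<in> homs \<C> x z"
    and comp_ide_right: "\<lbrakk>x \<in> obj \<C>; y \<in> obj \<C>; a \<in> homs \<C> x y\<rbrakk> \<Longrightarrow> comp \<C> x x y a (ide \<C> x) = a"
    and comp_ide_left: "\<lbrakk>x \<in> obj \<C>; y \<in> obj \<C>; a \<in> homs \<C> x y\<rbrakk> \<Longrightarrow> comp \<C> x y y (ide \<C> y) a = a"
    and comp_assoc: "\<lbrakk>w \<in> obj \<C>; x \<in> obj \<C>; y \<in> obj \<C>; z \<in> obj \<C>;
        a \<in> homs \<C> w x; b \<in> homs \<C> x y; c \<in> homs \<C> y z\<rbrakk>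
      \<Longrightarrow> comp \<C> w x z (comp \<C> x y z c b) a = comp \<C> w y z c (comp \<C> w x y b a)"

record ('o, 'a, 'p, 'b) func =
  on_obj :: "'o \<Rightarrow> 'p"
  on_arr :: "'o \<Rightarrow> 'o \<Rightarrow> 'a \<Rightarrow> 'b"

locale cat_functor = source: category \<A> + target: category \<B>
  for \<A> :: "('o, 'a) cat" and \<B> :: "('p, 'b) cat" +
  fixes F :: "('o, 'a, 'p, 'b) func"
  assumes on_obj_in: "x \<in> obj \<A> \<Longrightarrow> on_obj F x \<in> obj \<B>"
    and on_arr_in: "\<lbrakk>x \<in> obj \<A>; y \<in> obj \<A>; a \<in> homs \<A> x y\<rbrakk>
      \<Longrightarrow> on_arr F x y a \<in> homs \<B> (on_obj F x) (on_obj F y)"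
    and on_arr_ide: "x \<in> obj \<A> \<Longrightarrow> on_arr F x x (ide \<A> x) = ide \<B> (on_obj F x)"
    and on_arr_comp: "\<lbrakk>x \<in> obj \<A>; y \<in> obj \<A>; z \<in> obj \<A>; a \<in> homs \<A> x y; b \<in> homs \<A> y z\<rbrakk>
      \<Longrightarrow> on_arr F x z (comp \<A> x y z b a)
        = comp \<B> (on_obj F x) (on_obj F y) (on_obj F z) (on_arr F y z b) (on_arr F x y a)"

definition id_functor :: "('o, 'a, 'o, 'a) func" where
  "id_functor = \<lparr>on_obj = (\<lambda>x. x), on_arr = (\<lambda>x y a. a)\<rparr>"

definition comp_functor ::
    "('p, 'b, 'q, 'c) func \<Rightarrow> ('o, 'a, 'p, 'b) func \<Rightarrow> ('o, 'a, 'q, 'c) func" where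
  "comp_functor G F =
    \<lparr>on_obj = (\<lambda>x. on_obj G (on_obj F x)),
     on_arr = (\<lambda>x y a. on_arr G (on_obj F x) (on_obj F y) (on_arr F x y a))\<rparr>"

definition iso_arrow :: "('o, 'a) cat \<Rightarrow> 'o \<Rightarrow> 'o \<Rightarrow> 'a \<Rightarrow> bool" where
  "iso_arrow \<C> x y a \<longleftrightarrow> a \<in> homs \<C> x y \<and>
    (\<exists>b\<in>homs \<C> y x. comp \<C> x y x b a = ide \<C> x \<and> comp \<C> y x y a b = ide \<C> y)"

definition naturally_isomorphic ::
    "('o, 'a) cat \<Rightarrow> ('p, 'b) cat \<Rightarrow> ('o, 'a, 'p, 'b) func \<Rightarrow> ('o, 'a, 'p, 'b) func \<Rightarrow> bool" where
  "naturally_isomorphic \<A> \<B> F G \<longleftrightarrow>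
    (\<exists>\<eta>. (\<forall>x\<in>obj \<A>. iso_arrow \<B> (on_obj F x) (on_obj G x) (\<eta> x)) \<and>
      (\<forall>x\<in>obj \<A>. \<forall>y\<in>obj \<A>. \<forall>a\<in>homs \<A> x y.
        comp \<B> (on_obj F x) (on_obj F y) (on_obj G y) (\<eta> y) (on_arr F x y a)
        = comp \<B> (on_obj F x) (on_obj G x) (on_obj G y) (on_arr G x y a) (\<eta> x)))"

definition categorical_inverses ::
    "('o, 'a) cat \<Rightarrow> ('p, 'b) cat \<Rightarrow> ('o, 'a, 'p, 'b) func \<Rightarrow> ('p, 'b, 'o, 'a) func \<Rightarrow> bool" where
  "categorical_inverses \<A> \<B> F G \<longleftrightarrow>
    cat_functor \<A> \<B> F \<and> cat_functor \<B> \<A> G \<and>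
    naturally_isomorphic \<A> \<A> (comp_functor G F) id_functor \<and>
    naturally_isomorphic \<B> \<B> (comp_functor F G) id_functor"

definition equivalent_categories :: "('o, 'a) cat \<Rightarrow> ('p, 'b) cat \<Rightarrow> bool" where
  "equivalent_categories \<A> \<B> \<longleftrightarrow> (\<exists>F G. categorical_inverses \<A> \<B> F G)"


section \<open>Posets with Grothendieck topologies\<close>

definition order_iso :: "('a, 'm) gorder_scheme \<Rightarrow> ('b, 'n) gorder_scheme \<Rightarrow> ('a \<Rightarrow> 'b) \<Rightarrow> bool" where
  "order_iso A B \<phi> \<longleftrightarrow> order_emb A B \<phi> \<and> bij_betw \<phi> (carrier A) (carrier B)"

definition down :: "('a, 'm) gorder_scheme \<Rightarrow> 'a \<Rightarrow> 'a set" where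
  "down C c = {d \<in> carrier C. d \<sqsubseteq>\<^bsub>C\<^esub> c}"

definition lower_set :: "('a, 'm) gorder_scheme \<Rightarrow> 'a set \<Rightarrow> bool" where
  "lower_set C I \<longleftrightarrow> I \<subseteq> carrier C \<and> (\<forall>c\<in>I. \<forall>d\<in>carrier C. d \<sqsubseteq>\<^bsub>C\<^esub> c \<longrightarrow> d \<in> I)"

text \<open>In a poset an arrow to \<open>c\<close> is an element below \<open>c\<close>, and the pullback of a sieve \<open>S\<close> along
  \<open>d \<le> c\<close> is \<open>S \<inter> down C d\<close>.\<close>

definition sieve :: "('a, 'm) gorder_scheme \<Rightarrow> 'a \<Rightarrow> 'a set \<Rightarrow> bool" where
  "sieve C c S \<longleftrightarrow> lower_set C S \<and> S \<subseteq> down C c"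

definition generated :: "('a, 'm) gorder_scheme \<Rightarrow> 'a set \<Rightarrow> 'a set" where
  "generated C A = {d \<in> carrier C. \<exists>a\<in>A. d \<sqsubseteq>\<^bsub>C\<^esub> a}"

text \<open>\<open>cov C c\<close> is the set of covering sieves on \<open>c\<close>.\<close>

record 'a site = "'a gorder" +
  cov :: "'a \<Rightarrow> 'a set set"

locale poset_site = partial_order C for C :: "'a site" (structure) +
  assumes cov_sieve: "\<lbrakk>c \<in> carrier C; S \<in> cov C c\<rbrakk> \<Longrightarrow> sieve C c S"
    and cov_maximal: "c \<in> carrier C \<Longrightarrow> down C c \<in> cov C c"
    and cov_stable: "\<lbrakk>c \<in> carrier C; S \<in> cov C c; d \<in> carrier C; d \<sqsubseteq> c\<rbrakk>
      \<Longrightarrow> S \<inter> down C d \<in> cov C d"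
    and cov_transitive: "\<lbrakk>c \<in> carrier C; S \<in> cov C c; sieve C c R;
        \<And>d. d \<in> S \<Longrightarrow> R \<inter> down C d \<in> cov C d\<rbrakk> \<Longrightarrow> R \<in> cov C c"

definition subcanonical :: "'a site \<Rightarrow> bool" where
  "subcanonical C \<longleftrightarrow> (\<forall>c\<in>carrier C. \<forall>S\<in>cov C c. is_lub C c S)"

definition site_iso :: "'a site \<Rightarrow> 'b site \<Rightarrow> ('a \<Rightarrow> 'b) \<Rightarrow> bool" where
  "site_iso C C' \<phi> \<longleftrightarrow> order_iso C C' \<phi> \<and> (\<forall>c\<in>carrier C. cov C' (\<phi> c) = (`) \<phi> ` cov C c)"

definition isomorphic_sites :: "'a site \<Rightarrow> 'b site \<Rightarrow> bool" where
  "isomorphic_sites C C' \<longleftrightarrow> (\<exists>\<phi>. site_iso C C' \<phi>)"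

definition site_morphism :: "'a site \<Rightarrow> 'b site \<Rightarrow> ('a \<Rightarrow> 'b) \<Rightarrow> bool" where
  "site_morphism C C' h \<longleftrightarrow>
    h \<in> carrier C \<rightarrow> carrier C' \<and> isotone C C' h \<and>
    (\<forall>d\<in>carrier C'. \<exists>c\<in>carrier C. d \<sqsubseteq>\<^bsub>C'\<^esub> h c) \<and>
    (\<forall>d\<in>carrier C'. \<forall>c\<in>carrier C. \<forall>c'\<in>carrier C. d \<sqsubseteq>\<^bsub>C'\<^esub> h c \<and> d \<sqsubseteq>\<^bsub>C'\<^esub> h c' \<longrightarrow>
      (\<exists>c''\<in>carrier C. c'' \<sqsubseteq>\<^bsub>C\<^esub> c \<and> c'' \<sqsubseteq>\<^bsub>C\<^esub> c' \<and> d \<sqsubseteq>\<^bsub>C'\<^esub> h c'')) \<and>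
    (\<forall>c\<in>carrier C. \<forall>S\<in>cov C c. generated C' (h ` S) \<in> cov C' (h c))"


section \<open>Sheaves\<close>

text \<open>\<open>'s\<close> plays the role of the universe of sets: a presheaf takes subsets of \<open>'s\<close> as values.
  For \<open>d \<le> c\<close>, \<open>res F c d\<close> is the restriction map from \<open>sec F c\<close> to \<open>sec F d\<close>.\<close>

record ('a, 's) presheaf =
  sec :: "'a \<Rightarrow> 's set"
  res :: "'a \<Rightarrow> 'a \<Rightarrow> 's \<Rightarrow> 's"

definition is_presheaf :: "'a site \<Rightarrow> ('a, 's) presheaf \<Rightarrow> bool" where
  "is_presheaf C F \<longleftrightarrow>
    (\<forall>c\<in>carrier C. \<forall>d\<in>carrier C. d \<sqsubseteq>\<^bsub>C\<^esub> c \<longrightarrow> res F c d \<in> sec F c \<rightarrow> sec F d) \<and>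
    (\<forall>c\<in>carrier C. \<forall>x\<in>sec F c. res F c c x = x) \<and>
    (\<forall>c\<in>carrier C. \<forall>d\<in>carrier C. \<forall>e\<in>carrier C. \<forall>x\<in>sec F c.
      d \<sqsubseteq>\<^bsub>C\<^esub> c \<and> e \<sqsubseteq>\<^bsub>C\<^esub> d \<longrightarrow> res F d e (res F c d x) = res F c e x)"

definition matching_family :: "'a site \<Rightarrow> ('a, 's) presheaf \<Rightarrow> 'a set \<Rightarrow> ('a \<Rightarrow> 's) \<Rightarrow> bool" where
  "matching_family C F S x \<longleftrightarrow>
    (\<forall>d\<in>S. x d \<in> sec F d) \<and>
    (\<forall>d\<in>S. \<forall>e\<in>carrier C. e \<sqsubseteq>\<^bsub>C\<^esub> d \<longrightarrow> res F d e (x d) = x e)"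

definition is_sheaf :: "'a site \<Rightarrow> ('a, 's) presheaf \<Rightarrow> bool" where
  "is_sheaf C F \<longleftrightarrow> is_presheaf C F \<and>
    (\<forall>c\<in>carrier C. \<forall>S\<in>cov C c. \<forall>x. matching_family C F S x \<longrightarrow>
      (\<exists>!s. s \<in> sec F c \<and> (\<forall>d\<in>S. res F c d s = x d)))"

definition presheaf_homs ::
    "'a site \<Rightarrow> ('a, 's) presheaf \<Rightarrow> ('a, 's) presheaf \<Rightarrow> ('a \<Rightarrow> 's \<Rightarrow> 's) set" where
  "presheaf_homs C F G =
    {\<alpha> \<in> (\<Pi>\<^sub>E c\<in>carrier C. sec F c \<rightarrow>\<^sub>E sec G c).
      \<forall>c\<in>carrier C. \<forall>d\<in>carrier C. d \<sqsubseteq>\<^bsub>C\<^esub> c \<longrightarrow>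
        (\<forall>x\<in>sec F c. \<alpha> d (res F c d x) = res G c d (\<alpha> c x))}"

definition Sh :: "'a site \<Rightarrow> (('a, 's) presheaf, 'a \<Rightarrow> 's \<Rightarrow> 's) cat" where
  "Sh C =
    \<lparr>obj = {F. is_sheaf C F},
     homs = presheaf_homs C,
     ide = (\<lambda>F. \<lambda>c\<in>carrier C. \<lambda>x\<in>sec F c. x),
     comp = (\<lambda>F G H \<beta> \<alpha>. \<lambda>c\<in>carrier C. compose (sec F c) (\<beta> c) (\<alpha> c))\<rparr>"


section \<open>Frames and ideals\<close>

locale frame = complete_lattice L for L (structure) +
  assumes meet_sup_distrib: "\<lbrakk>x \<in> carrier L; A \<subseteq> carrier L\<rbrakk>
    \<Longrightarrow> x \<sqinter> (\<Squnion>A) = \<Squnion>((\<lambda>a. x \<sqinter> a) ` A)"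

definition is_ideal :: "'a site \<Rightarrow> 'a set \<Rightarrow> bool" where
  "is_ideal C I \<longleftrightarrow> lower_set C I \<and> (\<forall>c\<in>carrier C. \<forall>S\<in>cov C c. S \<subseteq> I \<longrightarrow> c \<in> I)"

definition Id_frame :: "'a site \<Rightarrow> 'a set gorder" where
  "Id_frame C = \<lparr>carrier = {I. is_ideal C I}, eq = (=), le = (\<subseteq>)\<rparr>"

definition ideal_hull :: "'a site \<Rightarrow> 'a set \<Rightarrow> 'a set" where
  "ideal_hull C A = \<Inter>{I. is_ideal C I \<and> A \<subseteq> I}"

definition principal_ideals :: "'a site \<Rightarrow> 'a set set" where
  "principal_ideals C = (\<lambda>c. ideal_hull C {c}) ` carrier C"

definition A_map :: "'a site \<Rightarrow> 'b site \<Rightarrow> ('a \<Rightarrow> 'b) \<Rightarrow> 'a set \<Rightarrow> 'b set" where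
  "A_map C C' h = (\<lambda>I\<in>carrier (Id_frame C). ideal_hull C' (h ` I))"

definition canonical_cov :: "('l, 'm) gorder_scheme \<Rightarrow> 'l \<Rightarrow> 'l set set" where
  "canonical_cov L l = {S. sieve L l S \<and> \<Squnion>\<^bsub>L\<^esub>S = l}"

definition induced_site :: "('l, 'm) gorder_scheme \<Rightarrow> 'l set \<Rightarrow> 'l site" where
  "induced_site L B =
    (let B' = \<lparr>carrier = B, eq = eq L, le = le L\<rparr> in
    \<lparr>carrier = B, eq = eq L, le = le L,
     cov = (\<lambda>b. {S. sieve B' b S \<and> generated L S \<in> canonical_cov L b})\<rparr>)"

definition is_basis :: "('l, 'm) gorder_scheme \<Rightarrow> 'l set \<Rightarrow> bool" where
  "is_basis L B \<longleftrightarrow> B \<subseteq> carrier L \<and> (\<forall>l\<in>carrier L. \<exists>S\<subseteq>B. \<Squnion>\<^bsub>L\<^esub>S = l)"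


section \<open>Families of elements of frames\<close>

text \<open>A family is given by its set of members. Refinement, joins and membership depend on nothing
  else, and a property \<open>Q\<close> of indexed families enters below only through the existence of families
  satisfying it, that is, through the property of being the range of a family satisfying \<open>Q\<close>.

  Properties are predicates on the frames with elements in one type \<open>'l\<close>. This type will be
  \<open>'u set\<close>, where \<open>'u\<close> contains the elements of the posets: it contains a copy of every frame
  having a basis indexed by a poset with elements in \<open>'u\<close>.\<close>

type_synonym 'l family_property = "'l gorder \<Rightarrow> 'l set \<Rightarrow> bool"

definition invariant_family_property :: "'l family_property \<Rightarrow> bool" where
  "invariant_family_property Q \<longleftrightarrow>
    (\<forall>L M \<phi> A. frame L \<and> frame M \<and> order_iso L M \<phi> \<and> A \<subseteq> carrier L \<and> Q L A \<longrightarrow> Q M (\<phi> ` A))"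

definition refines :: "'l gorder \<Rightarrow> 'l set \<Rightarrow> 'l set \<Rightarrow> bool" where
  "refines L B A \<longleftrightarrow> (\<forall>b\<in>B. \<exists>a\<in>A. b \<sqsubseteq>\<^bsub>L\<^esub> a) \<and> \<Squnion>\<^bsub>L\<^esub>B = \<Squnion>\<^bsub>L\<^esub>A"

definition has_refinement_in :: "'l gorder \<Rightarrow> 'l set \<Rightarrow> 'l family_property \<Rightarrow> 'l set \<Rightarrow> bool" where
  "has_refinement_in L X Q A \<longleftrightarrow> (\<exists>B\<subseteq>X. refines L B A \<and> Q L B)"

abbreviation has_refinement :: "'l gorder \<Rightarrow> 'l family_property \<Rightarrow> 'l set \<Rightarrow> bool" where
  "has_refinement L \<equiv> has_refinement_in L (carrier L)"

definition compact_elements :: "'l family_property \<Rightarrow> 'l gorder \<Rightarrow> 'l set" where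
  "compact_elements Q L =
    {l \<in> carrier L. \<forall>A\<subseteq>carrier L. \<Squnion>\<^bsub>L\<^esub>A = l \<longrightarrow> has_refinement L Q A}"

type_synonym 'l basis_property = "'l gorder \<Rightarrow> 'l set \<Rightarrow> bool"

definition invariant_basis_property :: "'l basis_property \<Rightarrow> bool" where
  "invariant_basis_property P \<longleftrightarrow>
    (\<forall>L M \<phi> B. frame L \<and> frame M \<and> order_iso L M \<phi> \<and> is_basis L B \<and> P L B \<longrightarrow> P M (\<phi> ` B))"

definition induced_relative_to ::
    "'u set basis_property \<Rightarrow> 'u set family_property \<Rightarrow> 'u site \<Rightarrow> bool" where
  "induced_relative_to P Q C \<longleftrightarrow>
    (\<forall>(L :: 'u set gorder) i.
      frame L \<and> i \<in> carrier C \<rightarrow> carrier L \<and> order_emb C L i \<and>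
      is_basis L (i ` carrier C) \<and> P L (i ` carrier C) \<and>
      (\<forall>c\<in>carrier C. \<forall>S\<in>cov C c. \<Squnion>\<^bsub>L\<^esub>(i ` S) = i c) \<longrightarrow>
      (\<forall>A\<subseteq>carrier C.
        (\<exists>c\<in>carrier C. (\<forall>a\<in>A. a \<sqsubseteq>\<^bsub>C\<^esub> c) \<and> generated C A \<in> cov C c) \<longleftrightarrow>
        has_refinement_in L (i ` carrier C) Q (i ` A)))"

definition induced_topology :: "'u site set \<Rightarrow> 'u set family_property \<Rightarrow> 'u site \<Rightarrow> bool" where
  "induced_topology \<K> Q C \<longleftrightarrow>
    (\<exists>P. invariant_basis_property P \<and> (\<forall>C'\<in>\<K>. P (Id_frame C') (down C' ` carrier C')) \<and>
      induced_relative_to P Q C)"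


section \<open>The extended categories and the functors between them\<close>

definition comp_site :: "'u set family_property \<Rightarrow> 'u site \<Rightarrow> 'u set site" where
  "comp_site Q C = induced_site (Id_frame C) (compact_elements Q (Id_frame C))"

definition ext_homs :: "'u set family_property \<Rightarrow> 'u site \<Rightarrow> 'u site \<Rightarrow> ('u \<Rightarrow> 'u) set" where
  "ext_homs Q C C' =
    {h \<in> carrier C \<rightarrow>\<^sub>E carrier C'. site_morphism C C' h \<and>
      A_map C C' h ` compact_elements Q (Id_frame C) \<subseteq> compact_elements Q (Id_frame C') \<and>
      site_morphism (comp_site Q C) (comp_site Q C') (A_map C C' h)}"

definition Ext :: "'u site set \<Rightarrow> 'u set family_property \<Rightarrow> ('u site, 'u \<Rightarrow> 'u) cat" where
  "Ext \<K> Q =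
    \<lparr>obj = {C. partial_order C \<and> (\<exists>C\<^sub>0\<in>\<K>. isomorphic_sites C\<^sub>0 C)},
     homs = ext_homs Q,
     ide = (\<lambda>C. \<lambda>c\<in>carrier C. c),
     comp = (\<lambda>C C' C'' h' h. compose (carrier C) h' h)\<rparr>"

text \<open>The poset of compact elements of \<open>Id_frame C\<close> has its elements in \<open>'u set\<close>, while the objects of
  the extended categories have theirs in \<open>'u\<close>. So the functor below takes as value an isomorphic
  copy in \<open>'u\<close>, and conjugates the restriction of \<open>A_map C C' h\<close> with the chosen isomorphisms.
  The topology on the poset of compact elements is the one induced by the canonical topology.\<close>

definition copy :: "'u set site \<Rightarrow> 'u site" where
  "copy S = (SOME T. partial_order T \<and> isomorphic_sites S T)"

definition copy_map :: "'u set site \<Rightarrow> 'u set \<Rightarrow> 'u" where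
  "copy_map S = (SOME \<theta>. site_iso S (copy S) \<theta>)"

definition compacts_functor ::
    "'u set family_property \<Rightarrow> ('u site, 'u \<Rightarrow> 'u, 'u site, 'u \<Rightarrow> 'u) func" where
  "compacts_functor Q =
    \<lparr>on_obj = (\<lambda>C. copy (comp_site Q C)),
     on_arr = (\<lambda>C C' h. \<lambda>x\<in>carrier (copy (comp_site Q C)).
       copy_map (comp_site Q C')
         (A_map C C' h (inv_into (carrier (comp_site Q C)) (copy_map (comp_site Q C)) x)))\<rparr>"

end

theory Submission
  imports Defs
begin

text \<open>
  The idea is that every site \<open>C\<close> in sight is visible inside its own frame of ideals, as a poset of
  compact elements. By subcanonicity \<open>c \<mapsto> down C c\<close> identifies \<open>C\<close> with the poset of principal ideals,
  topology included, since a sieve on \<open>c\<close> covers exactly if its ideal hull is \<open>down C c\<close>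
  (\<open>down_site_iso\<close>). The hypotheses on refinements and on the topologies make the principal ideals
  coincide with the \<open>U\<close>-compact elements, for \<open>C\<close> in \<open>\<K>\<close>, and with the \<open>V\<close>-compact ones, for \<open>C\<close> in \<open>\<H>\<close>
  (\<open>compact_elements_principal\<close>): a covering family has a refinement satisfying the invariant, and
  conversely a \<open>U\<close>-compact ideal, being the join of its principal parts, is generated by a family
  that covers one of its own elements.

  An equivalence of sheaf toposes restricts to subterminal objects, which are the ideals, and so
  yields an isomorphism \<open>Id_frame C \<cong> Id_frame D\<close> for \<open>D = f C\<close>
  (\<open>equivalent_sheaves_order_iso_ideals\<close>). Thus, up to isomorphism, a single frame contains both \<open>C\<close>, as its
  \<open>U\<close>-compact elements, and \<open>D\<close>, as its \<open>V\<close>-compact elements. This situation, \<open>dual_sites U V C D\<close>, is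
  symmetric and stable under isomorphism of sites, and everything else follows from it.

  Let \<open>T\<close> be the site of \<open>V\<close>-compact elements of \<open>Id_frame C\<close>. Sending an ideal to the set of
  \<open>V\<close>-compact elements below it is an isomorphism \<open>Id_frame C \<cong> Id_frame T\<close>, so the \<open>U\<close>-compact
  elements of \<open>Id_frame T\<close> are a copy of \<open>C\<close>: dualizing twice returns \<open>C\<close>. The isomorphism is natural
  in the arrows of the extended category (\<open>to_dual_natural\<close>). Restricted to principal ideals,
  naturality says that the frame map induced by the dual of an arrow \<open>h\<close> acts on \<open>U\<close>-compact elements as
  \<open>h\<close> itself. This one fact shows both that the dual of \<open>h\<close> is again an arrow of the extended category,
  because \<open>h\<close> is a morphism of sites, and that the identification of \<open>C\<close> with its double dual is
  natural.
\<close>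

section \<open>Isomorphisms of frames, compact elements and bases\<close>

lemma sup_eqI:
  assumes "partial_order L" "A \<subseteq> carrier L" "x \<in> carrier L"
    and "\<And>a. a \<in> A \<Longrightarrow> a \<sqsubseteq>\<^bsub>L\<^esub> x"
    and "\<And>y. \<lbrakk>y \<in> carrier L; \<And>a. a \<in> A \<Longrightarrow> a \<sqsubseteq>\<^bsub>L\<^esub> y\<rbrakk> \<Longrightarrow> x \<sqsubseteq>\<^bsub>L\<^esub> y"
  shows "\<Squnion>\<^bsub>L\<^esub>A = x"
proof -
  interpret partial_order L by fact
  have "is_lub L x A"
    using assms(2-4) by (auto simp: least_def Upper_def intro!: assms(5))
  then show ?thesis
    unfolding sup_def by (blast intro: least_unique)
qed

lemma order_iso_le:
  "\<lbrakk>order_iso A B \<phi>; x \<in> carrier A; y \<in> carrier A\<rbrakk> \<Longrightarrow> \<phi> x \<sqsubseteq>\<^bsub>B\<^esub> \<phi> y \<longleftrightarrow> x \<sqsubseteq>\<^bsub>A\<^esub> y"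
  by (simp add: order_iso_def order_emb_def)

lemma order_iso_inj: "order_iso A B \<phi> \<Longrightarrow> inj_on \<phi> (carrier A)"
  by (simp add: order_iso_def bij_betw_def)

lemma order_iso_carrier: "order_iso A B \<phi> \<Longrightarrow> \<phi> ` carrier A = carrier B"
  by (simp add: order_iso_def bij_betw_def)

lemma order_iso_in: "\<lbrakk>order_iso A B \<phi>; x \<in> carrier A\<rbrakk> \<Longrightarrow> \<phi> x \<in> carrier B"
  using order_iso_carrier by blast

lemma order_isoI:
  assumes "weak_partial_order A" "weak_partial_order B" "\<phi> ` carrier A = carrier B"
    "inj_on \<phi> (carrier A)"
    "\<And>x y. \<lbrakk>x \<in> carrier A; y \<in> carrier A\<rbrakk> \<Longrightarrow> \<phi> x \<sqsubseteq>\<^bsub>B\<^esub> \<phi> y \<longleftrightarrow> x \<sqsubseteq>\<^bsub>A\<^esub> y"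
  shows "order_iso A B \<phi>"
  using assms by (auto simp: order_iso_def order_emb_def bij_betw_def)

lemma order_iso_weak:
  "order_iso A B \<phi> \<Longrightarrow> weak_partial_order A" "order_iso A B \<phi> \<Longrightarrow> weak_partial_order B"
  by (simp_all add: order_iso_def order_emb_def)

lemma order_iso_inv:
  assumes "order_iso A B \<phi>"
  shows "order_iso B A (inv_into (carrier A) \<phi>)"
proof (rule order_isoI)
  note le = order_iso_le[OF assms] and img = order_iso_carrier[OF assms]
  show "inv_into (carrier A) \<phi> ` carrier B = carrier A"
    using assms by (metis bij_betw_imp_surj_on bij_betw_inv_into order_iso_def)
  show "inj_on (inv_into (carrier A) \<phi>) (carrier B)"
    using img by (simp add: inj_on_inv_into)
  show "inv_into (carrier A) \<phi> x \<sqsubseteq>\<^bsub>A\<^esub> inv_into (carrier A) \<phi> y \<longleftrightarrow> x \<sqsubseteq>\<^bsub>B\<^esub> y"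
    if "x \<in> carrier B" "y \<in> carrier B" for x y
    using le[of "inv_into (carrier A) \<phi> x" "inv_into (carrier A) \<phi> y"] that img
    by (simp add: inv_into_into f_inv_into_f)
qed (use assms in \<open>simp_all add: order_iso_weak\<close>)

lemma order_iso_down:
  assumes "order_iso C D \<phi>" "c \<in> carrier C"
  shows "down D (\<phi> c) = \<phi> ` down C c"
proof (intro subset_antisym subsetI)
  note le = order_iso_le[OF assms(1)]
  fix d assume d: "d \<in> down D (\<phi> c)"
  then obtain b where "b \<in> carrier C" "d = \<phi> b"
    using order_iso_carrier[OF assms(1)] by (auto simp: down_def)
  then show "d \<in> \<phi> ` down C c" using d le[of b c] assms(2) by (auto simp: down_def)
next
  fix d assume "d \<in> \<phi> ` down C c"
  then show "d \<in> down D (\<phi> c)"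
    using assms(2) order_iso_le[OF assms(1)] order_iso_in[OF assms(1)] by (auto simp: down_def)
qed

lemma order_iso_comp:
  assumes "order_iso A B \<phi>" "order_iso B C \<psi>"
  shows "order_iso A C (\<psi> \<circ> \<phi>)"
proof -
  have "bij_betw (\<psi> \<circ> \<phi>) (carrier A) (carrier C)"
    using assms by (auto simp: order_iso_def intro: bij_betw_trans)
  then show ?thesis
    using assms order_iso_in[OF assms(1)] by (simp add: order_iso_def order_emb_def)
qed

lemma order_iso_cong:
  "\<lbrakk>order_iso A B \<phi>; \<And>x. x \<in> carrier A \<Longrightarrow> \<psi> x = \<phi> x\<rbrakk> \<Longrightarrow> order_iso A B \<psi>"
  by (auto simp: order_iso_def order_emb_def cong: bij_betw_cong)

lemma order_iso_sup:
  assumes "frame L" "frame M" "order_iso L M \<phi>" "A \<subseteq> carrier L"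
  shows "\<phi> (\<Squnion>\<^bsub>L\<^esub>A) = \<Squnion>\<^bsub>M\<^esub>(\<phi> ` A)"
proof (rule sym, rule sup_eqI)
  interpret L: frame L by fact
  interpret M: frame M by fact
  note le = order_iso_le[OF assms(3)] and mem = order_iso_in[OF assms(3)]
  show "partial_order M" ..
  show "\<phi> ` A \<subseteq> carrier M" "\<phi> (\<Squnion>\<^bsub>L\<^esub>A) \<in> carrier M"
    using assms(4) mem by auto
  show "a \<sqsubseteq>\<^bsub>M\<^esub> \<phi> (\<Squnion>\<^bsub>L\<^esub>A)" if "a \<in> \<phi> ` A" for a
  proof -
    obtain x where "x \<in> A" "a = \<phi> x" using \<open>a \<in> \<phi> ` A\<close> by blast
    then show ?thesis using assms(4) le[of x "\<Squnion>\<^bsub>L\<^esub>A"] L.sup_upper[of A x] by auto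
  qed
  fix y assume y: "y \<in> carrier M" "\<And>a. a \<in> \<phi> ` A \<Longrightarrow> a \<sqsubseteq>\<^bsub>M\<^esub> y"
  obtain x where x: "x \<in> carrier L" "y = \<phi> x"
    using y(1) order_iso_carrier[OF assms(3)] by blast
  have "\<Squnion>\<^bsub>L\<^esub>A \<sqsubseteq>\<^bsub>L\<^esub> x"
  proof (rule L.sup_least)
    fix a assume "a \<in> A"
    then show "a \<sqsubseteq>\<^bsub>L\<^esub> x" using y(2)[of "\<phi> a"] x assms(4) le[of a x] by auto
  qed (use assms(4) x in auto)
  then show "\<phi> (\<Squnion>\<^bsub>L\<^esub>A) \<sqsubseteq>\<^bsub>M\<^esub> y"
    using x le assms(4) by simp
qed

text \<open>A family with join \<open>\<phi> l\<close> is pulled back to one with join \<open>l\<close>, refined there, and the refinement is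
  pushed forward again.\<close>

lemma compact_elements_image_subset:
  assumes "frame L" "frame M" "order_iso L M \<phi>" "invariant_family_property Q"
  shows "\<phi> ` compact_elements Q L \<subseteq> compact_elements Q M"
proof clarify
  fix l assume l: "l \<in> compact_elements Q L"
  interpret L: frame L by fact
  interpret M: frame M by fact
  let ?\<theta> = "inv_into (carrier L) \<phi>"
  note inv_iso = order_iso_inv[OF assms(3)]
  have "has_refinement M Q A" if A: "A \<subseteq> carrier M" "\<Squnion>\<^bsub>M\<^esub>A = \<phi> l" for A
  proof -
    have lc: "l \<in> carrier L" using l by (simp add: compact_elements_def)
    have A': "?\<theta> ` A \<subseteq> carrier L" using order_iso_in[OF inv_iso] A by blast
    have cancel: "\<phi> ` ?\<theta> ` A = A"
      by (rule image_inv_into_cancel[OF order_iso_carrier[OF assms(3)] A(1)])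
    have "\<Squnion>\<^bsub>L\<^esub>(?\<theta> ` A) = l"
      using order_iso_sup[OF assms(2,1) inv_iso A(1)] A(2) lc order_iso_inj[OF assms(3)] by simp
    then obtain B where B: "B \<subseteq> carrier L" "refines L B (?\<theta> ` A)" "Q L B"
      using l A' by (auto simp: compact_elements_def has_refinement_in_def)
    have "refines M (\<phi> ` B) (\<phi> ` ?\<theta> ` A)"
      unfolding refines_def
    proof
      show "\<forall>b\<in>\<phi> ` B. \<exists>a\<in>\<phi> ` ?\<theta> ` A. b \<sqsubseteq>\<^bsub>M\<^esub> a"
      proof clarify
        fix b assume "b \<in> B"
        then obtain a where "a \<in> ?\<theta> ` A" "b \<sqsubseteq>\<^bsub>L\<^esub> a"
          using B(2) unfolding refines_def by blast
        then show "\<exists>a\<in>\<phi> ` ?\<theta> ` A. \<phi> b \<sqsubseteq>\<^bsub>M\<^esub> a"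
          using \<open>b \<in> B\<close> B(1) A' order_iso_le[OF assms(3), of b a] by (meson imageI subsetD)
      qed
      show "\<Squnion>\<^bsub>M\<^esub>(\<phi> ` B) = \<Squnion>\<^bsub>M\<^esub>(\<phi> ` ?\<theta> ` A)"
        using B(1,2) A' assms(1-3) by (simp add: order_iso_sup[symmetric] refines_def)
    qed
    moreover have "Q M (\<phi> ` B)"
      using assms(4)[unfolded invariant_family_property_def, rule_format, of L M \<phi> B] assms(1-3) B
      by blast
    moreover have "\<phi> ` B \<subseteq> carrier M" using B(1) order_iso_in[OF assms(3)] by blast
    ultimately show ?thesis
      unfolding has_refinement_in_def cancel by blast
  qed
  then show "\<phi> l \<in> compact_elements Q M"
    using l order_iso_in[OF assms(3)] by (auto simp: compact_elements_def)
qed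

lemma compact_elements_image:
  assumes "frame L" "frame M" "order_iso L M \<phi>" "invariant_family_property Q"
  shows "\<phi> ` compact_elements Q L = compact_elements Q M"
proof (rule subset_antisym)
  let ?\<theta> = "inv_into (carrier L) \<phi>"
  have "?\<theta> ` compact_elements Q M \<subseteq> compact_elements Q L"
    by (rule compact_elements_image_subset[OF assms(2,1) order_iso_inv[OF assms(3)] assms(4)])
  then have "\<phi> ` ?\<theta> ` compact_elements Q M \<subseteq> \<phi> ` compact_elements Q L" by blast
  moreover have "\<phi> ` ?\<theta> ` compact_elements Q M = compact_elements Q M"
    by (rule image_inv_into_cancel[OF order_iso_carrier[OF assms(3)]])
      (auto simp: compact_elements_def)
  ultimately show "compact_elements Q M \<subseteq> \<phi> ` compact_elements Q L" by simp
qed (rule compact_elements_image_subset[OF assms])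

lemma induced_site_simps [simp]:
  "carrier (induced_site L B) = B" "le (induced_site L B) = le L" "eq (induced_site L B) = eq L"
  by (simp_all add: induced_site_def Let_def)

lemma partial_order_induced_site:
  assumes "partial_order L" "B \<subseteq> carrier L"
  shows "partial_order (induced_site L B)"
proof -
  interpret partial_order L by fact
  show ?thesis
    using assms(2) by unfold_locales (auto simp: eq_is_equal intro: le_trans le_antisym)
qed

text \<open>A family and the sieve it generates in \<open>L\<close> have the same join, and a family with join \<open>b\<close> lies below \<open>b\<close>.
  This leaves a description of the induced topology that mentions only joins of subsets of \<open>B\<close>.\<close>

lemma cov_induced_site:
  assumes "frame L" "B \<subseteq> carrier L" "b \<in> B"
  shows "S \<in> cov (induced_site L B) b \<longleftrightarrow>
    S \<subseteq> B \<and> (\<forall>s\<in>S. \<forall>d\<in>B. d \<sqsubseteq>\<^bsub>L\<^esub> s \<longrightarrow> d \<in> S) \<and> \<Squnion>\<^bsub>L\<^esub>S = b"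
proof -
  interpret frame L by fact
  have gen: "\<Squnion>\<^bsub>L\<^esub>(generated L S) = \<Squnion>\<^bsub>L\<^esub>S" if "S \<subseteq> B"
  proof (rule sup_eqI)
    have S: "S \<subseteq> carrier L" using that assms(2) by blast
    show "partial_order L" ..
    show "generated L S \<subseteq> carrier L" by (auto simp: generated_def)
    show "\<Squnion>\<^bsub>L\<^esub>S \<in> carrier L" using S by simp
    show "a \<sqsubseteq>\<^bsub>L\<^esub> \<Squnion>\<^bsub>L\<^esub>S" if "a \<in> generated L S" for a
      using that S sup_upper[OF S] by (auto simp: generated_def intro: le_trans[OF _ _ _ _ sup_closed[OF S]])
    show "\<Squnion>\<^bsub>L\<^esub>S \<sqsubseteq>\<^bsub>L\<^esub> y" if "y \<in> carrier L" "\<And>a. a \<in> generated L S \<Longrightarrow> a \<sqsubseteq>\<^bsub>L\<^esub> y" for y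
    proof (rule sup_least)
      fix s assume "s \<in> S"
      then have "s \<in> generated L S" using S le_refl[of s] unfolding generated_def by blast
      then show "s \<sqsubseteq>\<^bsub>L\<^esub> y" by (rule that(2))
    qed (use S that in auto)
  qed
  have sv: "sieve L b (generated L S)" if "S \<subseteq> B" "\<forall>s\<in>S. s \<sqsubseteq>\<^bsub>L\<^esub> b"
  proof -
    have "x \<sqsubseteq>\<^bsub>L\<^esub> t" if "x \<in> carrier L" "y \<in> carrier L" "t \<in> carrier L"
      "x \<sqsubseteq>\<^bsub>L\<^esub> y" "y \<sqsubseteq>\<^bsub>L\<^esub> t" for x y t
      using that le_trans by blast
    then show ?thesis
      using that assms(2,3) unfolding sieve_def lower_set_def generated_def down_def
      by (simp add: subset_iff) meson
  qed
  have ub: "\<forall>s\<in>S. s \<sqsubseteq>\<^bsub>L\<^esub> b" if "S \<subseteq> B" "\<Squnion>\<^bsub>L\<^esub>S = b"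
    using that assms(2) sup_upper[of S] by auto
  show ?thesis
    using gen sv ub
    by (auto simp: induced_site_def Let_def canonical_cov_def sieve_def lower_set_def down_def)
qed

lemma basis_image:
  assumes "frame L" "frame M" "order_iso L M \<phi>" "is_basis L B"
  shows "is_basis M (\<phi> ` B)"
  unfolding is_basis_def
proof (intro conjI ballI)
  have B: "B \<subseteq> carrier L" using assms(4) by (simp add: is_basis_def)
  then show "\<phi> ` B \<subseteq> carrier M" using order_iso_carrier[OF assms(3)] by blast
  fix m assume "m \<in> carrier M"
  then obtain l where l: "l \<in> carrier L" "m = \<phi> l"
    using order_iso_carrier[OF assms(3)] by blast
  then obtain S where "S \<subseteq> B" "\<Squnion>\<^bsub>L\<^esub>S = l"
    using assms(4) by (auto simp: is_basis_def)
  then have "\<Squnion>\<^bsub>M\<^esub>(\<phi> ` S) = m"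
    using order_iso_sup[OF assms(1-3), of S] B l by auto
  then show "\<exists>S\<subseteq>\<phi> ` B. \<Squnion>\<^bsub>M\<^esub>S = m"
    using \<open>S \<subseteq> B\<close> by blast
qed

section \<open>Isomorphisms and morphisms of sites\<close>

lemma site_iso_inv:
  assumes "site_iso C D \<phi>" "\<And>c S. \<lbrakk>c \<in> carrier C; S \<in> cov C c\<rbrakk> \<Longrightarrow> S \<subseteq> carrier C"
  shows "site_iso D C (inv_into (carrier C) \<phi>)"
  unfolding site_iso_def
proof (intro conjI ballI)
  let ?\<theta> = "inv_into (carrier C) \<phi>"
  have iso: "order_iso C D \<phi>" using assms by (simp add: site_iso_def)
  show "order_iso D C ?\<theta>" by (rule order_iso_inv[OF iso])
  fix d assume "d \<in> carrier D"
  then obtain c where c: "c \<in> carrier C" "d = \<phi> c" using order_iso_carrier[OF iso] by blast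
  have "?\<theta> ` \<phi> ` S = S" if "S \<in> cov C c" for S
    using assms(2)[OF c(1) that] order_iso_inj[OF iso] by simp
  then have "(`) ?\<theta> ` (`) \<phi> ` cov C c = cov C c"
    by (force simp: image_iff)
  then show "cov C (?\<theta> d) = (`) ?\<theta> ` cov D d"
    using assms(1) c order_iso_inj[OF iso] by (simp add: site_iso_def)
qed

lemma site_iso_comp:
  assumes "site_iso C D \<phi>" "site_iso D E \<psi>"
  shows "site_iso C E (\<psi> \<circ> \<phi>)"
proof -
  have iso: "order_iso C D \<phi>" "order_iso D E \<psi>" using assms by (auto simp: site_iso_def)
  show ?thesis
    using order_iso_comp[OF iso] order_iso_in[OF iso(1)] assms
    by (simp add: site_iso_def image_image image_comp[symmetric])
qed

lemma site_iso_cong: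
  assumes "site_iso C D \<phi>" "\<And>x. x \<in> carrier C \<Longrightarrow> \<psi> x = \<phi> x"
    "\<And>c S. \<lbrakk>c \<in> carrier C; S \<in> cov C c\<rbrakk> \<Longrightarrow> S \<subseteq> carrier C"
  shows "site_iso C D \<psi>"
proof -
  have "\<psi> ` S = \<phi> ` S" if "c \<in> carrier C" "S \<in> cov C c" for c S
    using assms(2) assms(3)[OF that] by (intro image_cong) auto
  then have "(`) \<psi> ` cov C c = (`) \<phi> ` cov C c" if "c \<in> carrier C" for c
    using that by (simp cong: image_cong)
  then show ?thesis
    using assms(1,2) order_iso_cong[of C D \<phi> \<psi>] by (simp add: site_iso_def)
qed

lemma site_iso_refl: "weak_partial_order C \<Longrightarrow> site_iso C C (\<lambda>c. c)"
  by (auto simp: site_iso_def order_iso_def order_emb_def bij_betw_def)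

lemma site_iso_order_iso: "site_iso C D \<phi> \<Longrightarrow> order_iso C D \<phi>"
  by (simp add: site_iso_def)

lemma site_iso_cov:
  "\<lbrakk>site_iso C D \<phi>; c \<in> carrier C\<rbrakk> \<Longrightarrow> cov D (\<phi> c) = (`) \<phi> ` cov C c"
  by (simp add: site_iso_def)

text \<open>Equalities between sets of covering sieves are reduced by this rule to a comparison one sieve
  at a time.\<close>

lemma image_family_eqI:
  assumes "\<And>R. R \<subseteq> B \<Longrightarrow> \<phi> ` R \<in> \<T> \<longleftrightarrow> R \<in> \<S>" "\<And>S. S \<in> \<T> \<Longrightarrow> \<exists>R\<subseteq>B. S = \<phi> ` R"
    "\<And>R. R \<in> \<S> \<Longrightarrow> R \<subseteq> B"
  shows "\<T> = (`) \<phi> ` \<S>"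
proof (intro subset_antisym subsetI)
  show "S \<in> (`) \<phi> ` \<S>" if S: "S \<in> \<T>" for S
  proof -
    obtain R where "R \<subseteq> B" "S = \<phi> ` R" using assms(2)[OF S] by blast
    then show ?thesis using assms(1)[of R] S by simp
  qed
  show "S \<in> \<T>" if "S \<in> (`) \<phi> ` \<S>" for S
    using that assms(1,3) by auto
qed

lemma induced_site_iso:
  assumes "frame L" "frame M" "order_iso L M \<phi>" "B \<subseteq> carrier L"
  shows "site_iso (induced_site L B) (induced_site M (\<phi> ` B)) \<phi>"
proof -
  interpret L: frame L by fact
  interpret M: frame M by fact
  have B': "\<phi> ` B \<subseteq> carrier M" using assms(4) order_iso_carrier[OF assms(3)] by blast
  have po: "partial_order (induced_site L B)" "partial_order (induced_site M (\<phi> ` B))"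
    by (rule partial_order_induced_site; (rule L.partial_order_axioms M.partial_order_axioms assms(4) B'))+
  have inj: "inj_on \<phi> B" using order_iso_inj[OF assms(3)] assms(4) inj_on_subset by blast
  have le: "\<phi> x \<sqsubseteq>\<^bsub>M\<^esub> \<phi> y \<longleftrightarrow> x \<sqsubseteq>\<^bsub>L\<^esub> y" if "x \<in> B" "y \<in> B" for x y
    using order_iso_le[OF assms(3)] assms(4) that by (simp add: subset_iff)
  have iso: "order_iso (induced_site L B) (induced_site M (\<phi> ` B)) \<phi>"
    by (rule order_isoI) (use po inj le in \<open>auto simp: partial_order_def\<close>)
  have "cov (induced_site M (\<phi> ` B)) (\<phi> b) = (`) \<phi> ` cov (induced_site L B) b" if b: "b \<in> B" for b
  proof -
    have eq: "\<phi> ` S \<in> cov (induced_site M (\<phi> ` B)) (\<phi> b) \<longleftrightarrow> S \<in> cov (induced_site L B) b"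
      if S: "S \<subseteq> B" for S
    proof -
      have "\<Squnion>\<^bsub>M\<^esub>(\<phi> ` S) = \<phi> (\<Squnion>\<^bsub>L\<^esub>S)"
        using order_iso_sup[OF assms(1-3), of S] S assms(4) by simp
      then have "\<Squnion>\<^bsub>M\<^esub>(\<phi> ` S) = \<phi> b \<longleftrightarrow> \<Squnion>\<^bsub>L\<^esub>S = b"
        using order_iso_inj[OF assms(3)] S b assms(4) by (auto simp: inj_on_eq_iff subset_iff)
      moreover have "(\<forall>s\<in>\<phi> ` S. \<forall>d\<in>\<phi> ` B. d \<sqsubseteq>\<^bsub>M\<^esub> s \<longrightarrow> d \<in> \<phi> ` S) \<longleftrightarrow>
          (\<forall>s\<in>S. \<forall>d\<in>B. d \<sqsubseteq>\<^bsub>L\<^esub> s \<longrightarrow> d \<in> S)"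
        using le inj S by (auto simp: subset_iff inj_on_image_mem_iff[OF inj])
      ultimately show ?thesis
        using S b by (simp add: cov_induced_site[OF assms(1,4)] cov_induced_site[OF assms(2) B'] image_mono)
    qed
    have sub: "S \<subseteq> B" if "S \<in> cov (induced_site L B) b" for S
      using that b by (simp add: cov_induced_site[OF assms(1,4)])
    have sub': "\<exists>R\<subseteq>B. S = \<phi> ` R" if "S \<in> cov (induced_site M (\<phi> ` B)) (\<phi> b)" for S
      using that b by (auto simp: cov_induced_site[OF assms(2) B'] subset_image_iff)
    show ?thesis using eq sub' sub by (rule image_family_eqI[of B])
  qed
  then show ?thesis using iso by (simp add: site_iso_def)
qed

lemma site_morphism_cong:
  assumes "site_morphism C D h" "\<And>x. x \<in> carrier C \<Longrightarrow> k x = h x"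
    "\<And>c S. \<lbrakk>c \<in> carrier C; S \<in> cov C c\<rbrakk> \<Longrightarrow> S \<subseteq> carrier C"
  shows "site_morphism C D k"
proof -
  have "k ` S = h ` S" if "c \<in> carrier C" "S \<in> cov C c" for c S
    using assms(2) assms(3)[OF that] by (intro image_cong) auto
  then show ?thesis
    using assms(1,2) by (auto simp: site_morphism_def isotone_def Pi_iff)
qed

lemma generated_generated:
  assumes "isotone C D h" "weak_partial_order E" "isotone D E k" "h \<in> carrier C \<rightarrow> carrier D"
    "k \<in> carrier D \<rightarrow> carrier E" "S \<subseteq> carrier C"
  shows "generated E (k ` generated D (h ` S)) = generated E ((k \<circ> h) ` S)"
proof -
  interpret D: weak_partial_order D using assms(1) by (simp add: isotone_def)
  interpret E: weak_partial_order E by fact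
  show ?thesis
  proof (intro subset_antisym subsetI)
    fix x assume "x \<in> generated E (k ` generated D (h ` S))"
    then obtain d s where x: "x \<in> carrier E" "x \<sqsubseteq>\<^bsub>E\<^esub> k d" "d \<in> carrier D" "s \<in> S" "d \<sqsubseteq>\<^bsub>D\<^esub> h s"
      by (auto simp: generated_def)
    then have hs: "h s \<in> carrier D" using assms(4,6) by blast
    have "k d \<sqsubseteq>\<^bsub>E\<^esub> k (h s)" using assms(3) x hs by (simp add: isotone_def)
    then have "x \<sqsubseteq>\<^bsub>E\<^esub> k (h s)" using x hs assms(5) by (meson E.le_trans PiE)
    then show "x \<in> generated E ((k \<circ> h) ` S)" using x by (auto simp: generated_def)
  next
    fix x assume "x \<in> generated E ((k \<circ> h) ` S)"
    then obtain s where x: "x \<in> carrier E" "s \<in> S" "x \<sqsubseteq>\<^bsub>E\<^esub> k (h s)"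
      by (auto simp: generated_def)
    then have "h s \<in> carrier D" using assms(4,6) by blast
    then have "h s \<in> generated D (h ` S)" using x by (auto simp: generated_def)
    then show "x \<in> generated E (k ` generated D (h ` S))"
      using x by (auto simp: generated_def)
  qed
qed

lemma site_morphism_comp:
  assumes "site_morphism C D h" "site_morphism D E k"
    "\<And>c S. \<lbrakk>c \<in> carrier C; S \<in> cov C c\<rbrakk> \<Longrightarrow> S \<subseteq> carrier C"
  shows "site_morphism C E (k \<circ> h)"
proof -
  have hm: "h \<in> carrier C \<rightarrow> carrier D" "isotone C D h"
    "\<And>d. d \<in> carrier D \<Longrightarrow> \<exists>c\<in>carrier C. d \<sqsubseteq>\<^bsub>D\<^esub> h c"
    "\<And>d c c'. \<lbrakk>d \<in> carrier D; c \<in> carrier C; c' \<in> carrier C; d \<sqsubseteq>\<^bsub>D\<^esub> h c; d \<sqsubseteq>\<^bsub>D\<^esub> h c'\<rbrakk> \<Longrightarrow>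
      \<exists>c''\<in>carrier C. c'' \<sqsubseteq>\<^bsub>C\<^esub> c \<and> c'' \<sqsubseteq>\<^bsub>C\<^esub> c' \<and> d \<sqsubseteq>\<^bsub>D\<^esub> h c''"
    "\<And>c S. \<lbrakk>c \<in> carrier C; S \<in> cov C c\<rbrakk> \<Longrightarrow> generated D (h ` S) \<in> cov D (h c)"
    using assms(1) unfolding site_morphism_def by blast+
  have km: "k \<in> carrier D \<rightarrow> carrier E" "isotone D E k"
    "\<And>d. d \<in> carrier E \<Longrightarrow> \<exists>c\<in>carrier D. d \<sqsubseteq>\<^bsub>E\<^esub> k c"
    "\<And>d c c'. \<lbrakk>d \<in> carrier E; c \<in> carrier D; c' \<in> carrier D; d \<sqsubseteq>\<^bsub>E\<^esub> k c; d \<sqsubseteq>\<^bsub>E\<^esub> k c'\<rbrakk> \<Longrightarrow>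
      \<exists>c''\<in>carrier D. c'' \<sqsubseteq>\<^bsub>D\<^esub> c \<and> c'' \<sqsubseteq>\<^bsub>D\<^esub> c' \<and> d \<sqsubseteq>\<^bsub>E\<^esub> k c''"
    "\<And>c S. \<lbrakk>c \<in> carrier D; S \<in> cov D c\<rbrakk> \<Longrightarrow> generated E (k ` S) \<in> cov E (k c)"
    using assms(2) unfolding site_morphism_def by blast+
  interpret E: weak_partial_order E using km(2) by (simp add: isotone_def)
  have h_in: "h c \<in> carrier D" if "c \<in> carrier C" for c using hm(1) that by blast
  have k_in: "k d \<in> carrier E" if "d \<in> carrier D" for d using km(1) that by blast
  have k_mono: "k x \<sqsubseteq>\<^bsub>E\<^esub> k y" if "x \<in> carrier D" "y \<in> carrier D" "x \<sqsubseteq>\<^bsub>D\<^esub> y" for x y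
    using km(2) that by (simp add: isotone_def)
  show ?thesis
    unfolding site_morphism_def
  proof (intro conjI ballI impI)
    show "k \<circ> h \<in> carrier C \<rightarrow> carrier E" using h_in k_in by auto
    show "isotone C E (k \<circ> h)" by (rule iso_compose[OF hm(1,2) km(1,2)])
    fix e assume e: "e \<in> carrier E"
    obtain d where d: "d \<in> carrier D" "e \<sqsubseteq>\<^bsub>E\<^esub> k d" using km(3)[OF e] by blast
    obtain c where "c \<in> carrier C" "d \<sqsubseteq>\<^bsub>D\<^esub> h c" using hm(3)[OF d(1)] by blast
    then show "\<exists>c\<in>carrier C. e \<sqsubseteq>\<^bsub>E\<^esub> (k \<circ> h) c"
      using e d h_in k_in k_mono by (metis E.le_trans comp_apply)
  next
    fix e c c' assume a: "e \<in> carrier E" "c \<in> carrier C" "c' \<in> carrier C"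
      and "e \<sqsubseteq>\<^bsub>E\<^esub> (k \<circ> h) c \<and> e \<sqsubseteq>\<^bsub>E\<^esub> (k \<circ> h) c'"
    then obtain d where d: "d \<in> carrier D" "d \<sqsubseteq>\<^bsub>D\<^esub> h c" "d \<sqsubseteq>\<^bsub>D\<^esub> h c'" "e \<sqsubseteq>\<^bsub>E\<^esub> k d"
      using km(4)[of e "h c" "h c'"] h_in by auto
    then obtain c'' where "c'' \<in> carrier C" "c'' \<sqsubseteq>\<^bsub>C\<^esub> c" "c'' \<sqsubseteq>\<^bsub>C\<^esub> c'" "d \<sqsubseteq>\<^bsub>D\<^esub> h c''"
      using hm(4) a by blast
    then show "\<exists>c''\<in>carrier C. c'' \<sqsubseteq>\<^bsub>C\<^esub> c \<and> c'' \<sqsubseteq>\<^bsub>C\<^esub> c' \<and> e \<sqsubseteq>\<^bsub>E\<^esub> (k \<circ> h) c''"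
      using a d h_in k_in k_mono by (metis E.le_trans comp_apply)
  next
    fix c S assume c: "c \<in> carrier C" "S \<in> cov C c"
    have "generated E (k ` generated D (h ` S)) \<in> cov E (k (h c))"
      using km(5) hm(5) c h_in by simp
    then show "generated E ((k \<circ> h) ` S) \<in> cov E ((k \<circ> h) c)"
      using generated_generated[OF hm(2) E.weak_partial_order_axioms km(2) hm(1) km(1) assms(3)[OF c]]
      by simp
  qed
qed

lemma generated_lower_set: "\<lbrakk>weak_partial_order C; lower_set C S\<rbrakk> \<Longrightarrow> generated C S = S"
  unfolding lower_set_def generated_def by (blast intro: weak_partial_order.le_refl)

lemma order_iso_lower_set:
  assumes "order_iso C D \<phi>" "lower_set C S"
  shows "lower_set D (\<phi> ` S)"
  unfolding lower_set_def
proof (intro conjI ballI impI)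
  show "\<phi> ` S \<subseteq> carrier D" using assms order_iso_in[OF assms(1)] by (auto simp: lower_set_def)
  fix y d assume "y \<in> \<phi> ` S" "d \<in> carrier D" "d \<sqsubseteq>\<^bsub>D\<^esub> y"
  then obtain c s where "s \<in> S" "c \<in> carrier C" "d = \<phi> c" "\<phi> c \<sqsubseteq>\<^bsub>D\<^esub> \<phi> s"
    using order_iso_carrier[OF assms(1)] by (metis imageE)
  then show "d \<in> \<phi> ` S" using assms(2) order_iso_le[OF assms(1), of c s] by (auto simp: lower_set_def)
qed

lemma site_iso_morphism:
  assumes "site_iso C D \<phi>" "\<And>c S. \<lbrakk>c \<in> carrier C; S \<in> cov C c\<rbrakk> \<Longrightarrow> lower_set C S"
  shows "site_morphism C D \<phi>"
  unfolding site_morphism_def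
proof (intro conjI ballI impI)
  have iso: "order_iso C D \<phi>" using assms(1) by (rule site_iso_order_iso)
  interpret D: weak_partial_order D using iso by (rule order_iso_weak)
  show "\<phi> \<in> carrier C \<rightarrow> carrier D" using order_iso_in[OF iso] by blast
  show "isotone C D \<phi>" using iso by (simp add: order_iso_def order_emb_isotone)
  show "\<exists>c\<in>carrier C. d \<sqsubseteq>\<^bsub>D\<^esub> \<phi> c" if "d \<in> carrier D" for d
    using that order_iso_carrier[OF iso] by (metis D.le_refl imageE)
  show "\<exists>c''\<in>carrier C. c'' \<sqsubseteq>\<^bsub>C\<^esub> c \<and> c'' \<sqsubseteq>\<^bsub>C\<^esub> c' \<and> d \<sqsubseteq>\<^bsub>D\<^esub> \<phi> c''"
    if d: "d \<in> carrier D" and c: "c \<in> carrier C" "c' \<in> carrier C"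
      and le: "d \<sqsubseteq>\<^bsub>D\<^esub> \<phi> c \<and> d \<sqsubseteq>\<^bsub>D\<^esub> \<phi> c'" for d c c'
  proof -
    obtain x where "x \<in> carrier C" "d = \<phi> x" using d order_iso_carrier[OF iso] by blast
    then show ?thesis using c le d order_iso_le[OF iso] by auto
  qed
  show "generated D (\<phi> ` S) \<in> cov D (\<phi> c)" if "c \<in> carrier C" "S \<in> cov C c" for c S
    using site_iso_cov[OF assms(1) that(1)] that(2)
      generated_lower_set[OF D.weak_partial_order_axioms order_iso_lower_set[OF iso assms(2)[OF that]]]
    by simp
qed

section \<open>The frame of ideals\<close>

lemma ideal_hull_least: "\<lbrakk>is_ideal C I; A \<subseteq> I\<rbrakk> \<Longrightarrow> ideal_hull C A \<subseteq> I"
  by (auto simp: ideal_hull_def)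

lemma ideal_hull_superset: "A \<subseteq> ideal_hull C A"
  by (auto simp: ideal_hull_def)

lemma ideal_hull_ideal: "is_ideal C I \<Longrightarrow> ideal_hull C I = I"
  using ideal_hull_least[of C I I] ideal_hull_superset[of I C] by simp

lemma ideal_subset: "is_ideal C I \<Longrightarrow> I \<subseteq> carrier C"
  by (simp add: is_ideal_def lower_set_def)

lemma ideal_lower: "\<lbrakk>is_ideal C I; c \<in> I; d \<in> carrier C; d \<sqsubseteq>\<^bsub>C\<^esub> c\<rbrakk> \<Longrightarrow> d \<in> I"
  by (simp add: is_ideal_def lower_set_def)

lemma ideal_down: "\<lbrakk>is_ideal C I; c \<in> I\<rbrakk> \<Longrightarrow> down C c \<subseteq> I"
  using ideal_lower by (auto simp: down_def)

lemma ideal_cov: "\<lbrakk>is_ideal C I; c \<in> carrier C; S \<in> cov C c; S \<subseteq> I\<rbrakk> \<Longrightarrow> c \<in> I"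
  unfolding is_ideal_def by blast

lemma Id_frame_simps [simp]:
  "carrier (Id_frame C) = {I. is_ideal C I}" "le (Id_frame C) = (\<subseteq>)" "eq (Id_frame C) = (=)"
  by (simp_all add: Id_frame_def)

lemma partial_order_Id_frame: "partial_order (Id_frame C)"
  by unfold_locales auto

lemma ideal_Int: "\<lbrakk>is_ideal C I; is_ideal C J\<rbrakk> \<Longrightarrow> is_ideal C (I \<inter> J)"
  by (auto simp: is_ideal_def lower_set_def)

lemma down_mono: "\<lbrakk>weak_partial_order C; c \<in> carrier C; d \<in> carrier C; d \<sqsubseteq>\<^bsub>C\<^esub> c\<rbrakk> \<Longrightarrow> down C d \<subseteq> down C c"
  unfolding down_def by (blast intro: weak_partial_order.le_trans)

context poset_site
begin

lemma cov_lower_set: "\<lbrakk>c \<in> carrier C; S \<in> cov C c\<rbrakk> \<Longrightarrow> lower_set C S"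
  using cov_sieve by (simp add: sieve_def)

lemma cov_subset: "\<lbrakk>c \<in> carrier C; S \<in> cov C c\<rbrakk> \<Longrightarrow> S \<subseteq> carrier C"
  using cov_lower_set by (simp add: lower_set_def)

lemma ideal_carrier: "is_ideal C (carrier C)"
  by (simp add: is_ideal_def lower_set_def)

lemma ideal_Inter: "\<lbrakk>\<A> \<noteq> {}; \<And>I. I \<in> \<A> \<Longrightarrow> is_ideal C I\<rbrakk> \<Longrightarrow> is_ideal C (\<Inter>\<A>)"
  unfolding is_ideal_def lower_set_def by blast

lemma is_ideal_hull: "A \<subseteq> carrier C \<Longrightarrow> is_ideal C (ideal_hull C A)"
  unfolding ideal_hull_def using ideal_carrier by (intro ideal_Inter) auto

text \<open>A single closure step suffices: by transitivity of the topology, the elements covered by \<open>A\<close> already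
  form an ideal. Membership in the hull thereby becomes a local condition at \<open>c\<close>.\<close>

lemma ideal_hull_lower_set:
  assumes "lower_set C A"
  shows "ideal_hull C A = {c \<in> carrier C. A \<inter> down C c \<in> cov C c}" (is "_ = ?H")
proof (rule subset_antisym)
  have A: "A \<subseteq> carrier C" using assms by (simp add: lower_set_def)
  have "is_ideal C ?H"
    unfolding is_ideal_def
  proof (intro conjI ballI impI)
    have "d \<in> ?H" if "c \<in> ?H" "d \<in> carrier C" "d \<sqsubseteq> c" for c d
    proof -
      have "(A \<inter> down C c) \<inter> down C d = A \<inter> down C d"
        using down_mono[OF weak_partial_order_axioms, of c d] that by auto
      moreover have "(A \<inter> down C c) \<inter> down C d \<in> cov C d" using cov_stable that by auto
      ultimately show ?thesis using that by simp
    qed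
    then show "lower_set C ?H" by (auto simp: lower_set_def)
    fix c S assume c: "c \<in> carrier C" "S \<in> cov C c" "S \<subseteq> ?H"
    have "A \<inter> down C c \<in> cov C c"
    proof (rule cov_transitive[OF c(1,2)])
      show "sieve C c (A \<inter> down C c)"
        using assms c(1) unfolding sieve_def lower_set_def down_def
        by (auto intro: le_trans)
      fix d assume d: "d \<in> S"
      then have "d \<in> carrier C" "d \<sqsubseteq> c" using cov_sieve[OF c(1,2)] by (auto simp: sieve_def down_def)
      then have "(A \<inter> down C c) \<inter> down C d = A \<inter> down C d"
        using down_mono[OF weak_partial_order_axioms, of c d] c(1) by auto
      then show "(A \<inter> down C c) \<inter> down C d \<in> cov C d" using d c(3) by auto
    qed
    then show "c \<in> ?H" using c(1) by simp
  qed
  moreover have "A \<subseteq> ?H"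
  proof
    fix a assume a: "a \<in> A"
    then have "A \<inter> down C a = down C a" using assms by (auto simp: lower_set_def down_def)
    then show "a \<in> ?H" using a A cov_maximal by auto
  qed
  ultimately show "ideal_hull C A \<subseteq> ?H" by (rule ideal_hull_least)
  show "?H \<subseteq> ideal_hull C A"
    unfolding ideal_hull_def using ideal_cov by fastforce
qed

lemma Union_ideals: "\<A> \<subseteq> {I. is_ideal C I} \<Longrightarrow> \<Union>\<A> \<subseteq> carrier C" "\<A> \<subseteq> {I. is_ideal C I} \<Longrightarrow> lower_set C (\<Union>\<A>)"
  by (auto simp: is_ideal_def lower_set_def)

lemma Id_frame_lub:
  assumes "\<A> \<subseteq> {I. is_ideal C I}"
  shows "is_lub (Id_frame C) (ideal_hull C (\<Union>\<A>)) \<A>"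
proof (rule least_UpperI)
  show "\<A> \<subseteq> carrier (Id_frame C)" using assms by simp
  show "ideal_hull C (\<Union>\<A>) \<in> carrier (Id_frame C)"
    using is_ideal_hull[OF Union_ideals(1)[OF assms]] by simp
  show "I \<sqsubseteq>\<^bsub>Id_frame C\<^esub> ideal_hull C (\<Union>\<A>)" if "I \<in> \<A>" for I
    using that ideal_hull_superset[of "\<Union>\<A>" C] by auto
  fix J assume "J \<in> Upper (Id_frame C) \<A>"
  then have "is_ideal C J" "\<Union>\<A> \<subseteq> J" using assms by (auto simp: Upper_def)
  then show "ideal_hull C (\<Union>\<A>) \<sqsubseteq>\<^bsub>Id_frame C\<^esub> J" by (simp add: ideal_hull_least)
qed

lemma Id_frame_sup:
  assumes "\<A> \<subseteq> {I. is_ideal C I}"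
  shows "\<Squnion>\<^bsub>Id_frame C\<^esub>\<A> = ideal_hull C (\<Union>\<A>)"
proof -
  interpret P: partial_order "Id_frame C" by (rule partial_order_Id_frame)
  show ?thesis
    unfolding sup_def
    by (rule some_equality, rule Id_frame_lub[OF assms]) (rule P.least_unique[OF _ Id_frame_lub[OF assms]])
qed

lemma Id_frame_meet:
  assumes "is_ideal C I" "is_ideal C J"
  shows "I \<sqinter>\<^bsub>Id_frame C\<^esub> J = I \<inter> J"
proof -
  interpret P: partial_order "Id_frame C" by (rule partial_order_Id_frame)
  have glb: "is_glb (Id_frame C) (I \<inter> J) {I, J}"
    using assms ideal_Int by (auto simp: greatest_def Lower_def)
  show ?thesis
    unfolding meet_def inf_def
    by (rule some_equality, rule glb) (rule P.greatest_unique[OF _ glb])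
qed

text \<open>Distributivity holds because membership of \<open>c\<close> in a hull depends only on the part below \<open>c\<close>, and for \<open>c\<close>
  in \<open>I\<close> intersecting with \<open>I\<close> does not change that part.\<close>

lemma frame_Id_frame: "frame (Id_frame C)"
proof -
  interpret P: partial_order "Id_frame C" by (rule partial_order_Id_frame)
  show ?thesis
  proof
    fix \<A> assume \<A>: "\<A> \<subseteq> carrier (Id_frame C)"
    show "\<exists>s. is_lub (Id_frame C) s \<A>" using Id_frame_lub \<A> by auto
    \<comment> \<open>The carrier is inserted because the infimum of the empty family is the greatest ideal.\<close>
    have "is_glb (Id_frame C) (\<Inter>(insert (carrier C) \<A>)) \<A>"
    proof (rule greatest_LowerI)
      show "\<Inter>(insert (carrier C) \<A>) \<in> carrier (Id_frame C)"
        using \<A> ideal_Inter[of "insert (carrier C) \<A>"] ideal_carrier by auto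
      fix J assume "J \<in> Lower (Id_frame C) \<A>"
      then show "J \<sqsubseteq>\<^bsub>Id_frame C\<^esub> \<Inter>(insert (carrier C) \<A>)"
        using \<A> ideal_subset[of C J] by (auto simp: Lower_def)
    qed (use \<A> in auto)
    then show "\<exists>s. is_glb (Id_frame C) s \<A>" ..
  next
    fix I \<A> assume I: "I \<in> carrier (Id_frame C)" and \<A>: "\<A> \<subseteq> carrier (Id_frame C)"
    have hull: "is_ideal C (ideal_hull C (\<Union>\<A>))" using \<A> is_ideal_hull Union_ideals(1) by simp
    let ?\<B> = "(\<lambda>a. I \<inter> a) ` \<A>"
    have \<B>: "?\<B> \<subseteq> {I. is_ideal C I}" using I \<A> ideal_Int by auto
    have "I \<inter> ideal_hull C (\<Union>\<A>) = ideal_hull C (\<Union>?\<B>)"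
    proof (rule subset_antisym)
      show "ideal_hull C (\<Union>?\<B>) \<subseteq> I \<inter> ideal_hull C (\<Union>\<A>)"
        using ideal_hull_superset[of "\<Union>\<A>" C] I hull
        by (intro ideal_hull_least ideal_Int) auto
      show "I \<inter> ideal_hull C (\<Union>\<A>) \<subseteq> ideal_hull C (\<Union>?\<B>)"
      proof
        fix c assume c: "c \<in> I \<inter> ideal_hull C (\<Union>\<A>)"
        then have "\<Union>?\<B> \<inter> down C c = \<Union>\<A> \<inter> down C c"
          using ideal_down[of C I c] I by auto
        then show "c \<in> ideal_hull C (\<Union>?\<B>)"
          using c \<A> Union_ideals(2)[OF \<B>] Union_ideals(2)[of \<A>] by (simp add: ideal_hull_lower_set)
      qed
    qed
    moreover have "(\<lambda>a. I \<sqinter>\<^bsub>Id_frame C\<^esub> a) ` \<A> = ?\<B>"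
      using I \<A> Id_frame_meet by (intro image_cong) auto
    ultimately show "I \<sqinter>\<^bsub>Id_frame C\<^esub> \<Squnion>\<^bsub>Id_frame C\<^esub>\<A>
        = \<Squnion>\<^bsub>Id_frame C\<^esub>((\<lambda>a. I \<sqinter>\<^bsub>Id_frame C\<^esub> a) ` \<A>)"
      using I \<A> \<B> hull by (simp add: Id_frame_sup Id_frame_meet)
  qed
qed

end

locale subcanonical_site = poset_site +
  assumes subcanonical_axiom: "subcanonical C"
begin

lemma ideal_down_set: "c \<in> carrier C \<Longrightarrow> is_ideal C (down C c)"
  unfolding is_ideal_def
proof (intro conjI ballI impI)
  assume c: "c \<in> carrier C"
  show "lower_set C (down C c)"
    using c by (auto simp: lower_set_def down_def intro: le_trans)
  fix d S assume d: "d \<in> carrier C" "S \<in> cov C d" "S \<subseteq> down C c"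
  then have "is_lub C d S" using subcanonical_axiom by (simp add: subcanonical_def)
  moreover have "c \<in> Upper C S" using d c by (auto simp: Upper_def down_def)
  ultimately show "d \<in> down C c" using d(1) by (auto simp: least_def down_def)
qed

lemma self_in_down: "c \<in> carrier C \<Longrightarrow> c \<in> down C c"
  by (simp add: down_def)

lemma hull_singleton: "c \<in> carrier C \<Longrightarrow> ideal_hull C {c} = down C c"
  using ideal_hull_least[OF ideal_down_set[of c], of "{c}"] self_in_down[of c]
    ideal_down[OF is_ideal_hull[of "{c}"], of c] ideal_hull_superset[of "{c}" C] by auto

lemma principal_ideals_eq: "principal_ideals C = down C ` carrier C"
  unfolding principal_ideals_def by (simp add: hull_singleton)

lemma down_le_iff: "\<lbrakk>c \<in> carrier C; d \<in> carrier C\<rbrakk> \<Longrightarrow> down C c \<subseteq> down C d \<longleftrightarrow> c \<sqsubseteq> d"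
  using down_mono[OF weak_partial_order_axioms, of d c] self_in_down[of c] by (auto simp: down_def)

lemma down_inj: "inj_on (down C) (carrier C)"
  by (rule inj_onI) (metis down_le_iff le_antisym subset_refl)

lemma ideal_sup_down:
  assumes "I \<subseteq> carrier C" "lower_set C I"
  shows "\<Squnion>\<^bsub>Id_frame C\<^esub>(down C ` I) = ideal_hull C I"
proof -
  have "\<Union>(down C ` I) = I"
  proof (intro subset_antisym subsetI)
    show "x \<in> I" if "x \<in> \<Union>(down C ` I)" for x
      using that assms(2) by (auto simp: lower_set_def down_def)
    show "x \<in> \<Union>(down C ` I)" if "x \<in> I" for x
      using that assms(1) self_in_down[of x] by blast
  qed
  then show ?thesis using Id_frame_sup[of "down C ` I"] assms(1) ideal_down_set by auto
qed

lemma ideal_eq_sup_down: "is_ideal C I \<Longrightarrow> \<Squnion>\<^bsub>Id_frame C\<^esub>(down C ` I) = I"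
  using ideal_sup_down[of I] ideal_hull_ideal[of C I] by (simp add: is_ideal_def lower_set_def)

lemma down_basis: "is_basis (Id_frame C) (down C ` carrier C)"
  unfolding is_basis_def
proof (intro conjI ballI)
  show "down C ` carrier C \<subseteq> carrier (Id_frame C)" using ideal_down_set by auto
  fix I assume "I \<in> carrier (Id_frame C)"
  then have "down C ` I \<subseteq> down C ` carrier C" "\<Squnion>\<^bsub>Id_frame C\<^esub>(down C ` I) = I"
    using ideal_eq_sup_down[of I] ideal_subset[of C I] by (simp_all add: image_mono)
  then show "\<exists>S\<subseteq>down C ` carrier C. \<Squnion>\<^bsub>Id_frame C\<^esub>S = I" by (intro exI conjI)
qed

lemma down_order_emb: "order_emb C (Id_frame C) (down C)"
  using weak_partial_order_axioms partial_order.axioms(1)[OF partial_order_Id_frame, of C]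
  by (simp add: order_emb_def down_le_iff)

text \<open>The topology can be read off from the frame of ideals.\<close>

lemma cov_iff_hull:
  assumes "c \<in> carrier C" "sieve C c S"
  shows "S \<in> cov C c \<longleftrightarrow> ideal_hull C S = down C c"
proof -
  have S: "lower_set C S" "S \<subseteq> down C c" "S \<inter> down C c = S" using assms(2) by (auto simp: sieve_def)
  have "ideal_hull C S \<subseteq> down C c" using S ideal_down_set[OF assms(1)] ideal_hull_least by blast
  moreover have "c \<in> ideal_hull C S \<longleftrightarrow> down C c \<subseteq> ideal_hull C S"
    using self_in_down[OF assms(1)] ideal_down[OF is_ideal_hull[of S], of c] S(1)
    by (auto simp: lower_set_def)
  moreover have "c \<in> ideal_hull C S \<longleftrightarrow> S \<in> cov C c"
    using assms(1) S by (simp add: ideal_hull_lower_set)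
  ultimately show ?thesis by auto
qed

text \<open>A subcanonical site is isomorphic to the poset of its principal ideals, with the topology induced by
  the canonical topology of the frame. This is what allows a site to be recovered from its frame of
  ideals once the principal ideals are known.\<close>

lemma down_site_iso: "site_iso C (induced_site (Id_frame C) (down C ` carrier C)) (down C)"
proof -
  let ?B = "down C ` carrier C"
  have B: "?B \<subseteq> carrier (Id_frame C)" using ideal_down_set by auto
  have po: "weak_partial_order (induced_site (Id_frame C) ?B)"
    using partial_order_induced_site[OF partial_order_Id_frame B] by (simp add: partial_order_def)
  have "order_iso C (induced_site (Id_frame C) ?B) (down C)"
    by (rule order_isoI) (use po weak_partial_order_axioms down_inj down_le_iff in auto)
  moreover have "cov (induced_site (Id_frame C) ?B) (down C c) = (`) (down C) ` cov C c"
    if c: "c \<in> carrier C" for c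
  proof -
    note cov_iff = cov_induced_site[OF frame_Id_frame B imageI[OF c], simplified]
    have eq: "down C ` R \<in> cov (induced_site (Id_frame C) ?B) (down C c) \<longleftrightarrow> R \<in> cov C c"
      if R: "R \<subseteq> carrier C" for R
    proof -
      have low: "(\<forall>s\<in>down C ` R. \<forall>d\<in>carrier C. down C d \<subseteq> s \<longrightarrow> down C d \<in> down C ` R) \<longleftrightarrow> lower_set C R"
      proof -
        have "down C d \<in> down C ` R \<longleftrightarrow> d \<in> R" if "d \<in> carrier C" for d
          by (rule inj_on_image_mem_iff[OF down_inj that R])
        moreover have "down C d \<subseteq> down C s \<longleftrightarrow> d \<sqsubseteq> s" if "d \<in> carrier C" "s \<in> R" for d s
          using that R by (intro down_le_iff) auto
        ultimately show ?thesis using R by (simp add: lower_set_def)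
      qed
      show ?thesis
      proof
        assume a: "down C ` R \<in> cov (induced_site (Id_frame C) ?B) (down C c)"
        then have l: "lower_set C R" using low by (simp add: cov_iff)
        then have h: "ideal_hull C R = down C c" using a ideal_sup_down[OF R] by (simp add: cov_iff)
        then have "sieve C c R" using l ideal_hull_superset[of R C] by (simp add: sieve_def)
        then show "R \<in> cov C c" using h cov_iff_hull c by simp
      next
        assume a: "R \<in> cov C c"
        then have "lower_set C R" "ideal_hull C R = down C c"
          using cov_iff_hull[OF c] cov_sieve[OF c a] a by (simp_all add: sieve_def)
        then show "down C ` R \<in> cov (induced_site (Id_frame C) ?B) (down C c)"
          using low ideal_sup_down[OF R] R by (simp add: cov_iff image_mono)
      qed
    qed
    have "\<exists>R\<subseteq>carrier C. S = down C ` R" if "S \<in> cov (induced_site (Id_frame C) ?B) (down C c)" for S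
      using that by (auto simp: cov_iff subset_image_iff)
    then show ?thesis using eq cov_subset[OF c] by (intro image_family_eqI[of "carrier C"])
  qed
  ultimately show ?thesis by (simp add: site_iso_def)
qed

end

section \<open>Ideals along morphisms and isomorphisms of sites\<close>

lemma inj_on_image_subset_iff:
  "\<lbrakk>inj_on f A; X \<subseteq> A; Y \<subseteq> A\<rbrakk> \<Longrightarrow> f ` X \<subseteq> f ` Y \<longleftrightarrow> X \<subseteq> Y"
  by (metis image_mono inj_on_image_mem_iff image_subset_iff subsetD subsetI)

text \<open>The image under an isomorphism of sites needs no closing up. Hence \<open>A_map\<close> of an isomorphism is the
  direct image.\<close>

lemma site_iso_ideal_image:
  assumes "site_iso C D \<phi>" "is_ideal C I" "\<And>c S. \<lbrakk>c \<in> carrier C; S \<in> cov C c\<rbrakk> \<Longrightarrow> S \<subseteq> carrier C"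
  shows "is_ideal D (\<phi> ` I)"
  unfolding is_ideal_def
proof (intro conjI ballI impI)
  have iso: "order_iso C D \<phi>" using assms(1) by (rule site_iso_order_iso)
  have I: "I \<subseteq> carrier C" by (rule ideal_subset[OF assms(2)])
  show "lower_set D (\<phi> ` I)"
    using order_iso_lower_set[OF iso] assms(2) by (simp add: is_ideal_def)
  fix d S assume d: "d \<in> carrier D" "S \<in> cov D d" "S \<subseteq> \<phi> ` I"
  obtain c where c: "c \<in> carrier C" "d = \<phi> c" using d(1) order_iso_carrier[OF iso] by blast
  then obtain R where R: "R \<in> cov C c" "S = \<phi> ` R" using d(2) site_iso_cov[OF assms(1)] by auto
  have "R \<subseteq> I"
    using d(3) R(2) inj_on_image_subset_iff[OF order_iso_inj[OF iso] assms(3)[OF c(1) R(1)] I] by simp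
  then show "d \<in> \<phi> ` I" using ideal_cov[OF assms(2) c(1) R(1)] c(2) by simp
qed

context poset_site
begin

text \<open>The preimage is the right adjoint of \<open>A_map C D h\<close>. It is a lower set because \<open>h\<close> is monotone,
  and it contains what it covers because \<open>h\<close> preserves covers.\<close>

lemma site_morphism_comap_ideal:
  assumes "site_morphism C D h" "is_ideal D J"
  shows "is_ideal C {c \<in> carrier C. h c \<in> J}"
  unfolding is_ideal_def
proof (intro conjI ballI impI)
  have h: "h \<in> carrier C \<rightarrow> carrier D" "isotone C D h"
    "\<And>c S. \<lbrakk>c \<in> carrier C; S \<in> cov C c\<rbrakk> \<Longrightarrow> generated D (h ` S) \<in> cov D (h c)"
    using assms(1) unfolding site_morphism_def by blast+
  show "lower_set C {c \<in> carrier C. h c \<in> J}"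
    unfolding lower_set_def
  proof (intro conjI ballI impI)
    fix c d assume "c \<in> {c \<in> carrier C. h c \<in> J}" "d \<in> carrier C" "d \<sqsubseteq> c"
    then show "d \<in> {c \<in> carrier C. h c \<in> J}"
      using h(1,2) ideal_lower[OF assms(2), of "h c" "h d"] by (auto simp: isotone_def)
  qed auto
  fix c S assume c: "c \<in> carrier C" "S \<in> cov C c" "S \<subseteq> {c \<in> carrier C. h c \<in> J}"
  have "generated D (h ` S) \<subseteq> J"
    using c(3) ideal_lower[OF assms(2)] by (auto simp: generated_def)
  then have "h c \<in> J"
    using ideal_cov[OF assms(2) _ h(3)[OF c(1,2)]] h(1) c(1) by auto
  then show "c \<in> {c \<in> carrier C. h c \<in> J}" using c(1) by simp
qed

end

lemma A_map_eq: "is_ideal C I \<Longrightarrow> A_map C D h I = ideal_hull D (h ` I)"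
  by (simp add: A_map_def)

lemma image_ideal_subset:
  "\<lbrakk>h \<in> carrier C \<rightarrow> carrier D; is_ideal C I\<rbrakk> \<Longrightarrow> h ` I \<subseteq> carrier D"
  using ideal_subset by blast

lemma site_morphism_maps: "site_morphism C D h \<Longrightarrow> h \<in> carrier C \<rightarrow> carrier D"
  by (simp add: site_morphism_def)

lemma A_map_ideal:
  assumes "poset_site D" "h \<in> carrier C \<rightarrow> carrier D" "is_ideal C I"
  shows "is_ideal D (A_map C D h I)"
  using poset_site.is_ideal_hull[OF assms(1) image_ideal_subset[OF assms(2,3)]] assms(3)
  by (simp add: A_map_eq)

lemma A_map_subset_iff:
  assumes "is_ideal C I" "is_ideal D J"
  shows "A_map C D h I \<subseteq> J \<longleftrightarrow> h ` I \<subseteq> J"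
  using assms ideal_hull_least[of D J "h ` I"] ideal_hull_superset[of "h ` I" D]
  by (auto simp: A_map_eq)

text \<open>Since preimages of ideals are ideals, every ideal that contains \<open>h ` X\<close> contains the image of
  the whole hull of \<open>X\<close>. Functoriality of \<open>A_map\<close> and its value on principal ideals both follow.\<close>

lemma A_map_hull:
  assumes "poset_site C" "poset_site D" "site_morphism C D h" "X \<subseteq> carrier C"
  shows "ideal_hull D (h ` ideal_hull C X) = ideal_hull D (h ` X)"
proof (rule subset_antisym)
  interpret C: poset_site C by fact
  interpret D: poset_site D by fact
  have h: "h \<in> carrier C \<rightarrow> carrier D" by (rule site_morphism_maps[OF assms(3)])
  have hull: "is_ideal C (ideal_hull C X)" by (rule C.is_ideal_hull[OF assms(4)])
  let ?J = "ideal_hull D (h ` X)"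
  have J: "is_ideal D ?J" using h assms(4) by (intro D.is_ideal_hull) auto
  have "ideal_hull C X \<subseteq> {c \<in> carrier C. h c \<in> ?J}"
    using C.site_morphism_comap_ideal[OF assms(3) J] assms(4) ideal_hull_superset[of "h ` X" D]
    by (intro ideal_hull_least) auto
  then show "ideal_hull D (h ` ideal_hull C X) \<subseteq> ?J"
    by (intro ideal_hull_least[OF J]) auto
  have "is_ideal D (ideal_hull D (h ` ideal_hull C X))"
    using image_ideal_subset[OF h hull] by (rule D.is_ideal_hull)
  then show "?J \<subseteq> ideal_hull D (h ` ideal_hull C X)"
    using ideal_hull_superset[of "h ` ideal_hull C X" D] ideal_hull_superset[of X C]
    by (intro ideal_hull_least) auto
qed

lemma A_map_comp:
  assumes "poset_site D" "poset_site E" "h \<in> carrier C \<rightarrow> carrier D" "site_morphism D E k" "is_ideal C I"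
    "\<And>c. c \<in> carrier C \<Longrightarrow> l c = k (h c)"
  shows "A_map C E l I = A_map D E k (A_map C D h I)"
proof -
  have I: "h ` I \<subseteq> carrier D" by (rule image_ideal_subset[OF assms(3,5)])
  have "l ` I = k ` h ` I" using assms(6) ideal_subset[OF assms(5)] by (auto simp: image_image intro!: image_cong)
  then show ?thesis
    using A_map_hull[OF assms(1,2,4) I] assms(5) A_map_ideal[OF assms(1,3,5)] by (simp add: A_map_eq)
qed

lemma A_map_ident: "\<lbrakk>is_ideal C I; \<And>c. c \<in> carrier C \<Longrightarrow> h c = c\<rbrakk> \<Longrightarrow> A_map C C h I = I"
proof -
  assume I: "is_ideal C I" and h: "\<And>c. c \<in> carrier C \<Longrightarrow> h c = c"
  have "h ` I = I" using h ideal_subset[OF I] by (force simp: image_iff)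
  then show ?thesis using I by (simp add: A_map_eq ideal_hull_ideal)
qed

lemma A_map_site_iso:
  assumes "site_iso C D \<phi>" "is_ideal C I" "\<And>c S. \<lbrakk>c \<in> carrier C; S \<in> cov C c\<rbrakk> \<Longrightarrow> S \<subseteq> carrier C"
  shows "A_map C D \<phi> I = \<phi> ` I"
  using site_iso_ideal_image[OF assms] assms(2) by (simp add: A_map_eq ideal_hull_ideal)

lemma Id_frame_site_iso:
  assumes "site_iso C D \<phi>" "\<And>c S. \<lbrakk>c \<in> carrier C; S \<in> cov C c\<rbrakk> \<Longrightarrow> S \<subseteq> carrier C"
  shows "order_iso (Id_frame C) (Id_frame D) ((`) \<phi>)"
proof (rule order_isoI)
  have iso: "order_iso C D \<phi>" by (rule site_iso_order_iso[OF assms(1)])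
  have inv: "site_iso D C (inv_into (carrier C) \<phi>)" by (rule site_iso_inv[OF assms])
  have covD: "S \<subseteq> carrier D" if d: "d \<in> carrier D" "S \<in> cov D d" for d S
  proof -
    obtain c where c: "c \<in> carrier C" "d = \<phi> c"
      using d(1) order_iso_carrier[OF iso] by blast
    then obtain R where R: "R \<in> cov C c" "S = \<phi> ` R" using d(2) site_iso_cov[OF assms(1)] by auto
    show ?thesis
      unfolding R(2) using assms(2)[OF c(1) R(1)] order_iso_in[OF iso] by (intro image_subsetI) (rule order_iso_in[OF iso], blast)
  qed
  show "weak_partial_order (Id_frame C)" "weak_partial_order (Id_frame D)"
    by (rule partial_order.axioms(1)[OF partial_order_Id_frame])+
  show "(`) \<phi> ` carrier (Id_frame C) = carrier (Id_frame D)"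
  proof (intro subset_antisym subsetI)
    show "J \<in> carrier (Id_frame D)" if "J \<in> (`) \<phi> ` carrier (Id_frame C)" for J
      using that site_iso_ideal_image[OF assms(1) _ assms(2)] by auto
    fix J assume "J \<in> carrier (Id_frame D)"
    then have J: "is_ideal D J" by simp
    have "is_ideal C (inv_into (carrier C) \<phi> ` J)" by (rule site_iso_ideal_image[OF inv J covD])
    moreover have "\<phi> ` inv_into (carrier C) \<phi> ` J = J"
      by (rule image_inv_into_cancel[OF order_iso_carrier[OF iso] ideal_subset[OF J]])
    ultimately show "J \<in> (`) \<phi> ` carrier (Id_frame C)" by (metis Id_frame_simps(1) image_eqI mem_Collect_eq)
  qed
  have *: "\<phi> ` I \<subseteq> \<phi> ` J \<longleftrightarrow> I \<subseteq> J" if "is_ideal C I" "is_ideal C J" for I J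
    by (rule inj_on_image_subset_iff[OF order_iso_inj[OF iso] that[THEN ideal_subset]])
  then show "inj_on ((`) \<phi>) (carrier (Id_frame C))"
    by (intro inj_onI) (metis Id_frame_simps(1) mem_Collect_eq subset_antisym subset_refl)
  show "\<phi> ` I \<sqsubseteq>\<^bsub>Id_frame D\<^esub> \<phi> ` J \<longleftrightarrow> I \<sqsubseteq>\<^bsub>Id_frame C\<^esub> J"
    if "I \<in> carrier (Id_frame C)" "J \<in> carrier (Id_frame C)" for I J
    using * that by simp
qed

lemma A_map_down:
  assumes "subcanonical_site C" "subcanonical_site D" "site_morphism C D h" "c \<in> carrier C"
  shows "A_map C D h (down C c) = down D (h c)"
proof -
  interpret C: subcanonical_site C by fact
  interpret D: subcanonical_site D by fact
  have "h c \<in> carrier D" using site_morphism_maps[OF assms(3)] assms(4) by blast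
  then show ?thesis
    using A_map_hull[OF C.poset_site_axioms D.poset_site_axioms assms(3), of "{c}"] assms(4)
    by (simp add: A_map_eq C.ideal_down_set C.hull_singleton D.hull_singleton)
qed

text \<open>Each axiom is checked on the preimages under \<open>\<phi>\<close>, which commutes with principal lower sets and, by
  injectivity, with intersections.\<close>

lemma poset_site_iso:
  assumes "poset_site C" "partial_order D" "site_iso C D \<phi>"
  shows "poset_site D"
proof -
  interpret C: poset_site C by fact
  interpret D: partial_order D by fact
  have iso: "order_iso C D \<phi>" by (rule site_iso_order_iso[OF assms(3)])
  note le = order_iso_le[OF iso] and inj = order_iso_inj[OF iso] and mem = order_iso_in[OF iso]
  have covE: "\<exists>R\<in>cov C c. S = \<phi> ` R" if "c \<in> carrier C" "S \<in> cov D (\<phi> c)" for c S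
    using that site_iso_cov[OF assms(3)] by auto
  have covI: "\<phi> ` R \<in> cov D (\<phi> c)" if "c \<in> carrier C" "R \<in> cov C c" for c R
    using that site_iso_cov[OF assms(3)] by auto
  have carrE: "\<exists>c\<in>carrier C. d = \<phi> c" if "d \<in> carrier D" for d
    using that order_iso_carrier[OF iso] by blast
  note down = order_iso_down[OF iso]
  have Int: "\<phi> ` R \<inter> down D (\<phi> c) = \<phi> ` (R \<inter> down C c)" if "c \<in> carrier C" "R \<subseteq> carrier C" for c R
    using that inj_on_image_Int[OF inj that(2), of "down C c"] down[OF that(1)] by (auto simp: down_def)
  have sieveI: "sieve D (\<phi> c) (\<phi> ` R) \<longleftrightarrow> sieve C c R" if "c \<in> carrier C" "R \<subseteq> carrier C" for c R
  proof -
    have "lower_set C R" if "lower_set D (\<phi> ` R)"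
      unfolding lower_set_def
    proof (intro conjI ballI impI)
      fix r d assume "r \<in> R" "d \<in> carrier C" "d \<sqsubseteq>\<^bsub>C\<^esub> r"
      then have "\<phi> d \<in> \<phi> ` R" using \<open>R \<subseteq> carrier C\<close> that le[of d r] mem[of d] by (auto simp: lower_set_def)
      then show "d \<in> R" using inj_on_image_mem_iff[OF inj] \<open>R \<subseteq> carrier C\<close> \<open>d \<in> carrier C\<close> by blast
    qed fact
    moreover have "\<phi> ` R \<subseteq> down D (\<phi> c) \<longleftrightarrow> R \<subseteq> down C c"
      unfolding down[OF that(1)] by (rule inj_on_image_subset_iff[OF inj that(2)]) (auto simp: down_def)
    ultimately show ?thesis using order_iso_lower_set[OF iso] by (auto simp: sieve_def)
  qed
  show ?thesis
  proof
    fix d S assume "d \<in> carrier D" "S \<in> cov D d"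
    then obtain c R where "c \<in> carrier C" "d = \<phi> c" "R \<in> cov C c" "S = \<phi> ` R"
      using carrE covE by metis
    then show "sieve D d S" using sieveI C.cov_sieve C.cov_subset by simp
  next
    fix d assume "d \<in> carrier D"
    then show "down D d \<in> cov D d" using carrE covI C.cov_maximal down by metis
  next
    fix d S e assume "d \<in> carrier D" "S \<in> cov D d" "e \<in> carrier D" "e \<sqsubseteq>\<^bsub>D\<^esub> d"
    moreover then obtain c R b where "c \<in> carrier C" "d = \<phi> c" "R \<in> cov C c" "S = \<phi> ` R"
      "b \<in> carrier C" "e = \<phi> b"
      using carrE covE by metis
    ultimately show "S \<inter> down D e \<in> cov D e"
      using Int[of b R] C.cov_subset[of c R] C.cov_stable[of c R b] le covI by simp
  next
    fix d S T assume a: "d \<in> carrier D" "S \<in> cov D d" "sieve D d T"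
      "\<And>e. e \<in> S \<Longrightarrow> T \<inter> down D e \<in> cov D e"
    then obtain c R where c: "c \<in> carrier C" "d = \<phi> c" "R \<in> cov C c" "S = \<phi> ` R"
      using carrE covE by metis
    have "T \<subseteq> \<phi> ` carrier C"
      using a(3) order_iso_carrier[OF iso] by (auto simp: sieve_def lower_set_def)
    then obtain Q where Q: "Q \<subseteq> carrier C" "T = \<phi> ` Q" by (auto simp: subset_image_iff)
    have "Q \<in> cov C c"
    proof (rule C.cov_transitive[OF c(1,3)])
      show "sieve C c Q" using a(3) Q c sieveI by simp
      fix b assume b: "b \<in> R"
      then have bc: "b \<in> carrier C" using C.cov_subset[OF c(1,3)] by blast
      then have "\<phi> ` (Q \<inter> down C b) \<in> cov D (\<phi> b)" using a(4)[of "\<phi> b"] b c(4) Q Int by simp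
      then obtain P where P: "P \<in> cov C b" "\<phi> ` (Q \<inter> down C b) = \<phi> ` P" using covE[OF bc] by blast
      have "Q \<inter> down C b = P"
        using P inj_on_image_eq_iff[OF inj, of "Q \<inter> down C b" P] Q(1) C.cov_subset[OF bc P(1)] by auto
      then show "Q \<inter> down C b \<in> cov C b" using P by simp
    qed
    then show "T \<in> cov D d" using c Q covI by simp
  qed
qed

lemma subcanonical_site_iso:
  assumes "subcanonical_site C" "partial_order D" "site_iso C D \<phi>"
  shows "subcanonical_site D"
proof -
  interpret C: subcanonical_site C by fact
  interpret D: poset_site D by (rule poset_site_iso[OF C.poset_site_axioms assms(2,3)])
  have iso: "order_iso C D \<phi>" by (rule site_iso_order_iso[OF assms(3)])
  note le = order_iso_le[OF iso] and mem = order_iso_in[OF iso]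
  have "is_lub D d S" if d: "d \<in> carrier D" "S \<in> cov D d" for d S
  proof -
    obtain c where c: "c \<in> carrier C" "d = \<phi> c" using d(1) order_iso_carrier[OF iso] by blast
    obtain R where R: "R \<in> cov C c" "S = \<phi> ` R" using d(2) c site_iso_cov[OF assms(3)] by auto
    have Rc: "R \<subseteq> carrier C" by (rule C.cov_subset[OF c(1) R(1)])
    have lub: "is_lub C c R" using C.subcanonical_axiom c R by (simp add: subcanonical_def)
    show ?thesis
    proof (rule least_UpperI)
      show "S \<subseteq> carrier D" "d \<in> carrier D" using R Rc mem d by auto
      show "x \<sqsubseteq>\<^bsub>D\<^esub> d" if "x \<in> S" for x
      proof -
        obtain r where "r \<in> R" "x = \<phi> r" using \<open>x \<in> S\<close> R(2) by blast
        then show ?thesis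
          using least_Upper_above[OF lub _ Rc, of r] c le[of r c] Rc by auto
      qed
      fix y assume y: "y \<in> Upper D S"
      obtain b where b: "b \<in> carrier C" "y = \<phi> b"
        using y Upper_closed[of D S] order_iso_carrier[OF iso] by blast
      have "b \<in> Upper C R"
      proof (rule Upper_memI)
        fix r assume "r \<in> R"
        then have "\<phi> r \<sqsubseteq>\<^bsub>D\<^esub> \<phi> b" using y b R mem Rc by (auto simp: Upper_def)
        then show "r \<sqsubseteq>\<^bsub>C\<^esub> b" using le[of r b] \<open>r \<in> R\<close> Rc b by blast
      qed fact
      then show "d \<sqsubseteq>\<^bsub>D\<^esub> y" using lub b c le by (auto simp: least_def)
    qed
  qed
  then show ?thesis by unfold_locales (simp add: subcanonical_def)
qed

section \<open>Sheaf categories determine the frame of ideals\<close>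

lemma categorical_inverses_sym: "categorical_inverses \<A> \<B> F G \<Longrightarrow> categorical_inverses \<B> \<A> G F"
  by (auto simp: categorical_inverses_def)

lemma iso_arrow_cancel_left:
  assumes "category \<C>" "iso_arrow \<C> y z e" "x \<in> obj \<C>" "y \<in> obj \<C>" "z \<in> obj \<C>"
    "a \<in> homs \<C> x y" "b \<in> homs \<C> x y" "comp \<C> x y z e a = comp \<C> x y z e b"
  shows "a = b"
proof -
  interpret category \<C> by fact
  obtain d where d: "d \<in> homs \<C> z y" "comp \<C> y z y d e = ide \<C> y" "e \<in> homs \<C> y z"
    using assms(2) by (auto simp: iso_arrow_def)
  have "f = comp \<C> x z y d (comp \<C> x y z e f)" if "f \<in> homs \<C> x y" for f
    using comp_assoc[of x y z y f e d] comp_ide_left[of x y f] assms(3-5) d that by simp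
  from this[OF assms(6)] this[OF assms(7)] show ?thesis using assms(8) by simp
qed

lemma iso_arrow_cancel_right:
  assumes "category \<C>" "iso_arrow \<C> x y e" "x \<in> obj \<C>" "y \<in> obj \<C>" "z \<in> obj \<C>"
    "a \<in> homs \<C> y z" "b \<in> homs \<C> y z" "comp \<C> x y z a e = comp \<C> x y z b e"
  shows "a = b"
proof -
  interpret category \<C> by fact
  obtain d where d: "d \<in> homs \<C> y x" "comp \<C> y x y e d = ide \<C> y" "e \<in> homs \<C> x y"
    using assms(2) by (auto simp: iso_arrow_def)
  have "f = comp \<C> y x z (comp \<C> x y z f e) d" if "f \<in> homs \<C> y z" for f
    using comp_assoc[of y x y z d e f] comp_ide_right[of y z f] assms(3-5) d that by simp
  from this[OF assms(6)] this[OF assms(7)] show ?thesis using assms(8) by simp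
qed

text \<open>Stated without reference to a terminal object, so that it is visibly preserved by equivalences.\<close>

definition subterminal :: "('o, 'a) cat \<Rightarrow> 'o \<Rightarrow> bool" where
  "subterminal \<C> x \<longleftrightarrow> x \<in> obj \<C> \<and> (\<forall>y\<in>obj \<C>. \<forall>a\<in>homs \<C> y x. \<forall>b\<in>homs \<C> y x. a = b)"

lemma counit:
  assumes "categorical_inverses \<A> \<B> F G"
  obtains \<eta> where "\<And>x. x \<in> obj \<A> \<Longrightarrow> iso_arrow \<A> (on_obj G (on_obj F x)) x (\<eta> x)"
    "\<And>x y a. \<lbrakk>x \<in> obj \<A>; y \<in> obj \<A>; a \<in> homs \<A> x y\<rbrakk> \<Longrightarrow>
      comp \<A> (on_obj G (on_obj F x)) (on_obj G (on_obj F y)) y (\<eta> y)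
        (on_arr G (on_obj F x) (on_obj F y) (on_arr F x y a))
      = comp \<A> (on_obj G (on_obj F x)) x y a (\<eta> x)"
proof -
  have "naturally_isomorphic \<A> \<A> (comp_functor G F) id_functor"
    using assms by (simp add: categorical_inverses_def)
  then obtain \<eta> where "(\<forall>x\<in>obj \<A>. iso_arrow \<A> (on_obj G (on_obj F x)) x (\<eta> x)) \<and>
      (\<forall>x\<in>obj \<A>. \<forall>y\<in>obj \<A>. \<forall>a\<in>homs \<A> x y.
        comp \<A> (on_obj G (on_obj F x)) (on_obj G (on_obj F y)) y (\<eta> y)
          (on_arr G (on_obj F x) (on_obj F y) (on_arr F x y a))
        = comp \<A> (on_obj G (on_obj F x)) x y a (\<eta> x))"
    by (auto simp: naturally_isomorphic_def comp_functor_def id_functor_def)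
  then show thesis by (intro that[of \<eta>]) simp_all
qed

lemma equivalence_faithful:
  assumes "categorical_inverses \<A> \<B> F G" "x \<in> obj \<A>" "y \<in> obj \<A>"
    "a \<in> homs \<A> x y" "b \<in> homs \<A> x y" "on_arr F x y a = on_arr F x y b"
  shows "a = b"
proof -
  interpret F: cat_functor \<A> \<B> F using assms(1) by (simp add: categorical_inverses_def)
  interpret G: cat_functor \<B> \<A> G using assms(1) by (simp add: categorical_inverses_def)
  obtain \<eta> where \<eta>: "\<And>x. x \<in> obj \<A> \<Longrightarrow> iso_arrow \<A> (on_obj G (on_obj F x)) x (\<eta> x)"
    "\<And>x y a. \<lbrakk>x \<in> obj \<A>; y \<in> obj \<A>; a \<in> homs \<A> x y\<rbrakk> \<Longrightarrow>
      comp \<A> (on_obj G (on_obj F x)) (on_obj G (on_obj F y)) y (\<eta> y)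
        (on_arr G (on_obj F x) (on_obj F y) (on_arr F x y a))
      = comp \<A> (on_obj G (on_obj F x)) x y a (\<eta> x)"
    using counit[OF assms(1)] by metis
  have "comp \<A> (on_obj G (on_obj F x)) x y a (\<eta> x) = comp \<A> (on_obj G (on_obj F x)) x y b (\<eta> x)"
    using \<eta>(2)[of x y a] \<eta>(2)[of x y b] assms by simp
  then show ?thesis
    using iso_arrow_cancel_right[OF F.source.category_axioms \<eta>(1)[OF assms(2)]] assms
      F.on_obj_in G.on_obj_in by metis
qed

text \<open>Two arrows into \<open>F x\<close> become equal after applying \<open>G\<close> and composing with the isomorphism
  \<open>G (F x) \<cong> x\<close>; the isomorphism is cancelled and \<open>G\<close> is faithful.\<close>

lemma equivalence_subterminal:
  assumes "categorical_inverses \<A> \<B> F G" "subterminal \<A> x"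
  shows "subterminal \<B> (on_obj F x)"
  unfolding subterminal_def
proof (intro conjI ballI)
  interpret F: cat_functor \<A> \<B> F using assms(1) by (simp add: categorical_inverses_def)
  interpret G: cat_functor \<B> \<A> G using assms(1) by (simp add: categorical_inverses_def)
  have x: "x \<in> obj \<A>" using assms(2) by (simp add: subterminal_def)
  then show Fx: "on_obj F x \<in> obj \<B>" by (rule F.on_obj_in)
  fix y a b assume y: "y \<in> obj \<B>" and a: "a \<in> homs \<B> y (on_obj F x)" and b: "b \<in> homs \<B> y (on_obj F x)"
  obtain \<eta> where \<eta>: "\<And>x. x \<in> obj \<A> \<Longrightarrow> iso_arrow \<A> (on_obj G (on_obj F x)) x (\<eta> x)"
    using counit[OF assms(1)] by metis
  let ?Gy = "on_obj G y" and ?GFx = "on_obj G (on_obj F x)"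
  have ob: "?Gy \<in> obj \<A>" "?GFx \<in> obj \<A>" using y Fx G.on_obj_in by auto
  have Ga: "on_arr G y (on_obj F x) a \<in> homs \<A> ?Gy ?GFx" "on_arr G y (on_obj F x) b \<in> homs \<A> ?Gy ?GFx"
    using G.on_arr_in y Fx a b by auto
  have "\<eta> x \<in> homs \<A> ?GFx x" using \<eta>[OF x] by (simp add: iso_arrow_def)
  then have "comp \<A> ?Gy ?GFx x (\<eta> x) (on_arr G y (on_obj F x) a)
      = comp \<A> ?Gy ?GFx x (\<eta> x) (on_arr G y (on_obj F x) b)"
    using assms(2) F.source.comp_in ob x Ga unfolding subterminal_def by metis
  then have "on_arr G y (on_obj F x) a = on_arr G y (on_obj F x) b"
    by (rule iso_arrow_cancel_left[OF F.source.category_axioms \<eta>[OF x] ob x Ga])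
  then show "a = b"
    by (rule equivalence_faithful[OF categorical_inverses_sym[OF assms(1)] y Fx a b])
qed

lemma functor_hom:
  "\<lbrakk>cat_functor \<A> \<B> F; x \<in> obj \<A>; y \<in> obj \<A>; homs \<A> x y \<noteq> {}\<rbrakk> \<Longrightarrow> homs \<B> (on_obj F x) (on_obj F y) \<noteq> {}"
  using cat_functor.on_arr_in by fastforce

lemma category_hom_trans:
  "\<lbrakk>category \<C>; x \<in> obj \<C>; y \<in> obj \<C>; z \<in> obj \<C>; homs \<C> x y \<noteq> {}; homs \<C> y z \<noteq> {}\<rbrakk> \<Longrightarrow> homs \<C> x z \<noteq> {}"
  using category.comp_in by fastforce

lemma counit_homs:
  assumes "categorical_inverses \<A> \<B> F G" "x \<in> obj \<A>"
  shows "homs \<A> (on_obj G (on_obj F x)) x \<noteq> {}" "homs \<A> x (on_obj G (on_obj F x)) \<noteq> {}"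
proof -
  obtain \<eta> where \<eta>: "iso_arrow \<A> (on_obj G (on_obj F x)) x (\<eta> x)"
    using counit[OF assms(1)] assms(2) by metis
  then show "homs \<A> (on_obj G (on_obj F x)) x \<noteq> {}" "homs \<A> x (on_obj G (on_obj F x)) \<noteq> {}"
    by (auto simp: iso_arrow_def)
qed

lemma equivalence_hom_iff:
  assumes "categorical_inverses \<A> \<B> F G" "x \<in> obj \<A>" "y \<in> obj \<A>"
  shows "homs \<B> (on_obj F x) (on_obj F y) \<noteq> {} \<longleftrightarrow> homs \<A> x y \<noteq> {}"
proof
  have F: "cat_functor \<A> \<B> F" and G: "cat_functor \<B> \<A> G"
    using assms(1) by (simp_all add: categorical_inverses_def)
  interpret F: cat_functor \<A> \<B> F by fact
  interpret G: cat_functor \<B> \<A> G by fact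
  note ob = F.on_obj_in[OF assms(2)] F.on_obj_in[OF assms(3)]
  assume "homs \<B> (on_obj F x) (on_obj F y) \<noteq> {}"
  then have "homs \<A> (on_obj G (on_obj F x)) (on_obj G (on_obj F y)) \<noteq> {}"
    by (rule functor_hom[OF G ob])
  then have "homs \<A> x (on_obj G (on_obj F y)) \<noteq> {}"
    by (rule category_hom_trans[OF F.source.category_axioms assms(2) G.on_obj_in[OF ob(1)]
          G.on_obj_in[OF ob(2)] counit_homs(2)[OF assms(1,2)]])
  then show "homs \<A> x y \<noteq> {}"
    by (rule category_hom_trans[OF F.source.category_axioms assms(2) G.on_obj_in[OF ob(2)] assms(3)
          _ counit_homs(1)[OF assms(1,3)]])
next
  assume "homs \<A> x y \<noteq> {}"
  then show "homs \<B> (on_obj F x) (on_obj F y) \<noteq> {}"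
    using functor_hom[of \<A> \<B> F x y] assms by (simp add: categorical_inverses_def)
qed

text \<open>The subterminal sheaf of an ideal. The value \<open>undefined\<close> serves as the unique section, so that the
  construction works for every nonempty universe \<open>'s\<close>, however small.\<close>

definition indicator_sheaf :: "'a set \<Rightarrow> ('a, 's) presheaf" where
  "indicator_sheaf I = \<lparr>sec = (\<lambda>c. if c \<in> I then {undefined} else {}), res = (\<lambda>c d x. x)\<rparr>"

definition support :: "'a site \<Rightarrow> ('a, 's) presheaf \<Rightarrow> 'a set" where
  "support C F = {c \<in> carrier C. sec F c \<noteq> {}}"

text \<open>For sheaves on a subcanonical site this is equivalent to being subterminal; see \<open>thin_subterminal\<close>
  and \<open>subterminal_thin\<close>.\<close>

definition thin :: "'a site \<Rightarrow> ('a, 's) presheaf \<Rightarrow> bool" where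
  "thin C F \<longleftrightarrow> (\<forall>c\<in>carrier C. \<forall>s\<in>sec F c. \<forall>t\<in>sec F c. s = t)"

lemma thin_indicator: "thin C (indicator_sheaf I)"
  by (simp add: thin_def indicator_sheaf_def)

lemma support_indicator: "is_ideal C I \<Longrightarrow> support C (indicator_sheaf I) = I"
  using ideal_subset[of C I] by (auto simp: support_def indicator_sheaf_def)

lemma Sh_simps [simp]: "obj (Sh C) = {F. is_sheaf C F}" "homs (Sh C) = presheaf_homs C"
  by (simp_all add: Sh_def)

lemma presheaf_res:
  "\<lbrakk>is_presheaf C F; c \<in> carrier C; d \<in> carrier C; d \<sqsubseteq>\<^bsub>C\<^esub> c; s \<in> sec F c\<rbrakk> \<Longrightarrow> res F c d s \<in> sec F d"
  by (simp add: is_presheaf_def Pi_iff)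

lemma presheaf_hom_ext:
  assumes "\<alpha> \<in> presheaf_homs C F G" "\<beta> \<in> presheaf_homs C F G"
    "\<And>c s. \<lbrakk>c \<in> carrier C; s \<in> sec F c\<rbrakk> \<Longrightarrow> \<alpha> c s = \<beta> c s"
  shows "\<alpha> = \<beta>"
proof -
  have "\<alpha> \<in> (\<Pi>\<^sub>E c\<in>carrier C. sec F c \<rightarrow>\<^sub>E sec G c)" "\<beta> \<in> (\<Pi>\<^sub>E c\<in>carrier C. sec F c \<rightarrow>\<^sub>E sec G c)"
    using assms(1,2) by (auto simp: presheaf_homs_def)
  then have "\<alpha> c s = \<beta> c s" for c s
    by (cases "c \<in> carrier C"; cases "s \<in> sec F c") (auto simp: assms(3) PiE_def extensional_def Pi_iff)
  then show ?thesis by blast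
qed

lemma presheaf_hom_maps:
  assumes "\<alpha> \<in> presheaf_homs C F G" "c \<in> carrier C" "s \<in> sec F c"
  shows "\<alpha> c s \<in> sec G c"
proof -
  have "\<alpha> c \<in> sec F c \<rightarrow>\<^sub>E sec G c" using assms(1,2) by (auto simp: presheaf_homs_def)
  then show ?thesis using assms(3) by blast
qed

text \<open>Uniqueness of sections makes any choice of sections natural.\<close>

lemma thin_hom_iff:
  assumes "is_sheaf C F" "is_sheaf C G" "thin C G"
  shows "presheaf_homs C F G \<noteq> {} \<longleftrightarrow> support C F \<subseteq> support C G"
proof
  assume "presheaf_homs C F G \<noteq> {}"
  then show "support C F \<subseteq> support C G"
    using presheaf_hom_maps[of _ C F G] by (fastforce simp: support_def)
next
  assume sub: "support C F \<subseteq> support C G"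
  define \<alpha> where "\<alpha> = (\<lambda>c\<in>carrier C. \<lambda>s\<in>sec F c. SOME t. t \<in> sec G c)"
  have \<alpha>: "\<alpha> c s \<in> sec G c" if "c \<in> carrier C" "s \<in> sec F c" for c s
    using that sub some_in_eq[of "sec G c"] by (auto simp: \<alpha>_def support_def)
  have pre: "is_presheaf C F" "is_presheaf C G" using assms by (simp_all add: is_sheaf_def)
  have "\<alpha> \<in> presheaf_homs C F G"
    unfolding presheaf_homs_def
  proof (intro CollectI conjI PiE_I ballI impI)
    show "\<alpha> c s \<in> sec G c" if "c \<in> carrier C" "s \<in> sec F c" for c s using that by (rule \<alpha>)
    show "\<alpha> c s = undefined" if "c \<in> carrier C" "s \<notin> sec F c" for c s using that by (simp add: \<alpha>_def)
    show "\<alpha> c = undefined" if "c \<notin> carrier C" for c using that by (simp add: \<alpha>_def)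
    show "\<alpha> d (res F c d s) = res G c d (\<alpha> c s)"
      if "c \<in> carrier C" "d \<in> carrier C" "d \<sqsubseteq>\<^bsub>C\<^esub> c" "s \<in> sec F c" for c d s
      using assms(3)[unfolded thin_def] that \<alpha>[of d "res F c d s"] \<alpha>[of c s]
        presheaf_res[OF pre(1), of c d s] presheaf_res[OF pre(2), of c d "\<alpha> c s"] by simp
  qed
  then show "presheaf_homs C F G \<noteq> {}" by blast
qed

context poset_site
begin

lemma indicator_sheaf:
  assumes "is_ideal C I"
  shows "is_sheaf C (indicator_sheaf I)"
  unfolding is_sheaf_def
proof (intro conjI ballI allI impI)
  show "is_presheaf C (indicator_sheaf I)"
    using ideal_lower[OF assms] by (auto simp: is_presheaf_def indicator_sheaf_def)
  fix c S x assume c: "c \<in> carrier C" "S \<in> cov C c"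
    and x: "matching_family C (indicator_sheaf I) S x"
  have xd: "d \<in> I \<and> x d = undefined" if "d \<in> S" for d
    using x that by (auto simp: matching_family_def indicator_sheaf_def split: if_splits)
  then have "c \<in> I" using ideal_cov[OF assms c] by blast
  then show "\<exists>!s. s \<in> sec (indicator_sheaf I) c \<and> (\<forall>d\<in>S. res (indicator_sheaf I) c d s = x d)"
    using xd by (auto simp: indicator_sheaf_def)
qed

text \<open>Unique sections over the members of a covering sieve automatically match, so they glue.\<close>

lemma thin_support_ideal:
  assumes "is_sheaf C F" "thin C F"
  shows "is_ideal C (support C F)"
  unfolding is_ideal_def
proof (intro conjI ballI impI)
  have pre: "is_presheaf C F" using assms by (simp add: is_sheaf_def)
  show "lower_set C (support C F)"
    unfolding lower_set_def
  proof (intro conjI ballI impI)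
    fix c d assume "c \<in> support C F" "d \<in> carrier C" "d \<sqsubseteq> c"
    then show "d \<in> support C F" using presheaf_res[OF pre, of c d] by (auto simp: support_def)
  qed (auto simp: support_def)
  fix c S assume c: "c \<in> carrier C" "S \<in> cov C c" "S \<subseteq> support C F"
  define x where "x = (\<lambda>d. SOME s. s \<in> sec F d)"
  have x: "x d \<in> sec F d" if "d \<in> S" for d
    using c(3) that some_in_eq[of "sec F d"] by (auto simp: x_def support_def)
  have S: "lower_set C S" by (rule cov_lower_set[OF c(1,2)])
  have "matching_family C F S x"
    unfolding matching_family_def
  proof (intro conjI ballI impI)
    fix d e assume d: "d \<in> S" "e \<in> carrier C" "e \<sqsubseteq> d"
    then have "e \<in> S" "d \<in> carrier C" using S by (auto simp: lower_set_def)
    then show "res F d e (x d) = x e"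
      using assms(2) presheaf_res[OF pre, of d e "x d"] x d by (simp add: thin_def)
  qed (rule x)
  then have "\<exists>s. s \<in> sec F c" using assms(1) c(1,2) unfolding is_sheaf_def by blast
  then show "c \<in> support C F" using c(1) by (auto simp: support_def)
qed

lemma thin_subterminal:
  assumes "is_sheaf C F" "thin C F"
  shows "subterminal (Sh C) F"
  unfolding subterminal_def
proof (intro conjI ballI)
  fix G \<alpha> \<beta> assume "\<alpha> \<in> homs (Sh C) G F" "\<beta> \<in> homs (Sh C) G F"
  then show "\<alpha> = \<beta>"
    using assms(2) presheaf_hom_maps[of _ C G F]
    by (intro presheaf_hom_ext[of \<alpha> C G F \<beta>]) (simp_all add: thin_def)
qed (use assms in simp)

end

context subcanonical_site
begin

text \<open>The Yoneda argument: a section \<open>u\<close> over \<open>c\<close> is an arrow to \<open>F\<close> from the representable sheaf of \<open>c\<close>, which is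
  the indicator of the ideal \<open>down C c\<close>. Two different sections would give two different arrows.\<close>

lemma subterminal_thin:
  fixes F :: "('a, 's) presheaf"
  assumes "subterminal (Sh C) F"
  shows "thin C F"
  unfolding thin_def
proof (intro ballI)
  fix c s t assume c: "c \<in> carrier C" and s: "s \<in> sec F c" and t: "t \<in> sec F c"
  have sh: "is_sheaf C F" and pre: "is_presheaf C F"
    using assms by (simp_all add: subterminal_def is_sheaf_def)
  let ?Y = "indicator_sheaf (down C c) :: ('a, 's) presheaf"
  \<comment> \<open>The arrow that corresponds to the section \<open>u\<close> under Yoneda.\<close>
  define \<alpha> where "\<alpha> u = (\<lambda>d\<in>carrier C. \<lambda>x\<in>sec ?Y d. res F c d u)" for u
  have hom: "\<alpha> u \<in> presheaf_homs C ?Y F" if u: "u \<in> sec F c" for u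
    unfolding presheaf_homs_def
  proof (intro CollectI conjI PiE_I ballI impI)
    show "\<alpha> u d x \<in> sec F d" if "d \<in> carrier C" "x \<in> sec ?Y d" for d x
      using that u presheaf_res[OF pre c, of d u]
      by (auto simp: \<alpha>_def indicator_sheaf_def down_def split: if_splits)
    show "\<alpha> u d x = undefined" if "d \<in> carrier C" "x \<notin> sec ?Y d" for d x
      using that by (simp add: \<alpha>_def)
    show "\<alpha> u d = undefined" if "d \<notin> carrier C" for d
      using that by (simp add: \<alpha>_def)
    show "\<alpha> u e (res ?Y d e x) = res F d e (\<alpha> u d x)"
      if d: "d \<in> carrier C" "e \<in> carrier C" "e \<sqsubseteq> d" and x: "x \<in> sec ?Y d" for d e x
    proof -
      have dc: "d \<in> down C c" "x = undefined" using x by (auto simp: indicator_sheaf_def split: if_splits)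
      then have "e \<in> down C c" using ideal_lower[OF ideal_down_set[OF c]] d by blast
      then have "\<alpha> u e (res ?Y d e x) = res F c e u" "\<alpha> u d x = res F c d u"
        using dc d by (simp_all add: \<alpha>_def indicator_sheaf_def)
      moreover have "res F d e (res F c d u) = res F c e u"
        using pre c d dc u by (simp add: is_presheaf_def down_def)
      ultimately show ?thesis by simp
    qed
  qed
  have Y: "?Y \<in> obj (Sh C)" using indicator_sheaf[OF ideal_down_set[OF c]] by simp
  have "\<alpha> s = \<alpha> t"
    using assms Y hom[OF s] hom[OF t] unfolding subterminal_def by auto
  then have "\<alpha> s c undefined = \<alpha> t c undefined" by simp
  then have "res F c c s = res F c c t"
    using c self_in_down[OF c] by (simp add: \<alpha>_def indicator_sheaf_def)
  then show "s = t" using pre c s t by (simp add: is_presheaf_def)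
qed

end

text \<open>Ideals are, up to isomorphism, the subterminal sheaves, and inclusion of ideals is existence of an
  arrow. Equivalences preserve subterminal objects and reflect existence of arrows.\<close>

theorem equivalent_sheaves_order_iso_ideals:
  assumes "subcanonical_site C" "subcanonical_site D"
    and "equivalent_categories
           (Sh C :: (('a, 's) presheaf, 'a \<Rightarrow> 's \<Rightarrow> 's) cat) (Sh D :: (('b, 't) presheaf, 'b \<Rightarrow> 't \<Rightarrow> 't) cat)"
  shows "\<exists>\<phi>. order_iso (Id_frame C) (Id_frame D) \<phi>"
proof -
  interpret C: subcanonical_site C by fact
  interpret D: subcanonical_site D by fact
  let ?SC = "Sh C :: (('a, 's) presheaf, 'a \<Rightarrow> 's \<Rightarrow> 's) cat"
  let ?SD = "Sh D :: (('b, 't) presheaf, 'b \<Rightarrow> 't \<Rightarrow> 't) cat"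
  obtain F G where FG: "categorical_inverses ?SC ?SD F G"
    using assms(3) by (auto simp: equivalent_categories_def)
  note GF = categorical_inverses_sym[OF FG]
  interpret F: cat_functor ?SC ?SD F using FG by (simp add: categorical_inverses_def)
  interpret G: cat_functor ?SD ?SC G using FG by (simp add: categorical_inverses_def)
  let ?\<chi> = "indicator_sheaf :: 'a set \<Rightarrow> ('a, 's) presheaf"
  let ?\<xi> = "indicator_sheaf :: 'b set \<Rightarrow> ('b, 't) presheaf"
  \<comment> \<open>An ideal is sent to the support of the image of its indicator sheaf.\<close>
  define \<Phi> where "\<Phi> I = support D (on_obj F (?\<chi> I))" for I
  have \<chi>: "?\<chi> I \<in> obj ?SC" "subterminal ?SC (?\<chi> I)" if "is_ideal C I" for I
    using C.indicator_sheaf[OF that] C.thin_subterminal[OF _ thin_indicator] by auto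
  have F\<chi>: "on_obj F (?\<chi> I) \<in> obj ?SD" "thin D (on_obj F (?\<chi> I))" if "is_ideal C I" for I
    using F.on_obj_in[OF \<chi>(1)[OF that]]
      D.subterminal_thin[OF equivalence_subterminal[OF FG \<chi>(2)[OF that]]] by auto
  have le: "\<Phi> I \<subseteq> \<Phi> J \<longleftrightarrow> I \<subseteq> J" if I: "is_ideal C I" and J: "is_ideal C J" for I J
  proof -
    have "\<Phi> I \<subseteq> \<Phi> J \<longleftrightarrow> homs ?SD (on_obj F (?\<chi> I)) (on_obj F (?\<chi> J)) \<noteq> {}"
      using thin_hom_iff[of D "on_obj F (?\<chi> I)" "on_obj F (?\<chi> J)"] F\<chi>[OF I] F\<chi>[OF J] by (simp add: \<Phi>_def)
    also have "\<dots> \<longleftrightarrow> homs ?SC (?\<chi> I) (?\<chi> J) \<noteq> {}"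
      by (rule equivalence_hom_iff[OF FG \<chi>(1)[OF I] \<chi>(1)[OF J]])
    also have "\<dots> \<longleftrightarrow> I \<subseteq> J"
      using thin_hom_iff[of C "?\<chi> I" "?\<chi> J"] \<chi>[OF I] \<chi>[OF J] thin_indicator[of C J]
      by (simp add: support_indicator I J)
    finally show ?thesis .
  qed
  have ideal: "is_ideal D (\<Phi> I)" if "is_ideal C I" for I
    using D.thin_support_ideal F\<chi>[OF that] by (simp add: \<Phi>_def)
  have surj: "\<exists>I. is_ideal C I \<and> \<Phi> I = J" if J: "is_ideal D J" for J
  proof -
    have \<xi>: "?\<xi> J \<in> obj ?SD" "subterminal ?SD (?\<xi> J)"
      using D.indicator_sheaf[OF J] D.thin_subterminal[OF _ thin_indicator] by auto
    let ?X = "on_obj G (?\<xi> J)"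
    have X: "?X \<in> obj ?SC" "thin C ?X"
      using G.on_obj_in[OF \<xi>(1)] C.subterminal_thin[OF equivalence_subterminal[OF GF \<xi>(2)]] by auto
    \<comment> \<open>The ideal sent to \<open>J\<close> is the support of the sheaf \<open>G\<close> assigns to the indicator of \<open>J\<close>.\<close>
    let ?I = "support C ?X"
    have I: "is_ideal C ?I" using C.thin_support_ideal X by simp
    have "homs ?SC (?\<chi> ?I) ?X \<noteq> {}" "homs ?SC ?X (?\<chi> ?I) \<noteq> {}"
      using thin_hom_iff[of C "?\<chi> ?I" ?X] thin_hom_iff[of C ?X "?\<chi> ?I"] X \<chi>(1)[OF I] thin_indicator[of C ?I]
      by (simp_all add: support_indicator I)
    then have "homs ?SD (on_obj F (?\<chi> ?I)) (on_obj F ?X) \<noteq> {}" "homs ?SD (on_obj F ?X) (on_obj F (?\<chi> ?I)) \<noteq> {}"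
      using equivalence_hom_iff[OF FG] X(1) \<chi>(1)[OF I] by blast+
    moreover have "homs ?SD (on_obj F ?X) (?\<xi> J) \<noteq> {}" "homs ?SD (?\<xi> J) (on_obj F ?X) \<noteq> {}"
      using counit_homs[OF GF \<xi>(1)] by auto
    ultimately have "homs ?SD (on_obj F (?\<chi> ?I)) (?\<xi> J) \<noteq> {}" "homs ?SD (?\<xi> J) (on_obj F (?\<chi> ?I)) \<noteq> {}"
      using category_hom_trans[OF F.target.category_axioms _ F.on_obj_in[OF X(1)]] \<xi>(1) F\<chi>(1)[OF I] by blast+
    then have "\<Phi> ?I = J"
      using thin_hom_iff[of D "on_obj F (?\<chi> ?I)" "?\<xi> J"] thin_hom_iff[of D "?\<xi> J" "on_obj F (?\<chi> ?I)"]
        \<xi>(1) F\<chi>[OF I] thin_indicator[of D J]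
      by (simp add: \<Phi>_def support_indicator J)
    then show ?thesis using I by blast
  qed
  have "order_iso (Id_frame C) (Id_frame D) \<Phi>"
  proof (rule order_isoI)
    show "weak_partial_order (Id_frame C)" "weak_partial_order (Id_frame D)"
      by (rule partial_order.axioms(1)[OF partial_order_Id_frame])+
    show "\<Phi> ` carrier (Id_frame C) = carrier (Id_frame D)"
      using ideal surj by (fastforce simp: image_iff)
    show "inj_on \<Phi> (carrier (Id_frame C))"
      using le by (intro inj_onI) (metis Id_frame_simps(1) mem_Collect_eq subset_antisym subset_refl)
  qed (simp add: le)
  then show ?thesis by blast
qed

section \<open>The extended categories\<close>

lemma comp_site_cov_lower:
  assumes "poset_site C" "b \<in> carrier (comp_site Q C)" "S \<in> cov (comp_site Q C) b"
  shows "S \<subseteq> carrier (comp_site Q C)" "lower_set (comp_site Q C) S"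
proof -
  have B: "compact_elements Q (Id_frame C) \<subseteq> carrier (Id_frame C)"
    by (auto simp: compact_elements_def)
  show "S \<subseteq> carrier (comp_site Q C)" "lower_set (comp_site Q C) S"
    using assms(2,3) cov_induced_site[OF poset_site.frame_Id_frame[OF assms(1)] B, of b S]
    by (auto simp: comp_site_def lower_set_def)
qed

lemma carrier_comp_site [simp]: "carrier (comp_site Q C) = compact_elements Q (Id_frame C)"
  by (simp add: comp_site_def)

lemma compact_ideal: "b \<in> compact_elements Q (Id_frame C) \<Longrightarrow> is_ideal C b"
  by (simp add: compact_elements_def)

lemma le_comp_site [simp]: "le (comp_site Q C) = (\<subseteq>)"
  by (simp add: comp_site_def)

text \<open>An isomorphism of sites induces an isomorphism of the frames of ideals, and invariance of \<open>Q\<close> makes it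
  match the compact elements, so the two further conditions on arrows are automatic.\<close>

lemma site_iso_ext_hom:
  assumes "poset_site C" "poset_site D" "site_iso C D \<phi>" "invariant_family_property Q"
  shows "restrict \<phi> (carrier C) \<in> ext_homs Q C D"
proof -
  interpret C: poset_site C by fact
  interpret D: poset_site D by fact
  let ?h = "restrict \<phi> (carrier C)"
  have iso: "site_iso C D ?h"
    using site_iso_cong[OF assms(3) _ C.cov_subset, of ?h] by simp
  have oi: "order_iso (Id_frame C) (Id_frame D) ((`) ?h)"
    by (rule Id_frame_site_iso[OF iso C.cov_subset])
  have A: "A_map C D ?h I = ?h ` I" if "is_ideal C I" for I
    by (rule A_map_site_iso[OF iso that C.cov_subset])
  have K: "(`) ?h ` compact_elements Q (Id_frame C) = compact_elements Q (Id_frame D)"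
    by (rule compact_elements_image[OF C.frame_Id_frame D.frame_Id_frame oi assms(4)])
  have "site_iso (comp_site Q C) (comp_site Q D) ((`) ?h)"
    using induced_site_iso[OF C.frame_Id_frame D.frame_Id_frame oi, of "compact_elements Q (Id_frame C)"]
    unfolding K comp_site_def by (auto simp: compact_elements_def)
  then have "site_morphism (comp_site Q C) (comp_site Q D) ((`) ?h)"
    using comp_site_cov_lower(2)[OF assms(1)] by (rule site_iso_morphism)
  then have "site_morphism (comp_site Q C) (comp_site Q D) (A_map C D ?h)"
    by (rule site_morphism_cong) (auto simp: A compact_ideal dest: comp_site_cov_lower(1)[OF assms(1), simplified])
  moreover have "A_map C D ?h ` compact_elements Q (Id_frame C) = compact_elements Q (Id_frame D)"
    using K A compact_ideal by (metis (no_types, lifting) image_cong)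
  moreover have "site_morphism C D ?h" using iso C.cov_lower_set by (rule site_iso_morphism)
  moreover have "?h \<in> carrier C \<rightarrow>\<^sub>E carrier D"
    using order_iso_in[OF site_iso_order_iso[OF assms(3)]] by auto
  ultimately show ?thesis by (simp add: ext_homs_def)
qed

lemma ext_homs_comp:
  assumes "poset_site C" "poset_site D" "poset_site E" "h \<in> ext_homs Q C D" "k \<in> ext_homs Q D E"
  shows "compose (carrier C) k h \<in> ext_homs Q C E"
proof -
  interpret C: poset_site C by fact
  let ?l = "compose (carrier C) k h"
  let ?B = "\<lambda>C. compact_elements Q (Id_frame C)"
  have h: "h \<in> carrier C \<rightarrow>\<^sub>E carrier D" "site_morphism C D h" "A_map C D h ` ?B C \<subseteq> ?B D"
    "site_morphism (comp_site Q C) (comp_site Q D) (A_map C D h)"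
    using assms(4) by (simp_all add: ext_homs_def)
  have k: "k \<in> carrier D \<rightarrow>\<^sub>E carrier E" "site_morphism D E k" "A_map D E k ` ?B D \<subseteq> ?B E"
    "site_morphism (comp_site Q D) (comp_site Q E) (A_map D E k)"
    using assms(5) by (simp_all add: ext_homs_def)
  have A: "A_map C E ?l I = (A_map D E k \<circ> A_map C D h) I" if "is_ideal C I" for I
    using A_map_comp[OF assms(2,3) site_morphism_maps[OF h(2)] k(2) that, where l = ?l]
    by (simp add: compose_def)
  have "site_morphism C E ?l"
    using site_morphism_cong[OF site_morphism_comp[OF h(2) k(2) C.cov_subset] _ C.cov_subset, where k = ?l]
    by (simp add: compose_def)
  moreover have "?l \<in> carrier C \<rightarrow>\<^sub>E carrier E" using h(1) k(1) by (auto simp: compose_def)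
  moreover have "A_map C E ?l ` ?B C \<subseteq> ?B E" using A h(3) k(3) compact_ideal by fastforce
  moreover have "site_morphism (comp_site Q C) (comp_site Q E) (A_map C E ?l)"
    using site_morphism_comp[OF h(4) k(4) comp_site_cov_lower(1)[OF assms(1)]]
    by (rule site_morphism_cong) (auto simp: A compact_ideal dest: comp_site_cov_lower(1)[OF assms(1), simplified])
  ultimately show ?thesis by (simp add: ext_homs_def)
qed

lemma Ext_simps [simp]:
  "obj (Ext \<K> Q) = {C. partial_order C \<and> (\<exists>C\<^sub>0\<in>\<K>. isomorphic_sites C\<^sub>0 C)}"
  "homs (Ext \<K> Q) = ext_homs Q"
  "ide (Ext \<K> Q) C = (\<lambda>c\<in>carrier C. c)"
  "comp (Ext \<K> Q) C D E k h = compose (carrier C) k h"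
  by (simp_all add: Ext_def)

lemma category_Ext:
  assumes "\<And>C. C \<in> obj (Ext \<K> Q) \<Longrightarrow> poset_site C" "invariant_family_property Q"
  shows "category (Ext \<K> Q)"
proof
  fix C assume "C \<in> obj (Ext \<K> Q)"
  then have C: "poset_site C" by (rule assms(1))
  have "weak_partial_order C" using C by (simp add: poset_site_def partial_order_def)
  then show "ide (Ext \<K> Q) C \<in> homs (Ext \<K> Q) C C"
    using site_iso_ext_hom[OF C C site_iso_refl assms(2)] by simp
next
  fix C D E h k
  assume "C \<in> obj (Ext \<K> Q)" "D \<in> obj (Ext \<K> Q)" "E \<in> obj (Ext \<K> Q)"
    and hk: "h \<in> homs (Ext \<K> Q) C D" "k \<in> homs (Ext \<K> Q) D E"
  then have "poset_site C" "poset_site D" "poset_site E" using assms(1) by blast+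
  then show "comp (Ext \<K> Q) C D E k h \<in> homs (Ext \<K> Q) C E"
    using ext_homs_comp hk by simp
next
  fix C D h assume h: "h \<in> homs (Ext \<K> Q) C D"
  then have "h \<in> carrier C \<rightarrow>\<^sub>E carrier D" by (simp add: ext_homs_def)
  then show "comp (Ext \<K> Q) C C D h (ide (Ext \<K> Q) C) = h" "comp (Ext \<K> Q) C D D (ide (Ext \<K> Q) D) h = h"
    by (auto simp: fun_eq_iff compose_def PiE_iff extensional_def)
next
  fix B C D E h k l
  assume "h \<in> homs (Ext \<K> Q) B C" "k \<in> homs (Ext \<K> Q) C D" "l \<in> homs (Ext \<K> Q) D E"
  then have "h \<in> carrier B \<rightarrow>\<^sub>E carrier C" by (simp add: ext_homs_def)
  then show "comp (Ext \<K> Q) B C E (comp (Ext \<K> Q) C D E l k) h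
      = comp (Ext \<K> Q) B D E l (comp (Ext \<K> Q) B C D k h)"
    by (auto simp: fun_eq_iff compose_def PiE_iff)
qed

section \<open>Dual sites\<close>

text \<open>Up to isomorphism, one frame has \<open>C\<close> as its poset of \<open>U\<close>-compact elements and \<open>D\<close> as its poset of
  \<open>V\<close>-compact elements.\<close>

definition dual_sites :: "'u set family_property \<Rightarrow> 'u set family_property \<Rightarrow> 'u site \<Rightarrow> 'u site \<Rightarrow> bool" where
  "dual_sites U V C D \<longleftrightarrow> subcanonical_site C \<and> subcanonical_site D \<and>
    compact_elements U (Id_frame C) = principal_ideals C \<and>
    compact_elements V (Id_frame D) = principal_ideals D \<and>
    (\<exists>\<chi>. order_iso (Id_frame C) (Id_frame D) \<chi>)"

lemma dual_sites_sym: "dual_sites U V C D \<Longrightarrow> dual_sites V U D C"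
  unfolding dual_sites_def using order_iso_inv by blast

text \<open>A family of ideals with join \<open>down C c\<close> is, after replacing each ideal by the principal ideals below
  it, a covering sieve on \<open>c\<close>, and so has a refinement because the topology is induced. Conversely let
  \<open>I\<close> be compact. The family of all principal ideals below \<open>I\<close> has a refinement satisfying \<open>Q\<close>, by the
  second hypothesis even one made of principal ideals. As the topology is induced, \<open>I\<close> is then a
  covering sieve on some \<open>c\<close>; an ideal contains what it covers, so \<open>c\<close> is the greatest element of \<open>I\<close>.\<close>

lemma compact_elements_principal:
  assumes "subcanonical_site C"
    and "\<And>F. F \<subseteq> principal_ideals C \<Longrightarrow>
      has_refinement (Id_frame C) Q F \<longleftrightarrow> has_refinement_in (Id_frame C) (principal_ideals C) Q F"
    and "induced_relative_to P Q C" "P (Id_frame C) (down C ` carrier C)"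
  shows "compact_elements Q (Id_frame C) = principal_ideals C"
proof -
  interpret subcanonical_site C by fact
  let ?L = "Id_frame C"
  interpret L: frame ?L by (rule frame_Id_frame)
  have down_in: "down C \<in> carrier C \<rightarrow> carrier ?L" using ideal_down_set by auto
  have "\<Squnion>\<^bsub>?L\<^esub>(down C ` S) = down C c" if c: "c \<in> carrier C" "S \<in> cov C c" for c S
    using ideal_sup_down[OF cov_subset[OF c] cov_lower_set[OF c]] cov_iff_hull[OF c(1) cov_sieve[OF c]] c(2)
    by simp
  then have ind: "(\<exists>c\<in>carrier C. (\<forall>a\<in>A. a \<sqsubseteq>\<^bsub>C\<^esub> c) \<and> generated C A \<in> cov C c) \<longleftrightarrow>
      has_refinement_in ?L (down C ` carrier C) Q (down C ` A)" if "A \<subseteq> carrier C" for A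
    using assms(3)[unfolded induced_relative_to_def, rule_format, of ?L "down C" A]
      frame_Id_frame down_in down_order_emb down_basis assms(4) that by blast
  show ?thesis
  proof (intro subset_antisym subsetI)
    fix I assume I: "I \<in> compact_elements Q ?L"
    then have ideal: "is_ideal C I" by (rule compact_ideal)
    have Ic: "I \<subseteq> carrier C" by (rule ideal_subset[OF ideal])
    have "down C ` I \<subseteq> carrier ?L" using Ic down_in by blast
    then have "has_refinement ?L Q (down C ` I)"
      using I ideal_eq_sup_down[OF ideal] unfolding compact_elements_def by blast
    then have "has_refinement_in ?L (down C ` carrier C) Q (down C ` I)"
      using assms(2)[of "down C ` I"] Ic by (simp add: principal_ideals_eq image_mono)
    then obtain c where c: "c \<in> carrier C" "\<forall>a\<in>I. a \<sqsubseteq>\<^bsub>C\<^esub> c" "generated C I \<in> cov C c"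
      using ind[OF Ic] by blast
    have "generated C I = I"
      using ideal generated_lower_set[OF weak_partial_order_axioms] by (simp add: is_ideal_def)
    then have "c \<in> I" using ideal_cov[OF ideal c(1), of I] c(3) by simp
    then have "I = down C c" using ideal_down[OF ideal] c(2) Ic by (auto simp: down_def)
    then show "I \<in> principal_ideals C" using c(1) by (simp add: principal_ideals_eq)
  next
    fix I assume "I \<in> principal_ideals C"
    then obtain c where c: "c \<in> carrier C" "I = down C c" by (auto simp: principal_ideals_eq)
    have "has_refinement ?L Q \<A>" if \<A>: "\<A> \<subseteq> carrier ?L" "\<Squnion>\<^bsub>?L\<^esub>\<A> = I" for \<A>
    proof -
      let ?S = "\<Union>\<A>"
      have \<A>': "\<A> \<subseteq> {I. is_ideal C I}" using \<A>(1) by simp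
      note S = Union_ideals[OF \<A>']
      have hull: "ideal_hull C ?S = down C c" using Id_frame_sup[OF \<A>'] \<A>(2) c(2) by simp
      then have sv: "sieve C c ?S" using S ideal_hull_superset[of ?S C] by (simp add: sieve_def)
      then have "generated C ?S \<in> cov C c"
        using cov_iff_hull[OF c(1)] hull generated_lower_set[OF weak_partial_order_axioms S(2)] by simp
      moreover have "\<forall>a\<in>?S. a \<sqsubseteq>\<^bsub>C\<^esub> c" using sv by (auto simp: sieve_def down_def)
      ultimately have "has_refinement_in ?L (down C ` carrier C) Q (down C ` ?S)"
        using ind[OF S(1)] c(1) by blast
      then obtain \<B> where \<B>: "\<B> \<subseteq> down C ` carrier C" "refines ?L \<B> (down C ` ?S)" "Q ?L \<B>"
        by (auto simp: has_refinement_in_def)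
      have "refines ?L \<B> \<A>"
        unfolding refines_def
      proof
        show "\<forall>b\<in>\<B>. \<exists>a\<in>\<A>. b \<sqsubseteq>\<^bsub>?L\<^esub> a"
        proof
          fix b assume "b \<in> \<B>"
          then have "\<exists>x\<in>down C ` ?S. b \<sqsubseteq>\<^bsub>?L\<^esub> x" using \<B>(2) unfolding refines_def by blast
          then obtain s where s: "s \<in> ?S" "b \<subseteq> down C s" by auto
          then obtain a where "a \<in> \<A>" "s \<in> a" by blast
          moreover then have "down C s \<subseteq> a" using \<A>' by (intro ideal_down) auto
          ultimately show "\<exists>a\<in>\<A>. b \<sqsubseteq>\<^bsub>?L\<^esub> a" using s(2) by auto
        qed
        show "\<Squnion>\<^bsub>?L\<^esub>\<B> = \<Squnion>\<^bsub>?L\<^esub>\<A>"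
          using \<B>(2) ideal_sup_down[OF S] hull \<A>(2) c(2) by (simp add: refines_def)
      qed
      moreover have "\<B> \<subseteq> carrier ?L" using \<B>(1) down_in by blast
      ultimately show ?thesis using \<B>(3) by (auto simp: has_refinement_in_def)
    qed
    then show "I \<in> compact_elements Q ?L"
      using ideal_down_set[OF c(1)] c(2) by (auto simp: compact_elements_def)
  qed
qed

lemma dual_sites_iso:
  assumes "dual_sites U V C D" "invariant_family_property U" "partial_order C'" "site_iso C C' \<phi>"
  shows "dual_sites U V C' D"
proof -
  interpret C: subcanonical_site C using assms(1) by (simp add: dual_sites_def)
  interpret C': subcanonical_site C' by (rule subcanonical_site_iso[OF C.subcanonical_site_axioms assms(3,4)])
  have iso: "order_iso C C' \<phi>" by (rule site_iso_order_iso[OF assms(4)])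
  have Id: "order_iso (Id_frame C) (Id_frame C') ((`) \<phi>)"
    by (rule Id_frame_site_iso[OF assms(4) C.cov_subset])
  have "compact_elements U (Id_frame C') = (`) \<phi> ` compact_elements U (Id_frame C)"
    using compact_elements_image[OF C.frame_Id_frame C'.frame_Id_frame Id assms(2)] by simp
  also have "\<dots> = (`) \<phi> ` down C ` carrier C"
    using assms(1) by (simp add: dual_sites_def C.principal_ideals_eq)
  also have "\<dots> = down C' ` \<phi> ` carrier C"
    unfolding image_image by (intro image_cong refl) (simp add: order_iso_down[OF iso])
  also have "\<dots> = principal_ideals C'"
    by (simp add: C'.principal_ideals_eq order_iso_carrier[OF iso])
  finally have K: "compact_elements U (Id_frame C') = principal_ideals C'" .
  obtain \<chi> where \<chi>: "order_iso (Id_frame C) (Id_frame D) \<chi>"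
    using assms(1) by (auto simp: dual_sites_def)
  have "order_iso (Id_frame C') (Id_frame D) (\<chi> \<circ> inv_into (carrier (Id_frame C)) ((`) \<phi>))"
    by (rule order_iso_comp[OF order_iso_inv[OF Id] \<chi>])
  then show ?thesis
    using assms(1) K C'.subcanonical_site_axioms unfolding dual_sites_def by blast
qed

text \<open>When the compact elements of \<open>Id_frame D\<close> are its principal ideals, those of any isomorphic frame of
  ideals are a copy of \<open>D\<close>. For \<open>D\<close> dual to \<open>C\<close> this exhibits the site of \<open>V\<close>-compact elements of \<open>Id_frame C\<close> as a copy of \<open>D\<close>, and
  it is used a second time to find \<open>C\<close> in the frame of ideals of its own dual.\<close>

lemma down_image_ideals_iso:
  assumes "subcanonical_site D" "order_iso (Id_frame D) (Id_frame C) \<chi>" "poset_site C"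
    "compact_elements V (Id_frame D) = principal_ideals D" "invariant_family_property V"
  shows "site_iso D (comp_site V C) (\<chi> \<circ> down D)"
    and "compact_elements V (Id_frame C) = \<chi> ` down D ` carrier D"
proof -
  interpret D: subcanonical_site D by fact
  interpret C: poset_site C by fact
  show K: "compact_elements V (Id_frame C) = \<chi> ` down D ` carrier D"
    using compact_elements_image[OF D.frame_Id_frame C.frame_Id_frame assms(2,5)] assms(4)
    by (simp add: D.principal_ideals_eq)
  have "site_iso (induced_site (Id_frame D) (down D ` carrier D))
      (induced_site (Id_frame C) (\<chi> ` down D ` carrier D)) \<chi>"
    using D.ideal_down_set by (intro induced_site_iso[OF D.frame_Id_frame C.frame_Id_frame assms(2)]) auto
  then have "site_iso (induced_site (Id_frame D) (down D ` carrier D)) (comp_site V C) \<chi>"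
    by (simp add: comp_site_def K)
  then show "site_iso D (comp_site V C) (\<chi> \<circ> down D)"
    by (rule site_iso_comp[OF D.down_site_iso])
qed

abbreviation (input) compacts :: "'u set family_property \<Rightarrow> 'u site \<Rightarrow> 'u site" where
  "compacts V C \<equiv> copy (comp_site V C)"

text \<open>The chosen isomorphism names the compact elements of \<open>Id_frame C\<close>, which have type \<open>'u set\<close>, by
  elements of \<open>'u\<close>.\<close>

abbreviation (input) name_of :: "'u set family_property \<Rightarrow> 'u site \<Rightarrow> 'u set \<Rightarrow> 'u" where
  "name_of V C \<equiv> copy_map (comp_site V C)"

text \<open>The isomorphism from \<open>Id_frame C\<close> to \<open>Id_frame (compacts V C)\<close>, see \<open>to_dual_iso\<close>: an ideal is
  represented by the names of the compact elements below it.\<close>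

definition to_dual :: "'u set family_property \<Rightarrow> 'u site \<Rightarrow> 'u set \<Rightarrow> 'u set" where
  "to_dual V C I = name_of V C ` {b \<in> compact_elements V (Id_frame C). b \<subseteq> I}"

text \<open>The site \<open>D\<close> serves as a witness: it provides an element type small enough for a copy of
  the poset of compact elements, and it shows that these form a basis. The functor itself is built from
  \<open>compacts V C\<close>, which is isomorphic to \<open>D\<close>.\<close>

locale dual_pair =
  fixes U V :: "'u set family_property" and C D :: "'u site"
  assumes dual: "dual_sites U V C D"
    and U_inv: "invariant_family_property U" and V_inv: "invariant_family_property V"
begin

sublocale C: subcanonical_site C using dual by (simp add: dual_sites_def)
sublocale D: subcanonical_site D using dual by (simp add: dual_sites_def)

lemma iso_ex: "\<exists>\<chi>. order_iso (Id_frame D) (Id_frame C) \<chi>"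
  using dual order_iso_inv unfolding dual_sites_def by blast

lemma comp_site_iso_ex: "\<exists>\<sigma>. site_iso D (comp_site V C) \<sigma>"
  using iso_ex down_image_ideals_iso(1)[OF D.subcanonical_site_axioms _ C.poset_site_axioms _ V_inv] dual
  unfolding dual_sites_def by blast

lemma copy: "partial_order (compacts V C)" "site_iso (comp_site V C) (compacts V C) (name_of V C)"
proof -
  obtain \<sigma> where \<sigma>: "site_iso D (comp_site V C) \<sigma>" using comp_site_iso_ex ..
  have "site_iso (comp_site V C) D (inv_into (carrier D) \<sigma>)"
    by (rule site_iso_inv[OF \<sigma> D.cov_subset])
  then have "isomorphic_sites (comp_site V C) D" unfolding isomorphic_sites_def by blast
  then have "\<exists>T :: 'u site. partial_order T \<and> isomorphic_sites (comp_site V C) T"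
    by (intro exI[of _ D] conjI D.partial_order_axioms)
  then have *: "partial_order (compacts V C) \<and> isomorphic_sites (comp_site V C) (compacts V C)"
    unfolding copy_def by (rule someI_ex)
  then show "partial_order (compacts V C)" ..
  show "site_iso (comp_site V C) (compacts V C) (name_of V C)"
    using * someI_ex[of "site_iso (comp_site V C) (compacts V C)"]
    by (simp add: isomorphic_sites_def copy_map_def)
qed

lemma site_iso_compacts: "\<exists>\<tau>. site_iso D (compacts V C) \<tau>"
  using comp_site_iso_ex copy(2) site_iso_comp by blast

lemma dual_compacts: "dual_sites U V C (compacts V C)"
proof -
  obtain \<tau> where "site_iso D (compacts V C) \<tau>" using site_iso_compacts ..
  then show ?thesis
    using dual_sites_iso[OF dual_sites_sym[OF dual] V_inv copy(1)] dual_sites_sym by blast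
qed

text \<open>Up to the isomorphism of \<open>D\<close> with \<open>compacts V C\<close>, this is the given isomorphism of \<open>Id_frame C\<close> with
  \<open>Id_frame D\<close>: an ideal \<open>J\<close> of \<open>D\<close> consists of those \<open>d\<close> whose principal ideal is below \<open>J\<close>.\<close>

lemma to_dual_iso: "order_iso (Id_frame C) (Id_frame (compacts V C)) (to_dual V C)"
proof -
  obtain \<chi> where \<chi>: "order_iso (Id_frame D) (Id_frame C) \<chi>" using iso_ex ..
  let ?\<chi>' = "inv_into (carrier (Id_frame D)) \<chi>"
  note inv = order_iso_inv[OF \<chi>]
  have DK: "compact_elements V (Id_frame D) = principal_ideals D" using dual by (simp add: dual_sites_def)
  note \<sigma> = down_image_ideals_iso[OF D.subcanonical_site_axioms \<chi> C.poset_site_axioms DK V_inv]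
  let ?\<tau> = "name_of V C \<circ> (\<chi> \<circ> down D)"
  have \<tau>: "site_iso D (compacts V C) ?\<tau>" by (rule site_iso_comp[OF \<sigma>(1) copy(2)])
  have "order_iso (Id_frame C) (Id_frame (compacts V C)) ((`) ?\<tau> \<circ> ?\<chi>')"
    by (rule order_iso_comp[OF inv Id_frame_site_iso[OF \<tau> D.cov_subset]])
  moreover have "to_dual V C I = ((`) ?\<tau> \<circ> ?\<chi>') I" if I: "I \<in> carrier (Id_frame C)" for I
  proof -
    have J: "is_ideal D (?\<chi>' I)" "\<chi> (?\<chi>' I) = I"
      using order_iso_in[OF inv I] I order_iso_carrier[OF \<chi>] by (simp_all add: f_inv_into_f)
    have iff: "\<chi> (down D d) \<subseteq> I \<longleftrightarrow> d \<in> ?\<chi>' I" if d: "d \<in> carrier D" for d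
      using order_iso_le[OF \<chi>, of "down D d" "?\<chi>' I"] J D.ideal_down_set[OF d]
        ideal_down[OF J(1), of d] D.self_in_down[OF d] by auto
    have "{b \<in> compact_elements V (Id_frame C). b \<subseteq> I} = \<chi> ` down D ` ?\<chi>' I"
    proof (intro subset_antisym subsetI)
      fix b assume "b \<in> {b \<in> compact_elements V (Id_frame C). b \<subseteq> I}"
      then obtain d where "d \<in> carrier D" "b = \<chi> (down D d)" "b \<subseteq> I" unfolding \<sigma>(2) by blast
      then show "b \<in> \<chi> ` down D ` ?\<chi>' I" using iff by blast
    next
      fix b assume "b \<in> \<chi> ` down D ` ?\<chi>' I"
      then obtain d where d: "d \<in> ?\<chi>' I" "b = \<chi> (down D d)" by blast
      then have "d \<in> carrier D" using ideal_subset[OF J(1)] by blast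
      then show "b \<in> {b \<in> compact_elements V (Id_frame C). b \<subseteq> I}"
        unfolding \<sigma>(2) using iff d by simp
    qed
    then show ?thesis by (simp add: to_dual_def image_comp)
  qed
  ultimately show ?thesis by (rule order_iso_cong)
qed

sublocale T: subcanonical_site "compacts V C" using dual_compacts by (simp add: dual_sites_def)

lemma name_of_inv: "x \<in> compact_elements V (Id_frame C) \<Longrightarrow>
    inv_into (carrier (comp_site V C)) (name_of V C) (name_of V C x) = x"
  using order_iso_inj[OF site_iso_order_iso[OF copy(2)]] by simp

lemma name_of_in: "b \<in> compact_elements V (Id_frame C) \<Longrightarrow> name_of V C b \<in> carrier (compacts V C)"
  using order_iso_in[OF site_iso_order_iso[OF copy(2)]] by simp

lemma name_of_surj:
  assumes "x \<in> carrier (compacts V C)"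
  obtains b where "b \<in> compact_elements V (Id_frame C)" "x = name_of V C b"
  using assms order_iso_carrier[OF site_iso_order_iso[OF copy(2)]] by auto

text \<open>The \<open>V\<close>-compact elements form a basis of \<open>Id_frame C\<close>, since they correspond to the principal ideals
  of \<open>D\<close>.\<close>

lemma sup_compact_below:
  assumes "is_ideal C I"
  shows "ideal_hull C (\<Union>{b \<in> compact_elements V (Id_frame C). b \<subseteq> I}) = I"
proof -
  obtain \<chi> where \<chi>: "order_iso (Id_frame D) (Id_frame C) \<chi>" using iso_ex ..
  have DK: "compact_elements V (Id_frame D) = principal_ideals D" using dual by (simp add: dual_sites_def)
  note K = down_image_ideals_iso(2)[OF D.subcanonical_site_axioms \<chi> C.poset_site_axioms DK V_inv]
  have "is_basis (Id_frame C) (compact_elements V (Id_frame C))"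
    unfolding K by (rule basis_image[OF D.frame_Id_frame C.frame_Id_frame \<chi> D.down_basis])
  then obtain S where S: "S \<subseteq> compact_elements V (Id_frame C)" "\<Squnion>\<^bsub>Id_frame C\<^esub>S = I"
    using assms by (auto simp: is_basis_def)
  then have "S \<subseteq> {I. is_ideal C I}" using compact_ideal by blast
  then have SI: "ideal_hull C (\<Union>S) = I" using S(2) C.Id_frame_sup by simp
  then have "\<Union>S \<subseteq> I" using ideal_hull_superset[of "\<Union>S" C] by simp
  then have sub: "\<Union>S \<subseteq> \<Union>{b \<in> compact_elements V (Id_frame C). b \<subseteq> I}" using S(1) by blast
  have hull: "is_ideal C (ideal_hull C (\<Union>{b \<in> compact_elements V (Id_frame C). b \<subseteq> I}))"
    using ideal_subset[OF assms] by (intro C.is_ideal_hull) auto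
  have "I \<subseteq> ideal_hull C (\<Union>{b \<in> compact_elements V (Id_frame C). b \<subseteq> I})"
    using ideal_hull_least[OF hull, of "\<Union>S"] sub SI
      ideal_hull_superset[of "\<Union>{b \<in> compact_elements V (Id_frame C). b \<subseteq> I}" C] by simp
  moreover have "ideal_hull C (\<Union>{b \<in> compact_elements V (Id_frame C). b \<subseteq> I}) \<subseteq> I"
    by (rule ideal_hull_least[OF assms]) auto
  ultimately show ?thesis by simp
qed

text \<open>The double dual of \<open>C\<close> is \<open>C\<close> again, before choosing names: \<open>to_dual V C\<close> carries the \<open>U\<close>-compact
  elements of \<open>Id_frame C\<close>, which are the principal ideals, to those of \<open>Id_frame (compacts V C)\<close>.\<close>

lemma principal_site_iso:
  "site_iso C (comp_site U (compacts V C)) (\<lambda>c. to_dual V C (down C c))"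
  "compact_elements U (Id_frame (compacts V C)) = (\<lambda>c. to_dual V C (down C c)) ` carrier C"
proof -
  have "compact_elements U (Id_frame C) = principal_ideals C" using dual by (simp add: dual_sites_def)
  note * = down_image_ideals_iso[OF C.subcanonical_site_axioms to_dual_iso T.poset_site_axioms this U_inv]
  show "site_iso C (comp_site U (compacts V C)) (\<lambda>c. to_dual V C (down C c))"
    using *(1) by (simp add: o_def)
  show "compact_elements U (Id_frame (compacts V C)) = (\<lambda>c. to_dual V C (down C c)) ` carrier C"
    using *(2) by (simp add: image_image)
qed

end

section \<open>The dual of an arrow\<close>

abbreviation (input) double_dual :: "'u set family_property \<Rightarrow> 'u set family_property \<Rightarrow> 'u site \<Rightarrow> 'u \<Rightarrow> 'u" where
  "double_dual U V C \<equiv> \<lambda>c. name_of U (compacts V C) (to_dual V C (down C c))"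

abbreviation (input) dual_hom :: "'u set family_property \<Rightarrow> 'u site \<Rightarrow> 'u site \<Rightarrow> ('u \<Rightarrow> 'u) \<Rightarrow> 'u \<Rightarrow> 'u" where
  "dual_hom V \<equiv> on_arr (compacts_functor V)"

lemma dual_hom_def:
  "dual_hom V C C' h = (\<lambda>x\<in>carrier (compacts V C). name_of V C'
     (A_map C C' h (inv_into (carrier (comp_site V C)) (name_of V C) x)))"
  by (simp add: compacts_functor_def)

lemma on_obj_compacts [simp]: "on_obj (compacts_functor V) C = compacts V C"
  by (simp add: compacts_functor_def)

locale dual_pairs = C: dual_pair U V C D + C': dual_pair U V C' D'
  for U V :: "'u set family_property" and C D C' D' :: "'u site" +
  fixes h :: "'u \<Rightarrow> 'u"
  assumes h_ext: "h \<in> ext_homs V C C'"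
begin

lemma h_props: "h \<in> carrier C \<rightarrow>\<^sub>E carrier C'" "site_morphism C C' h"
  "\<And>b. b \<in> compact_elements V (Id_frame C) \<Longrightarrow> A_map C C' h b \<in> compact_elements V (Id_frame C')"
  "site_morphism (comp_site V C) (comp_site V C') (A_map C C' h)"
  using h_ext unfolding ext_homs_def by blast+

lemma dual_hom_name:
  "b \<in> compact_elements V (Id_frame C) \<Longrightarrow>
    dual_hom V C C' h (name_of V C b) = name_of V C' (A_map C C' h b)"
  by (simp add: dual_hom_def C.name_of_in C.name_of_inv[simplified])

lemma dual_hom_morphism:
  "dual_hom V C C' h \<in> carrier (compacts V C) \<rightarrow>\<^sub>E carrier (compacts V C')"
  "site_morphism (compacts V C) (compacts V C') (dual_hom V C C' h)"
proof -
  let ?\<theta> = "inv_into (carrier (comp_site V C)) (name_of V C)"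
  have inv: "site_iso (compacts V C) (comp_site V C) ?\<theta>"
    by (rule site_iso_inv[OF C.copy(2) comp_site_cov_lower(1)[OF C.C.poset_site_axioms]])
  have "site_morphism (compacts V C) (comp_site V C') (A_map C C' h \<circ> ?\<theta>)"
    by (rule site_morphism_comp[OF site_iso_morphism[OF inv C.T.cov_lower_set] h_props(4) C.T.cov_subset])
  moreover have "site_morphism (comp_site V C') (compacts V C') (name_of V C')"
    by (rule site_iso_morphism[OF C'.copy(2) comp_site_cov_lower(2)[OF C'.C.poset_site_axioms]])
  ultimately have "site_morphism (compacts V C) (compacts V C') (name_of V C' \<circ> (A_map C C' h \<circ> ?\<theta>))"
    using C.T.cov_subset by (rule site_morphism_comp)
  then show m: "site_morphism (compacts V C) (compacts V C') (dual_hom V C C' h)"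
    by (rule site_morphism_cong[OF _ _ C.T.cov_subset]) (simp_all add: dual_hom_def)
  show "dual_hom V C C' h \<in> carrier (compacts V C) \<rightarrow>\<^sub>E carrier (compacts V C')"
    using site_morphism_maps[OF m] by (simp add: PiE_def) (simp add: dual_hom_def)
qed

text \<open>Both sides are determined by what happens to the compact elements below \<open>I\<close>. For the inclusion from
  right to left, the ideal on the left has the form \<open>to_dual V C' K\<close>; the preimage of \<open>K\<close> under \<open>h\<close> is an
  ideal that contains all compact elements below \<open>I\<close>, hence \<open>I\<close>, the compact elements being a basis.\<close>

lemma to_dual_natural:
  assumes I: "is_ideal C I"
  shows "A_map (compacts V C) (compacts V C') (dual_hom V C C' h) (to_dual V C I)
    = to_dual V C' (A_map C C' h I)"
proof -
  let ?T = "compacts V C" and ?T' = "compacts V C'" and ?k = "dual_hom V C C' h"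
  let ?B = "{b \<in> compact_elements V (Id_frame C). b \<subseteq> I}"
  let ?J = "A_map ?T ?T' ?k (to_dual V C I)"
  have AI: "is_ideal C' (A_map C C' h I)"
    by (rule A_map_ideal[OF C'.C.poset_site_axioms site_morphism_maps[OF h_props(2)] I])
  have \<Phi>I: "is_ideal ?T (to_dual V C I)" using order_iso_in[OF C.to_dual_iso] I by simp
  have \<Phi>AI: "is_ideal ?T' (to_dual V C' (A_map C C' h I))"
    using order_iso_in[OF C'.to_dual_iso] AI by simp
  have J: "is_ideal ?T' ?J"
    by (rule A_map_ideal[OF C'.T.poset_site_axioms site_morphism_maps[OF dual_hom_morphism(2)] \<Phi>I])
  have img: "?k ` to_dual V C I = name_of V C' ` A_map C C' h ` ?B"
    unfolding to_dual_def image_image by (intro image_cong refl) (simp add: dual_hom_name)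
  have mono: "A_map C C' h b \<subseteq> A_map C C' h I" if "is_ideal C b" "b \<subseteq> I" for b
  proof -
    have "h ` I \<subseteq> A_map C C' h I" using ideal_hull_superset[of "h ` I" C'] by (simp add: A_map_eq I)
    then show ?thesis using that A_map_subset_iff[OF that(1) AI] by auto
  qed
  have "?k ` to_dual V C I \<subseteq> to_dual V C' (A_map C C' h I)"
    unfolding img unfolding to_dual_def using h_props(3) mono compact_ideal by blast
  then have "?J \<subseteq> to_dual V C' (A_map C C' h I)"
    using A_map_subset_iff[OF \<Phi>I \<Phi>AI] by blast
  moreover have "to_dual V C' (A_map C C' h I) \<subseteq> ?J"
  proof -
    have "?J \<in> to_dual V C' ` carrier (Id_frame C')"
      unfolding order_iso_carrier[OF C'.to_dual_iso] using J by simp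
    then obtain K where K: "is_ideal C' K" "?J = to_dual V C' K" by auto
    \<comment> \<open>The right adjoint of \<open>A_map C C' h\<close>, applied to \<open>K\<close>.\<close>
    let ?P = "{c \<in> carrier C. h c \<in> K}"
    have P: "is_ideal C ?P" by (rule C.C.site_morphism_comap_ideal[OF h_props(2) K(1)])
    have "b \<subseteq> ?P" if b: "b \<in> ?B" for b
    proof -
      have bi: "is_ideal C b" using b compact_ideal by blast
      have "name_of V C' (A_map C C' h b) \<in> ?k ` to_dual V C I" unfolding img using b by blast
      also have "\<dots> \<subseteq> to_dual V C' K"
        using ideal_hull_superset[of "?k ` to_dual V C I" ?T'] K(2) by (simp add: A_map_eq \<Phi>I)
      finally obtain b' where b': "b' \<in> compact_elements V (Id_frame C')" "b' \<subseteq> K"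
        "name_of V C' (A_map C C' h b) = name_of V C' b'"
        by (auto simp: to_dual_def)
      have "A_map C C' h b \<in> compact_elements V (Id_frame C')" using h_props(3) b by blast
      then have "A_map C C' h b = b'" using b' C'.name_of_inv by metis
      then have "A_map C C' h b \<subseteq> K" using b'(2) by simp
      then have "h ` b \<subseteq> K" using A_map_subset_iff[OF bi K(1)] by blast
      then show ?thesis using ideal_subset[OF bi] by blast
    qed
    then have "ideal_hull C (\<Union>?B) \<subseteq> ?P" by (intro ideal_hull_least[OF P]) blast
    then have "I \<subseteq> ?P" by (simp only: C.sup_compact_below[OF I])
    then have "A_map C C' h I \<subseteq> K" using A_map_subset_iff[OF I K(1)] by blast
    then show ?thesis unfolding K(2) by (auto simp: to_dual_def)
  qed
  ultimately show ?thesis by simp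
qed

text \<open>Under the identification of \<open>C\<close> with the \<open>U\<close>-compact elements of \<open>Id_frame (compacts V C)\<close>, the map
  \<open>A_map\<close> of the dual arrow is \<open>h\<close>.\<close>

lemma principal_natural:
  assumes "c \<in> carrier C"
  shows "A_map (compacts V C) (compacts V C') (dual_hom V C C' h) (to_dual V C (down C c))
    = to_dual V C' (down C' (h c))"
  using to_dual_natural[OF C.C.ideal_down_set[OF assms]]
    A_map_down[OF C.C.subcanonical_site_axioms C'.C.subcanonical_site_axioms h_props(2) assms] by simp

text \<open>On \<open>U\<close>-compact elements \<open>A_map\<close> of the dual arrow is conjugate to \<open>h\<close>, so it preserves them and is a
  morphism of sites there because \<open>h\<close> is one.\<close>

lemma dual_hom_ext: "dual_hom V C C' h \<in> ext_homs U (compacts V C) (compacts V C')"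
proof -
  let ?T = "compacts V C" and ?T' = "compacts V C'" and ?k = "dual_hom V C C' h"
  let ?\<psi> = "\<lambda>c. to_dual V C (down C c)" and ?\<psi>' = "\<lambda>c. to_dual V C' (down C' c)"
  let ?\<rho> = "inv_into (carrier C) ?\<psi>"
  have inv: "site_iso (comp_site U ?T) C ?\<rho>"
    by (rule site_iso_inv[OF C.principal_site_iso(1) C.C.cov_subset])
  note low = comp_site_cov_lower[OF C.T.poset_site_axioms]
  have "site_morphism (comp_site U ?T) C' (h \<circ> ?\<rho>)"
    by (rule site_morphism_comp[OF site_iso_morphism[OF inv low(2)] h_props(2) low(1)])
  then have m: "site_morphism (comp_site U ?T) (comp_site U ?T') (?\<psi>' \<circ> (h \<circ> ?\<rho>))"
    by (rule site_morphism_comp[OF _ site_iso_morphism[OF C'.principal_site_iso(1) C'.C.cov_lower_set] low(1)])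
  have "A_map ?T ?T' ?k x = (?\<psi>' \<circ> (h \<circ> ?\<rho>)) x" if x: "x \<in> carrier (comp_site U ?T)" for x
  proof -
    have x': "x \<in> ?\<psi> ` carrier C" using x C.principal_site_iso(2) by simp
    then have "?\<rho> x \<in> carrier C" "?\<psi> (?\<rho> x) = x"
      by (simp_all add: inv_into_into f_inv_into_f[where f = ?\<psi>])
    then show ?thesis using principal_natural[of "?\<rho> x"] by simp
  qed
  then have "site_morphism (comp_site U ?T) (comp_site U ?T') (A_map ?T ?T' ?k)"
    using low(1) by (intro site_morphism_cong[OF m])
  moreover have "A_map ?T ?T' ?k ` compact_elements U (Id_frame ?T) \<subseteq> compact_elements U (Id_frame ?T')"
    unfolding C.principal_site_iso(2) C'.principal_site_iso(2)
    using principal_natural h_props(1) by (auto intro!: imageI)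
  ultimately show ?thesis using dual_hom_morphism by (simp add: ext_homs_def)
qed

lemma double_dual_natural:
  assumes "c \<in> carrier C"
  shows "dual_hom U (compacts V C) (compacts V C') (dual_hom V C C' h) (double_dual U V C c)
    = double_dual U V C' (h c)"
proof -
  let ?T = "compacts V C"
  interpret TC: dual_pair V U ?T C
    using C.dual_compacts C.U_inv C.V_inv by unfold_locales (rule dual_sites_sym)
  have "to_dual V C (down C c) \<in> compact_elements U (Id_frame ?T)"
    using assms C.principal_site_iso(2) by simp
  then show ?thesis
    using principal_natural[OF assms] TC.name_of_in TC.name_of_inv by (simp add: dual_hom_def)
qed

end

section \<open>The duality\<close>

text \<open>Two classes of sites in which every object has a dual in the other class. The assumptions are symmetric
  under exchanging the classes together with the invariants, so each result about one functor also
  holds for the other.\<close>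

locale dual_classes =
  fixes \<K> \<H> :: "'u site set" and U V :: "'u set family_property"
  assumes U_inv: "invariant_family_property U" and V_inv: "invariant_family_property V"
    and dual_of_K: "C \<in> obj (Ext \<K> V) \<Longrightarrow> \<exists>D\<in>obj (Ext \<H> U). dual_sites U V C D"
    and dual_of_H: "D \<in> obj (Ext \<H> U) \<Longrightarrow> \<exists>C\<in>obj (Ext \<K> V). dual_sites U V C D"
begin

lemma dual_pair:
  assumes "C \<in> obj (Ext \<K> V)"
  obtains D where "D \<in> obj (Ext \<H> U)" "dual_pair U V C D"
  using dual_of_K[OF assms] U_inv V_inv unfolding dual_pair_def by blast

lemma poset_site_K: "C \<in> obj (Ext \<K> V) \<Longrightarrow> poset_site C"
  using dual_of_K by (fastforce simp: dual_sites_def subcanonical_site_def)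

lemma poset_site_H: "D \<in> obj (Ext \<H> U) \<Longrightarrow> poset_site D"
  using dual_of_H by (fastforce simp: dual_sites_def subcanonical_site_def)

lemma category_K: "category (Ext \<K> V)"
  using poset_site_K V_inv by (rule category_Ext)

lemma category_H: "category (Ext \<H> U)"
  using poset_site_H U_inv by (rule category_Ext)

lemma compacts_in:
  assumes "C \<in> obj (Ext \<K> V)"
  shows "compacts V C \<in> obj (Ext \<H> U)"
proof -
  obtain D where D: "D \<in> obj (Ext \<H> U)" "dual_pair U V C D" using dual_pair[OF assms] .
  interpret dual_pair U V C D by fact
  \<comment> \<open>The copy need not be equal to \<open>D\<close>, but the class is closed under isomorphism.\<close>
  obtain D\<^sub>0 \<phi> where D\<^sub>0: "D\<^sub>0 \<in> \<H>" "site_iso D\<^sub>0 D \<phi>"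
    using D(1) by (auto simp: isomorphic_sites_def)
  obtain \<tau> where "site_iso D (compacts V C) \<tau>" using site_iso_compacts ..
  then have "site_iso D\<^sub>0 (compacts V C) (\<tau> \<circ> \<phi>)" by (rule site_iso_comp[OF D\<^sub>0(2)])
  then show ?thesis using D\<^sub>0(1) copy(1) by (auto simp: isomorphic_sites_def)
qed

lemma copy_map_iso:
  assumes "C \<in> obj (Ext \<K> V)"
  shows "site_iso (comp_site V C) (on_obj (compacts_functor V) C) (copy_map (comp_site V C))"
proof -
  obtain D where "dual_pair U V C D" using dual_pair[OF assms] by blast
  then interpret dual_pair U V C D .
  show ?thesis using copy(2) by simp
qed

lemma dual_pairs_hom:
  assumes "C \<in> obj (Ext \<K> V)" "C' \<in> obj (Ext \<K> V)" "h \<in> homs (Ext \<K> V) C C'"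
  obtains D D' where "dual_pairs U V C D C' D' h"
proof -
  obtain D where D: "dual_pair U V C D" using dual_pair[OF assms(1)] by blast
  obtain D' where D': "dual_pair U V C' D'" using dual_pair[OF assms(2)] by blast
  have "dual_pairs U V C D C' D' h"
    using D D' assms(3) by (simp add: dual_pairs_def dual_pairs_axioms_def)
  then show thesis by (rule that)
qed

lemma functor_compacts: "cat_functor (Ext \<K> V) (Ext \<H> U) (compacts_functor V)"
proof -
  interpret K: category "Ext \<K> V" by (rule category_K)
  interpret H: category "Ext \<H> U" by (rule category_H)
  show ?thesis
  proof
    show "on_obj (compacts_functor V) C \<in> obj (Ext \<H> U)" if "C \<in> obj (Ext \<K> V)" for C
      using compacts_in[OF that] by simp
  next
    fix C C' h assume h: "C \<in> obj (Ext \<K> V)" "C' \<in> obj (Ext \<K> V)" "h \<in> homs (Ext \<K> V) C C'"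
    obtain D D' where "dual_pairs U V C D C' D' h" using dual_pairs_hom[OF h] .
    then interpret dual_pairs U V C D C' D' h .
    show "dual_hom V C C' h \<in> homs (Ext \<H> U) (on_obj (compacts_functor V) C) (on_obj (compacts_functor V) C')"
      using dual_hom_ext by simp
  next
    fix C assume C: "C \<in> obj (Ext \<K> V)"
    obtain D where "dual_pair U V C D" using dual_pair[OF C] by blast
    then interpret dual_pair U V C D .
    have "dual_hom V C C (\<lambda>c\<in>carrier C. c) x = x" if x: "x \<in> carrier (compacts V C)" for x
    proof -
      obtain b where b: "b \<in> compact_elements V (Id_frame C)" "x = name_of V C b" using name_of_surj[OF x] .
      then show ?thesis
        using x name_of_inv A_map_ident[OF compact_ideal[OF b(1)], of "\<lambda>c\<in>carrier C. c"]
        by (simp add: dual_hom_def)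
    qed
    then show "dual_hom V C C (ide (Ext \<K> V) C) = ide (Ext \<H> U) (on_obj (compacts_functor V) C)"
      by (auto simp: fun_eq_iff) (simp add: dual_hom_def)
  next
    fix C C' C'' h k
    assume C: "C \<in> obj (Ext \<K> V)" "C' \<in> obj (Ext \<K> V)" "C'' \<in> obj (Ext \<K> V)"
      and h: "h \<in> homs (Ext \<K> V) C C'" and k: "k \<in> homs (Ext \<K> V) C' C''"
    obtain D D' where "dual_pairs U V C D C' D' h" using dual_pairs_hom[OF C(1,2) h] .
    then interpret h: dual_pairs U V C D C' D' h .
    obtain D1 D'' where "dual_pairs U V C' D1 C'' D'' k" using dual_pairs_hom[OF C(2,3) k] .
    then interpret k: dual_pairs U V C' D1 C'' D'' k .
    have "compose (carrier C) k h \<in> homs (Ext \<K> V) C C''"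
      using K.comp_in[OF C h k] by simp
    then obtain D2 D3 where "dual_pairs U V C D2 C'' D3 (compose (carrier C) k h)"
      using dual_pairs_hom[OF C(1,3)] by blast
    then interpret kh: dual_pairs U V C D2 C'' D3 "compose (carrier C) k h" .
    have "dual_hom V C C'' (compose (carrier C) k h) x = dual_hom V C' C'' k (dual_hom V C C' h x)"
      if x: "x \<in> carrier (compacts V C)" for x
    proof -
      obtain b where b: "b \<in> compact_elements V (Id_frame C)" "x = name_of V C b" using h.C.name_of_surj[OF x] .
      have "A_map C C'' (compose (carrier C) k h) b = A_map C' C'' k (A_map C C' h b)"
        using A_map_comp[OF h.C'.C.poset_site_axioms k.C'.C.poset_site_axioms
            site_morphism_maps[OF h.h_props(2)] k.h_props(2) compact_ideal[OF b(1)],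
            where l = "compose (carrier C) k h"]
        by (simp add: compose_def)
      then show ?thesis
        using b h.dual_hom_name[OF b(1)] kh.dual_hom_name[OF b(1)] k.dual_hom_name[OF h.h_props(3)[OF b(1)]]
        by simp
    qed
    then show "dual_hom V C C'' (comp (Ext \<K> V) C C' C'' k h) =
        comp (Ext \<H> U) (on_obj (compacts_functor V) C) (on_obj (compacts_functor V) C')
          (on_obj (compacts_functor V) C'') (dual_hom V C' C'' k) (dual_hom V C C' h)"
      by (auto simp: fun_eq_iff compose_def) (simp add: dual_hom_def)
  qed
qed

lemma dual_classes_sym: "dual_classes \<H> \<K> V U"
proof
  show "invariant_family_property V" "invariant_family_property U" by (rule V_inv U_inv)+
  show "\<exists>C\<in>obj (Ext \<K> V). dual_sites V U D C" if "D \<in> obj (Ext \<H> U)" for D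
    using dual_of_H[OF that] dual_sites_sym by blast
  show "\<exists>D\<in>obj (Ext \<H> U). dual_sites V U D C" if "C \<in> obj (Ext \<K> V)" for C
    using dual_of_K[OF that] dual_sites_sym by blast
qed

lemma double_dual_iso:
  assumes "C \<in> obj (Ext \<K> V)"
  shows "site_iso C (compacts U (compacts V C)) (double_dual U V C)"
proof -
  obtain D where "dual_pair U V C D" using dual_pair[OF assms] by blast
  then interpret dual_pair U V C D .
  interpret TC: dual_pair V U "compacts V C" C
    using dual_compacts U_inv V_inv by unfold_locales (rule dual_sites_sym)
  show ?thesis
    using site_iso_comp[OF principal_site_iso(1) TC.copy(2)] by (simp add: o_def)
qed

text \<open>The components are the inverses of the site isomorphisms \<open>double_dual U V C\<close>.\<close>

lemma double_dual_natural_iso: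
  "naturally_isomorphic (Ext \<K> V) (Ext \<K> V)
    (comp_functor (compacts_functor U) (compacts_functor V)) id_functor"
proof -
  interpret sym: dual_classes \<H> \<K> V U by (rule dual_classes_sym)
  let ?T = "\<lambda>C. compacts U (compacts V C)"
  let ?E = "\<lambda>C C' h. dual_hom U (compacts V C) (compacts V C') (dual_hom V C C' h)"
  define \<eta> where "\<eta> C = restrict (inv_into (carrier C) (double_dual U V C)) (carrier (?T C))" for C
  define \<iota> where "\<iota> C = restrict (double_dual U V C) (carrier C)" for C
  have T: "?T C \<in> obj (Ext \<K> V)" if "C \<in> obj (Ext \<K> V)" for C
    by (rule sym.compacts_in[OF compacts_in[OF that]])
  have iso: "bij_betw (double_dual U V C) (carrier C) (carrier (?T C))" if "C \<in> obj (Ext \<K> V)" for C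
    using site_iso_order_iso[OF double_dual_iso[OF that]] by (simp add: order_iso_def)
  have \<eta>_dd: "\<eta> C (double_dual U V C c) = c" "double_dual U V C c \<in> carrier (?T C)"
    if "C \<in> obj (Ext \<K> V)" "c \<in> carrier C" for C c
  proof -
    show "double_dual U V C c \<in> carrier (?T C)" by (rule bij_betwE[OF iso[OF that(1)], rule_format, OF that(2)])
    then show "\<eta> C (double_dual U V C c) = c"
      unfolding \<eta>_def using bij_betw_inv_into_left[OF iso[OF that(1)] that(2)] by simp
  qed
  have dd_surj: "\<exists>c\<in>carrier C. x = double_dual U V C c" if "C \<in> obj (Ext \<K> V)" "x \<in> carrier (?T C)" for C x
    using iso[OF that(1)] that(2) by (auto simp: bij_betw_def)
  have arrow: "iso_arrow (Ext \<K> V) (?T C) C (\<eta> C)" if C: "C \<in> obj (Ext \<K> V)" for C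
    unfolding iso_arrow_def
  proof (intro conjI bexI[of _ "\<iota> C"])
    note ps = poset_site_K[OF C] poset_site_K[OF T[OF C]]
    show "\<iota> C \<in> homs (Ext \<K> V) C (?T C)"
      using site_iso_ext_hom[OF ps double_dual_iso[OF C] V_inv] by (simp add: \<iota>_def)
    have "site_iso (?T C) C (inv_into (carrier C) (double_dual U V C))"
      by (rule site_iso_inv[OF double_dual_iso[OF C] poset_site.cov_subset[OF ps(1)]])
    then show "\<eta> C \<in> homs (Ext \<K> V) (?T C) C"
      using site_iso_ext_hom[OF ps(2,1) _ V_inv] by (simp add: \<eta>_def)
    show "comp (Ext \<K> V) (?T C) C (?T C) (\<iota> C) (\<eta> C) = ide (Ext \<K> V) (?T C)"
      using dd_surj[OF C] \<eta>_dd[OF C] by (fastforce simp: fun_eq_iff compose_def \<iota>_def)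
    show "comp (Ext \<K> V) C (?T C) C (\<eta> C) (\<iota> C) = ide (Ext \<K> V) C"
      using \<eta>_dd[OF C] by (simp add: fun_eq_iff compose_def \<iota>_def)
  qed
  have natural: "compose (carrier (?T C)) (\<eta> C') (?E C C' h) = compose (carrier (?T C)) h (\<eta> C)"
    if C: "C \<in> obj (Ext \<K> V)" "C' \<in> obj (Ext \<K> V)" and h: "h \<in> homs (Ext \<K> V) C C'" for C C' h
  proof -
    obtain D D' where "dual_pairs U V C D C' D' h" using dual_pairs_hom[OF C h] .
    then interpret dual_pairs U V C D C' D' h .
    have "\<eta> C' (?E C C' h x) = h (\<eta> C x)" if x: "x \<in> carrier (?T C)" for x
    proof -
      obtain c where c: "c \<in> carrier C" "x = double_dual U V C c" using dd_surj[OF C(1) x] by blast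
      then have "h c \<in> carrier C'" using h_props(1) by blast
      then show ?thesis
        using double_dual_natural[OF c(1)] c \<eta>_dd(1)[OF C(1)] \<eta>_dd(1)[OF C(2)] by simp
    qed
    then show ?thesis by (simp add: fun_eq_iff compose_def)
  qed
  show ?thesis
    unfolding naturally_isomorphic_def
  proof (intro exI[of _ \<eta>] conjI ballI)
    fix C assume "C \<in> obj (Ext \<K> V)"
    then show "iso_arrow (Ext \<K> V) (on_obj (comp_functor (compacts_functor U) (compacts_functor V)) C)
        (on_obj id_functor C) (\<eta> C)"
      using arrow by (simp add: comp_functor_def id_functor_def)
  next
    fix C C' h assume "C \<in> obj (Ext \<K> V)" "C' \<in> obj (Ext \<K> V)" "h \<in> homs (Ext \<K> V) C C'"
    then show "comp (Ext \<K> V)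
        (on_obj (comp_functor (compacts_functor U) (compacts_functor V)) C)
        (on_obj (comp_functor (compacts_functor U) (compacts_functor V)) C') (on_obj id_functor C') (\<eta> C')
        (on_arr (comp_functor (compacts_functor U) (compacts_functor V)) C C' h)
      = comp (Ext \<K> V)
        (on_obj (comp_functor (compacts_functor U) (compacts_functor V)) C) (on_obj id_functor C)
        (on_obj id_functor C') (on_arr id_functor C C' h) (\<eta> C)"
      using natural by (simp add: comp_functor_def id_functor_def)
  qed
qed

end

theorem theorem5p1:
  fixes \<K> \<H> :: "'u site set"
    and f g :: "'u site \<Rightarrow> 'u site"
    and U V :: "'u set family_property"
  assumes K_sites: "\<And>C. C \<in> \<K> \<Longrightarrow> poset_site C \<and> subcanonical C"
    and H_sites: "\<And>D. D \<in> \<H> \<Longrightarrow> poset_site D \<and> subcanonical D"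
    and f_maps: "f \<in> \<K> \<rightarrow> \<H>" and g_maps: "g \<in> \<H> \<rightarrow> \<K>"
    and gf_iso: "\<And>C. C \<in> \<K> \<Longrightarrow> isomorphic_sites (g (f C)) C"
    and fg_iso: "\<And>D. D \<in> \<H> \<Longrightarrow> isomorphic_sites (f (g D)) D"
    and sheaf_equiv: "\<And>C. C \<in> \<K> \<Longrightarrow> equivalent_categories
           (Sh C :: (('u, 's) presheaf, 'u \<Rightarrow> 's \<Rightarrow> 's) cat)
           (Sh (f C) :: (('u, 's) presheaf, 'u \<Rightarrow> 's \<Rightarrow> 's) cat)"
    and U_inv: "invariant_family_property U" and V_inv: "invariant_family_property V"
    and a_K: "\<And>C F. \<lbrakk>C \<in> \<K>; F \<subseteq> principal_ideals C\<rbrakk> \<Longrightarrow>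
           has_refinement (Id_frame C) U F \<longleftrightarrow> has_refinement_in (Id_frame C) (principal_ideals C) U F"
    and a_H: "\<And>D F. \<lbrakk>D \<in> \<H>; F \<subseteq> principal_ideals D\<rbrakk> \<Longrightarrow>
           has_refinement (Id_frame D) V F \<longleftrightarrow> has_refinement_in (Id_frame D) (principal_ideals D) V F"
    and b_K: "\<And>C. C \<in> \<K> \<Longrightarrow> induced_topology \<K> U C"
    and b_H: "\<And>D. D \<in> \<H> \<Longrightarrow> induced_topology \<H> V D"
  shows "(\<forall>C\<in>obj (Ext \<K> V).
           site_iso (comp_site V C) (on_obj (compacts_functor V) C) (copy_map (comp_site V C)))
       \<and> (\<forall>D\<in>obj (Ext \<H> U).
           site_iso (comp_site U D) (on_obj (compacts_functor U) D) (copy_map (comp_site U D)))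
       \<and> categorical_inverses (Ext \<K> V) (Ext \<H> U) (compacts_functor V) (compacts_functor U)
       \<and> equivalent_categories (Ext \<K> V) (Ext \<H> U)"
proof -
  have subK: "subcanonical_site C" if "C \<in> \<K>" for C
    using K_sites[OF that] by (simp add: subcanonical_site_def subcanonical_site_axioms_def)
  have subH: "subcanonical_site D" if "D \<in> \<H>" for D
    using H_sites[OF that] by (simp add: subcanonical_site_def subcanonical_site_axioms_def)
  have compK: "compact_elements U (Id_frame C) = principal_ideals C" if C: "C \<in> \<K>" for C
  proof -
    obtain P where P: "\<And>C'. C' \<in> \<K> \<Longrightarrow> P (Id_frame C') (down C' ` carrier C')" "induced_relative_to P U C"
      using b_K[OF C] unfolding induced_topology_def by blast
    show ?thesis by (rule compact_elements_principal[OF subK[OF C] a_K[OF C] P(2) P(1)[OF C]])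
  qed
  have compH: "compact_elements V (Id_frame D) = principal_ideals D" if D: "D \<in> \<H>" for D
  proof -
    obtain P where P: "\<And>D'. D' \<in> \<H> \<Longrightarrow> P (Id_frame D') (down D' ` carrier D')" "induced_relative_to P V D"
      using b_H[OF D] unfolding induced_topology_def by blast
    show ?thesis by (rule compact_elements_principal[OF subH[OF D] a_H[OF D] P(2) P(1)[OF D]])
  qed
  have dual: "dual_sites U V C (f C)" "f C \<in> \<H>" if C: "C \<in> \<K>" for C
  proof -
    show fC: "f C \<in> \<H>" using f_maps C by blast
    show "dual_sites U V C (f C)"
      using subK[OF C] subH[OF fC] compK[OF C] compH[OF fC]
        equivalent_sheaves_order_iso_ideals[OF subK[OF C] subH[OF fC] sheaf_equiv[OF C]]
      by (simp add: dual_sites_def)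
  qed
  have objK: "C \<in> obj (Ext \<K> V)" if "C \<in> \<K>" for C
    using that K_sites[OF that] site_iso_refl[of C]
    by (auto simp: isomorphic_sites_def poset_site_def partial_order_def)
  have objH: "D \<in> obj (Ext \<H> U)" if "D \<in> \<H>" for D
    using that H_sites[OF that] site_iso_refl[of D]
    by (auto simp: isomorphic_sites_def poset_site_def partial_order_def)
  interpret dual_classes \<K> \<H> U V
  proof
    show "invariant_family_property U" "invariant_family_property V" by fact+
  next
    fix C assume "C \<in> obj (Ext \<K> V)"
    then obtain C\<^sub>0 \<phi> where C: "C\<^sub>0 \<in> \<K>" "partial_order C" "site_iso C\<^sub>0 C \<phi>"
      by (auto simp: isomorphic_sites_def)
    then show "\<exists>D\<in>obj (Ext \<H> U). dual_sites U V C D"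
      using dual_sites_iso[OF dual(1)[OF C(1)] U_inv C(2,3)] objH[OF dual(2)[OF C(1)]] by blast
  next
    fix D assume "D \<in> obj (Ext \<H> U)"
    then obtain D\<^sub>0 \<phi> where D: "D\<^sub>0 \<in> \<H>" "partial_order D" "site_iso D\<^sub>0 D \<phi>"
      by (auto simp: isomorphic_sites_def)
    have gD: "g D\<^sub>0 \<in> \<K>" using g_maps D(1) by blast
    \<comment> \<open>The sheaf equivalence is available for \<open>g D\<^sub>0\<close> and \<open>f (g D\<^sub>0)\<close>, and the latter is isomorphic to \<open>D\<^sub>0\<close>.\<close>
    obtain \<psi> where "site_iso (f (g D\<^sub>0)) D\<^sub>0 \<psi>" using fg_iso[OF D(1)] by (auto simp: isomorphic_sites_def)
    then have "site_iso (f (g D\<^sub>0)) D (\<phi> \<circ> \<psi>)" using D(3) by (rule site_iso_comp)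
    then have "dual_sites V U D (g D\<^sub>0)"
      by (rule dual_sites_iso[OF dual_sites_sym[OF dual(1)[OF gD]] V_inv D(2)])
    then show "\<exists>C\<in>obj (Ext \<K> V). dual_sites U V C D"
      using objK[OF gD] dual_sites_sym by blast
  qed
  interpret sym: dual_classes \<H> \<K> V U by (rule dual_classes_sym)
  have "categorical_inverses (Ext \<K> V) (Ext \<H> U) (compacts_functor V) (compacts_functor U)"
    unfolding categorical_inverses_def
    using functor_compacts sym.functor_compacts double_dual_natural_iso sym.double_dual_natural_iso by simp
  then show ?thesis
    using copy_map_iso sym.copy_map_iso unfolding equivalent_categories_def by blast
qed

end
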